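(* Suppose $F:\mathbb{R}^d\to\mathbb{R}$ attains minimum value $0$ and satisfies third-order self-bounding regularity with functions $\rho_1,\rho_2$. Let $\epsilon>0$ be a tolerance and $w_0\in\mathbb{R}^d$. For any $\delta\in(0,1)$, there is a choice of the step size $\eta$ and of the other parameters $(r,g_{\mathrm{thres}},f_{\mathrm{thres}},t_{\mathrm{thres}})$ of Perturbed GD, depending on $\epsilon$, $\delta$, $d$ and $F(w_0)$, such that if Perturbed GD is run from the initialization $w_0$ with these parameters, then with probability at least $1-\delta$, within $$T=O\left(\frac{1}{\epsilon^2}\log^4\left(\frac{d}{\epsilon\delta}\right)\right)$$ oracle calls to $\nabla F(\cdot)$, Perturbed GD outputs $T$ candidate vectors $w$, one of which satisfies $$\|\nabla F(w)\|\le\epsilon,\qquad\nabla^2F(w)\succeq-\sqrt{\epsilon}\,I.$$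
   Context: $\|\cdot\|$ is the Euclidean norm, $\|\cdot\|_{\mathrm{op}}$ the operator norm (of matrices and third-order tensors), $I$ the $d\times d$ identity, and $\succeq$ the positive semidefinite order. Second-order self-bounding regularity: $F$ is twice differentiable and there is a non-decreasing $\rho_1:\mathbb{R}_{\ge0}\to\mathbb{R}_{\ge0}$ with $\|\nabla^2F(w)\|_{\mathrm{op}}\le\rho_1(F(w))$ for all $w\in\mathbb{R}^d$. Third-order self-bounding regularity: $F$ satisfies second-order self-bounding regularity and, for some non-decreasing $\rho_2:\mathbb{R}_{\ge0}\to\mathbb{R}_{\ge0}$, either (i) $F$ is three times differentiable everywhere and $\|\nabla^3F(w)\|_{\mathrm{op}}\le\rho_2(F(w))$ for all $w$; or (ii) for some constant $\delta_0>0$, $\|\nabla^2F(w)-\nabla^2F(w')\|_{\mathrm{op}}\le\rho_2(F(w))\|w-w'\|$ for all $w,w'\in\mathbb{R}^d$ with $\|w-w'\|\le\delta_0$. Perturbed GD with parameters $(\eta,r,g_{\mathrm{thres}},f_{\mathrm{thres}},t_{\mathrm{thres}})$ proceeds in rounds, the current point $u$ being initially $w_0$. In each round: if $\|\nabla F(u)\|>g_{\mathrm{thres}}$, replace $u$ by $u-\eta\nabla F(u)$ (one oracle call). Otherwise, set $p_0=u+\xi$ with $\xi$ drawn uniformly (independently of the past) from the Euclidean ball of radius $r$ centered at the origin, and compute $p_i=p_{i-1}-\eta\nabla F(p_{i-1})$ for $1\le i\le t_{\mathrm{thres}}$; if $F(p_{t_{\mathrm{thres}}})-F(u)>-f_{\mathrm{thres}}$,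 return $u$ and stop, else replace $u$ by $p_{t_{\mathrm{thres}}}$ and start the next round. The candidate vectors output are the points $u$ at the start of the rounds (including the returned point). $O(\cdot)$ hides universal constants and dependence on $F(w_0)$ (through $\rho_1,\rho_2$).
   Formalization: The bound on T is read as at most a constant times the maximum of 1 and log^4(d/(εδ))/ε^2, since that expression can be 0 (e.g. d=1, ε=2, δ=1/2), which would leave no candidates. *)

theory Defs
  imports "HOL-Probability.Probability"
begin

section \<open>Euclidean space of variable dimension\<close>

text \<open>
  The constant hidden in the O-notation must not depend on the dimension \<open>d\<close>, so \<open>d\<close> is
  quantified inside the statement and cannot be encoded in a type.  All the spaces \<open>\<real>\<^sup>d\<close> are
  therefore realised inside one inner product space, that of the finitely supported real
  sequences, as the subspace of the sequences that vanish from index \<open>d\<close> on.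
\<close>

typedef rvec = "{x :: nat \<Rightarrow> real. finite {i. x i \<noteq> 0}}"
  morphisms coord Abs_rvec
  by (rule exI[of _ "\<lambda>_. 0"]) simp

setup_lifting type_definition_rvec

lemma finite_coord: "finite {i. coord x i \<noteq> 0}"
  using coord[of x] by simp

lemma rvec_eqI: "(\<And>i. coord x i = coord y i) \<Longrightarrow> x = y"
  by (simp add: coord_inject[symmetric] fun_eq_iff)

instantiation rvec :: real_vector
begin

lift_definition zero_rvec :: rvec is "\<lambda>_. 0"
  by simp

lift_definition plus_rvec :: "rvec \<Rightarrow> rvec \<Rightarrow> rvec" is "\<lambda>x y i. x i + y i"
  subgoal for x y
    by (rule finite_subset[of _ "{i. x i \<noteq> 0} \<union> {i. y i \<noteq> 0}"]) auto
  done

lift_definition uminus_rvec :: "rvec \<Rightarrow> rvec" is "\<lambda>x i. - x i"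
  by simp

lift_definition minus_rvec :: "rvec \<Rightarrow> rvec \<Rightarrow> rvec" is "\<lambda>x y i. x i - y i"
  subgoal for x y
    by (rule finite_subset[of _ "{i. x i \<noteq> 0} \<union> {i. y i \<noteq> 0}"]) auto
  done

lift_definition scaleR_rvec :: "real \<Rightarrow> rvec \<Rightarrow> rvec" is "\<lambda>c x i. c * x i"
  by (erule rev_finite_subset) auto

instance
  by standard (transfer; simp add: fun_eq_iff algebra_simps)+

end

instantiation rvec :: real_inner
begin

definition inner_rvec :: "rvec \<Rightarrow> rvec \<Rightarrow> real" where
  "inner_rvec x y = (\<Sum>i | coord x i \<noteq> 0. coord x i * coord y i)"

definition norm_rvec :: "rvec \<Rightarrow> real" where
  "norm_rvec x = sqrt (inner x x)"

definition dist_rvec :: "rvec \<Rightarrow> rvec \<Rightarrow> real" where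
  "dist_rvec x y = norm (x - y)"

definition sgn_rvec :: "rvec \<Rightarrow> rvec" where
  "sgn_rvec x = x /\<^sub>R norm x"

definition uniformity_rvec :: "(rvec \<times> rvec) filter" where
  "uniformity_rvec = (INF e\<in>{0<..}. principal {(x, y). dist x y < e})"

definition open_rvec :: "rvec set \<Rightarrow> bool" where
  "open_rvec U \<longleftrightarrow> (\<forall>x\<in>U. \<forall>\<^sub>F (x', y) in uniformity. x' = x \<longrightarrow> y \<in> U)"

lemma inner_rvec_superset:
  assumes "finite A" "{i. coord x i \<noteq> 0} \<subseteq> A"
  shows "inner x y = (\<Sum>i\<in>A. coord x i * coord y i)"
  unfolding inner_rvec_def
  by (rule sum.mono_neutral_left) (use assms in auto)

instance
proof
  fix x y z :: rvec and c :: real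
  let ?A = "{i. coord x i \<noteq> 0} \<union> {i. coord y i \<noteq> 0}"
  have A: "finite ?A"
    using finite_coord by simp
  have inner: "inner u v = (\<Sum>i\<in>?A. coord u i * coord v i)"
    if "{i. coord u i \<noteq> 0} \<subseteq> ?A" for u v
    using inner_rvec_superset[OF A that] .
  have "inner x y = (\<Sum>i\<in>?A. coord x i * coord y i)" "inner y x = (\<Sum>i\<in>?A. coord y i * coord x i)"
    by (rule inner, blast)+
  then show "inner x y = inner y x"
    by (simp add: mult.commute)
  have "inner x z = (\<Sum>i\<in>?A. coord x i * coord z i)" "inner y z = (\<Sum>i\<in>?A. coord y i * coord z i)"
    by (rule inner, blast)+
  moreover have "inner (x + y) z = (\<Sum>i\<in>?A. coord (x + y) i * coord z i)"
    by (rule inner) (auto simp: plus_rvec.rep_eq)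
  ultimately show "inner (x + y) z = inner x z + inner y z"
    by (simp add: plus_rvec.rep_eq algebra_simps sum.distrib)
  have "inner (c *\<^sub>R x) y = (\<Sum>i\<in>?A. coord (c *\<^sub>R x) i * coord y i)"
    by (rule inner) (auto simp: scaleR_rvec.rep_eq)
  moreover have "inner x y = (\<Sum>i\<in>?A. coord x i * coord y i)"
    by (rule inner) blast
  ultimately show "inner (c *\<^sub>R x) y = c * inner x y"
    by (simp add: scaleR_rvec.rep_eq sum_distrib_left mult.assoc)
  show "0 \<le> inner x x"
    by (simp add: inner_rvec_def sum_nonneg)
  show "inner x x = 0 \<longleftrightarrow> x = 0"
  proof
    assume "inner x x = 0"
    then have "\<forall>i\<in>{i. coord x i \<noteq> 0}. coord x i * coord x i = 0"
      by (subst (asm) inner_rvec_def, subst (asm) sum_nonneg_eq_0_iff) (auto simp: finite_coord)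
    then show "x = 0"
      by (intro rvec_eqI) (auto simp: zero_rvec.rep_eq)
  qed (simp add: inner_rvec_def zero_rvec.rep_eq)
qed (rule norm_rvec_def dist_rvec_def sgn_rvec_def uniformity_rvec_def open_rvec_def)+

end

definition Rspace :: "nat \<Rightarrow> rvec set" where
  "Rspace d = {x. \<forall>i\<ge>d. coord x i = 0}"

text \<open>The linear isometry from coordinate tuples (arguments outside \<open>{..<d}\<close> are ignored) onto
  \<^term>\<open>Rspace d\<close>; it carries the \<open>d\<close>-dimensional Lebesgue measure over.\<close>

definition vec_of :: "nat \<Rightarrow> (nat \<Rightarrow> real) \<Rightarrow> rvec" where
  "vec_of d x = Abs_rvec (\<lambda>i. if i < d then x i else 0)"

definition lborel_Rspace :: "nat \<Rightarrow> rvec measure" where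
  "lborel_Rspace d =
     distr (Pi\<^sub>M {..<d} (\<lambda>_. lborel)) (restrict_space borel (Rspace d)) (vec_of d)"

definition uniform_ball :: "nat \<Rightarrow> real \<Rightarrow> rvec measure" where
  "uniform_ball d r = uniform_measure (lborel_Rspace d) (Rspace d \<inter> cball 0 r)"


section \<open>Derivatives on the subspace \<open>\<real>\<^sup>d\<close>\<close>

text \<open>
  Functions are total on \<^typ>\<open>rvec\<close>, but only their values on \<^term>\<open>Rspace d\<close> matter: all
  derivatives are Frechet derivatives within this subspace.  They are unique only as maps on
  \<^term>\<open>Rspace d\<close>, so the norms and the semidefinite order below test vectors of
  \<^term>\<open>Rspace d\<close> only (which is why \<^const>\<open>onorm\<close> is not used).
\<close>

definition grad :: "nat \<Rightarrow> (rvec \<Rightarrow> real) \<Rightarrow> rvec \<Rightarrow> rvec" where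
  "grad d F w =
     (THE g. g \<in> Rspace d \<and> (F has_derivative (\<lambda>h. g \<bullet> h)) (at w within Rspace d))"

definition hess :: "nat \<Rightarrow> (rvec \<Rightarrow> real) \<Rightarrow> rvec \<Rightarrow> rvec \<Rightarrow> rvec" where
  "hess d F w = frechet_derivative (grad d F) (at w within Rspace d)"

definition third_deriv :: "nat \<Rightarrow> (rvec \<Rightarrow> real) \<Rightarrow> rvec \<Rightarrow> rvec \<Rightarrow> rvec \<Rightarrow> rvec \<Rightarrow> real" where
  "third_deriv d F w h k l =
     frechet_derivative (\<lambda>v. hess d F v h) (at w within Rspace d) k \<bullet> l"

definition twice_differentiable :: "nat \<Rightarrow> (rvec \<Rightarrow> real) \<Rightarrow> bool" where
  "twice_differentiable d F \<longleftrightarrow>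
     F differentiable_on Rspace d \<and> grad d F differentiable_on Rspace d"

text \<open>In finite dimension the operator-valued map \<open>v \<mapsto> hess d F v\<close> is differentiable iff it is
  differentiable when evaluated at every fixed vector.\<close>

definition thrice_differentiable :: "nat \<Rightarrow> (rvec \<Rightarrow> real) \<Rightarrow> bool" where
  "thrice_differentiable d F \<longleftrightarrow>
     twice_differentiable d F \<and> (\<forall>h\<in>Rspace d. (\<lambda>v. hess d F v h) differentiable_on Rspace d)"

definition op_norm :: "nat \<Rightarrow> (rvec \<Rightarrow> rvec) \<Rightarrow> real" where
  "op_norm d A = (SUP h\<in>Rspace d \<inter> cball 0 1. norm (A h))"

definition tensor_op_norm :: "nat \<Rightarrow> (rvec \<Rightarrow> rvec \<Rightarrow> rvec \<Rightarrow> real) \<Rightarrow> real" where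
  "tensor_op_norm d A =
     (let B = Rspace d \<inter> cball 0 1 in SUP (h, k, l)\<in>B \<times> B \<times> B. \<bar>A h k l\<bar>)"

text \<open>Applied only to Hessians shifted by a multiple of the identity, which are symmetric, so no
  symmetry clause is needed.\<close>

definition psd :: "nat \<Rightarrow> (rvec \<Rightarrow> rvec) \<Rightarrow> bool" where
  "psd d A \<longleftrightarrow> (\<forall>v\<in>Rspace d. 0 \<le> v \<bullet> A v)"


section \<open>Self-bounding regularity\<close>

definition self_bound_fun :: "(real \<Rightarrow> real) \<Rightarrow> bool" where
  "self_bound_fun \<rho> \<longleftrightarrow> mono_on {0..} \<rho> \<and> (\<forall>x\<ge>0. 0 \<le> \<rho> x)"

definition second_order_self_bounding ::
    "nat \<Rightarrow> (rvec \<Rightarrow> real) \<Rightarrow> (real \<Rightarrow> real) \<Rightarrow> bool" where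
  "second_order_self_bounding d F \<rho>1 \<longleftrightarrow>
     twice_differentiable d F \<and> self_bound_fun \<rho>1 \<and>
     (\<forall>w\<in>Rspace d. op_norm d (hess d F w) \<le> \<rho>1 (F w))"

definition third_order_self_bounding ::
    "nat \<Rightarrow> (rvec \<Rightarrow> real) \<Rightarrow> (real \<Rightarrow> real) \<Rightarrow> (real \<Rightarrow> real) \<Rightarrow> bool" where
  "third_order_self_bounding d F \<rho>1 \<rho>2 \<longleftrightarrow>
     second_order_self_bounding d F \<rho>1 \<and> self_bound_fun \<rho>2 \<and>
     ((thrice_differentiable d F \<and>
       (\<forall>w\<in>Rspace d. tensor_op_norm d (third_deriv d F w) \<le> \<rho>2 (F w))) \<or>
      (\<exists>\<delta>0>0. \<forall>w\<in>Rspace d. \<forall>w'\<in>Rspace d. norm (w - w') \<le> \<delta>0 \<longrightarrow>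
         op_norm d (\<lambda>h. hess d F w h - hess d F w' h) \<le> \<rho>2 (F w) * norm (w - w')))"

definition has_min_value_zero :: "nat \<Rightarrow> (rvec \<Rightarrow> real) \<Rightarrow> bool" where
  "has_min_value_zero d F \<longleftrightarrow> (\<forall>w\<in>Rspace d. 0 \<le> F w) \<and> (\<exists>w\<in>Rspace d. F w = 0)"


section \<open>Perturbed gradient descent\<close>

text \<open>
  The run is a deterministic function of a sequence \<open>\<xi>\<close> of perturbations, of which round \<open>k\<close> uses
  \<open>\<xi> k\<close> if it perturbs at all; under \<open>pgd_noise\<close> these are independent and uniform on the ball.
  A round yields the next point, or \<^const>\<open>None\<close> if the algorithm returns.
\<close>

definition gd_step :: "nat \<Rightarrow> (rvec \<Rightarrow> real) \<Rightarrow> real \<Rightarrow> rvec \<Rightarrow> rvec" where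
  "gd_step d F \<eta> u = u - \<eta> *\<^sub>R grad d F u"

definition pgd_round ::
    "nat \<Rightarrow> (rvec \<Rightarrow> real) \<Rightarrow> real \<Rightarrow> real \<Rightarrow> real \<Rightarrow> nat \<Rightarrow> rvec \<Rightarrow> rvec \<Rightarrow> rvec option" where
  "pgd_round d F \<eta> gthres fthres tthres z u =
     (if norm (grad d F u) > gthres then Some (gd_step d F \<eta> u)
      else let p = (gd_step d F \<eta> ^^ tthres) (u + z)
           in if F p - F u > - fthres then None else Some p)"

text \<open>The point at the start of round \<open>k\<close>, or \<^const>\<open>None\<close> if the algorithm has returned before.\<close>

primrec pgd_candidate ::
    "nat \<Rightarrow> (rvec \<Rightarrow> real) \<Rightarrow> real \<Rightarrow> real \<Rightarrow> real \<Rightarrow> nat \<Rightarrow> rvec \<Rightarrow> (nat \<Rightarrow> rvec) \<Rightarrow> nat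
      \<Rightarrow> rvec option" where
  "pgd_candidate d F \<eta> gthres fthres tthres w0 \<xi> 0 = Some w0"
| "pgd_candidate d F \<eta> gthres fthres tthres w0 \<xi> (Suc k) =
     Option.bind (pgd_candidate d F \<eta> gthres fthres tthres w0 \<xi> k)
       (pgd_round d F \<eta> gthres fthres tthres (\<xi> k))"

text \<open>Gradient evaluations in one round from \<open>u\<close>: the one at \<open>u\<close>, needed for the test and reused
  for the gradient step, and those at \<open>p\<^sub>0, \<dots>, p\<^bsub>tthres - 1\<^esub>\<close> if the round perturbs.\<close>

definition round_calls :: "nat \<Rightarrow> (rvec \<Rightarrow> real) \<Rightarrow> real \<Rightarrow> nat \<Rightarrow> rvec \<Rightarrow> nat" where
  "round_calls d F gthres tthres u = (if norm (grad d F u) > gthres then 1 else 1 + tthres)"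

text \<open>Gradient evaluations in the first \<open>n\<close> rounds.\<close>

definition pgd_calls ::
    "nat \<Rightarrow> (rvec \<Rightarrow> real) \<Rightarrow> real \<Rightarrow> real \<Rightarrow> real \<Rightarrow> nat \<Rightarrow> rvec \<Rightarrow> (nat \<Rightarrow> rvec) \<Rightarrow> nat \<Rightarrow> nat" where
  "pgd_calls d F \<eta> gthres fthres tthres w0 \<xi> n =
     (\<Sum>k<n. case pgd_candidate d F \<eta> gthres fthres tthres w0 \<xi> k of
                None \<Rightarrow> 0
              | Some u \<Rightarrow> round_calls d F gthres tthres u)"

definition pgd_noise :: "nat \<Rightarrow> real \<Rightarrow> (nat \<Rightarrow> rvec) measure" where
  "pgd_noise d r = Pi\<^sub>M UNIV (\<lambda>_. uniform_ball d r)"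

text \<open>\<open>u\<close> is one of the first \<open>T\<close> candidates, and the rounds up to and including the one that
  starts at \<open>u\<close> make at most \<open>T\<close> oracle calls.\<close>

definition pgd_outputs_within ::
    "nat \<Rightarrow> (rvec \<Rightarrow> real) \<Rightarrow> real \<Rightarrow> real \<Rightarrow> real \<Rightarrow> nat \<Rightarrow> rvec \<Rightarrow> (nat \<Rightarrow> rvec) \<Rightarrow> nat \<Rightarrow> rvec
      \<Rightarrow> bool" where
  "pgd_outputs_within d F \<eta> gthres fthres tthres w0 \<xi> T u \<longleftrightarrow>
     (\<exists>k<T. pgd_candidate d F \<eta> gthres fthres tthres w0 \<xi> k = Some u \<and>
            pgd_calls d F \<eta> gthres fthres tthres w0 \<xi> (Suc k) \<le> T)"

end

theory Submission
  imports Defs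
begin

text \<open>
  On the sublevel set of the start point, self-bounding regularity makes gradients and Hessians
  bounded and the Hessian Lipschitz near each point; in case (ii) of the regularity the radius
  \<open>\<delta>\<^sub>0\<close> plays no role, since the Lipschitz bound chains along segments on which \<open>F\<close> is bounded.
  Gradient descent with step \<open>1 / M\<close> then decreases \<open>F\<close> by \<open>\<parallel>\<nabla>F\<parallel>\<^sup>2 / (2 * M)\<close> per step, so iterates that
  hardly decrease \<open>F\<close> remain near the point where they started.  If two such sequences start around a
  strict saddle at an offset \<open>\<mu> * e\<close> along a Hessian eigenvector \<open>e\<close> with eigenvalue below \<open>-sqrt \<epsilon>\<close>, their
  difference grows like \<open>\<bar>\<mu>\<bar> * (1 + sqrt \<epsilon> / M) ^ t\<close>, which forces \<open>\<bar>\<mu>\<bar>\<close> to be tiny.  The set of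
  perturbations that fail to escape is hence thin in direction \<open>e\<close>, and packing disjoint translates
  of it into a slightly larger ball bounds its probability, without rotating coordinates.  Outside
  these failures every oracle call pays for a fixed decrease of \<open>F \<ge> 0\<close>.
\<close>

section \<open>Euclidean structure of the coordinate subspaces\<close>

text \<open>All constants must come from \<open>\<rho>1\<close>, \<open>\<rho>2\<close> and the
  start value alone, before dimension, tolerance and objective are given; hence \<open>M\<close>,
  \<open>R\<close> and \<open>\<rho>\<close> are read off at levels of \<open>F\<close>, never at
  points. Rounds start at level at most \<open>f0\<close> and a perturbation adds at most
  \<open>fth \<le> 1\<close>. The curvature bound and the bound on \<open>F\<close> depend on each
  other, so the curvature is controlled up to \<open>f0 + 2\<close>: the extra unit is the strict
  room that lets both be propagated along a segment. The fourth power of the logarithm comes from a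
  balance, with s = sqrt \<epsilon>. Growth by a factor exp (\<iota> / 2) takes n of order \<iota> /
  s steps. The linearisation survives n steps within a radius S of order 1 / n. Iterates are
  confined to that radius when the drop of F is at most of order S^2 / n, and a drop of this size
  has to pay for n + 1 calls. Each call thus gains order S^2 / n^2, that is (s / \<iota>)^4 =
  \<epsilon>^2 / \<iota>^4.\<close>

definition unit_rvec :: "nat \<Rightarrow> rvec" where
  "unit_rvec i = Abs_rvec (\<lambda>j. if j = i then 1 else 0)"

lemma coord_unit_rvec: "coord (unit_rvec i) j = (if j = i then 1 else 0)"
  unfolding unit_rvec_def by (subst Abs_rvec_inverse) auto

lemma inner_unit_rvec: "x \<bullet> unit_rvec i = coord x i"
proof -
  have "unit_rvec i \<bullet> x = coord x i"
    by (subst inner_rvec_superset[of "{i}"]) (auto simp: coord_unit_rvec split: if_splits)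
  then show ?thesis by (simp add: inner_commute)
qed

lemma norm_unit_rvec [simp]: "norm (unit_rvec i) = 1"
  by (simp add: norm_eq_sqrt_inner inner_unit_rvec coord_unit_rvec)

lemma coord_sum: "coord (sum f A) i = (\<Sum>j\<in>A. coord (f j) i)"
  by (simp add: inner_unit_rvec[symmetric] inner_sum_left)

lemma abs_coord_le_norm: "\<bar>coord x i\<bar> \<le> norm x"
  using Cauchy_Schwarz_ineq2[of x "unit_rvec i"] by (simp add: inner_unit_rvec)

lemma bounded_linear_coord: "bounded_linear (\<lambda>x. coord x i)"
  using bounded_linear_inner_left[of "unit_rvec i"] by (simp add: inner_unit_rvec)

lemma continuous_coord [continuous_intros]: "continuous_on S (\<lambda>x. coord x i)"
  by (simp add: linear_continuous_on bounded_linear_coord)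

lemma subspace_Rspace: "subspace (Rspace d)"
  by (auto simp: subspace_def Rspace_def zero_rvec.rep_eq plus_rvec.rep_eq scaleR_rvec.rep_eq)

lemma unit_rvec_in_Rspace: "i < d \<Longrightarrow> unit_rvec i \<in> Rspace d"
  by (auto simp: Rspace_def coord_unit_rvec)

lemma Rspace_expansion:
  assumes "x \<in> Rspace d"
  shows "x = (\<Sum>i<d. coord x i *\<^sub>R unit_rvec i)"
proof (rule rvec_eqI)
  fix j
  have "coord (\<Sum>i<d. coord x i *\<^sub>R unit_rvec i) j = (\<Sum>i<d. if i = j then coord x i else 0)"
    unfolding coord_sum by (rule sum.cong) (auto simp: scaleR_rvec.rep_eq coord_unit_rvec)
  also have "\<dots> = coord x j"
    using assms by (auto simp: Rspace_def)
  finally show "coord x j = coord (\<Sum>i<d. coord x i *\<^sub>R unit_rvec i) j" by simp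
qed

lemma vec_of_eq: "vec_of d x = (\<Sum>i<d. x i *\<^sub>R unit_rvec i)"
proof (rule rvec_eqI)
  fix j
  have "coord (vec_of d x) j = (if j < d then x j else 0)"
    unfolding vec_of_def by (subst Abs_rvec_inverse) auto
  moreover have "coord (\<Sum>i<d. x i *\<^sub>R unit_rvec i) j = (\<Sum>i<d. if i = j then x i else 0)"
    unfolding coord_sum by (rule sum.cong) (auto simp: scaleR_rvec.rep_eq coord_unit_rvec)
  ultimately show "coord (vec_of d x) j = coord (\<Sum>i<d. x i *\<^sub>R unit_rvec i) j" by simp
qed

lemma vec_of_in_Rspace: "vec_of d x \<in> Rspace d"
  unfolding vec_of_eq
  by (intro subspace_sum subspace_scale subspace_Rspace unit_rvec_in_Rspace) auto

lemma coord_vec_of: "coord (vec_of d x) j = (if j < d then x j else 0)"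
  unfolding vec_of_def by (subst Abs_rvec_inverse) auto

lemma norm_le_sum_coord:
  assumes "x \<in> Rspace d"
  shows "norm x \<le> (\<Sum>i<d. \<bar>coord x i\<bar>)"
  using norm_sum[of "\<lambda>i. coord x i *\<^sub>R unit_rvec i" "{..<d}"] Rspace_expansion[OF assms]
  by simp

lemma closed_Rspace: "closed (Rspace d)"
proof -
  have "Rspace d = (\<Inter>i\<in>{d..}. {x. coord x i = 0})"
    by (auto simp: Rspace_def)
  also have "closed \<dots>"
    by (intro closed_INT ballI closed_Collect_eq continuous_intros)
  finally show ?thesis .
qed

lemma Rspace_0: "Rspace 0 = {0}"
  by (auto simp: Rspace_def zero_rvec.rep_eq intro!: rvec_eqI)

text \<open>The ambient space has infinite dimension, so its balls are not compact. By induction,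
  the ball is a closed subset of the continuous image of a ball of one dimension less times an
  interval, the interval carrying the last coordinate.\<close>

lemma compact_Rspace_cball: "compact (Rspace d \<inter> cball 0 R)"
proof (induction d)
  case 0
  have "Rspace 0 \<inter> cball 0 R \<subseteq> {0}" by (auto simp: Rspace_0)
  then show ?case by (metis finite.emptyI finite_imp_compact finite_insert finite_subset)
next
  case (Suc d)
  let ?f = "\<lambda>(x, t). x + t *\<^sub>R unit_rvec d"
  have "compact (?f ` ((Rspace d \<inter> cball 0 R) \<times> {-R..R}))"
    by (intro compact_continuous_image compact_Times Suc compact_Icc)
       (auto intro!: continuous_intros simp: case_prod_unfold)
  moreover have "Rspace (Suc d) \<inter> cball 0 R \<subseteq> ?f ` ((Rspace d \<inter> cball 0 R) \<times> {-R..R})"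
  proof
    fix x assume x: "x \<in> Rspace (Suc d) \<inter> cball 0 R"
    define y where "y = x - coord x d *\<^sub>R unit_rvec d"
    have y: "y \<in> Rspace d"
      using x unfolding y_def Rspace_def
      by (auto simp: minus_rvec.rep_eq scaleR_rvec.rep_eq coord_unit_rvec)
    have "y \<bullet> unit_rvec d = 0"
      using y by (simp add: inner_unit_rvec Rspace_def)
    then have "norm x ^ 2 = norm y ^ 2 + (coord x d)\<^sup>2"
      using norm_add_Pythagorean[of y "coord x d *\<^sub>R unit_rvec d"]
      by (simp add: y_def orthogonal_def)
    then have "norm y ^ 2 \<le> norm x ^ 2" by simp
    then have "norm y \<le> norm x" by (rule power2_le_imp_le) simp
    moreover have "\<bar>coord x d\<bar> \<le> norm x" by (rule abs_coord_le_norm)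
    ultimately have "(y, coord x d) \<in> (Rspace d \<inter> cball 0 R) \<times> {-R..R}"
      using x y by auto
    moreover have "x = ?f (y, coord x d)" by (simp add: y_def)
    ultimately show "x \<in> ?f ` ((Rspace d \<inter> cball 0 R) \<times> {-R..R})" by blast
  qed
  moreover have "closed (Rspace (Suc d) \<inter> cball 0 R)"
    by (intro closed_Int closed_Rspace closed_cball)
  ultimately show ?case
    by (metis closed_Int_compact inf.absorb_iff1)
qed

section \<open>Separability of the ambient space\<close>

lemma rvec_in_some_Rspace: "\<exists>d. x \<in> Rspace d"
proof -
  obtain n where "\<forall>i\<in>{i. coord x i \<noteq> 0}. i < n"
    using finite_coord[of x] finite_nat_set_iff_bounded by auto
  then have "x \<in> Rspace n" by (auto simp: Rspace_def linorder_not_le[symmetric])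
  then show ?thesis ..
qed

text \<open>Finitely supported rational sequences are dense. Separability yields a countable base,
  on which the measurability of sums of Borel maps into \<open>rvec\<close> rests.\<close>

lemma countable_dense_rvec:
  "\<exists>D :: rvec set. countable D \<and> (\<forall>x. \<forall>e>0. \<exists>y\<in>D. dist x y < e)"
proof -
  define D where "D = (\<Union>n. vec_of n ` (PiE {..<n} (\<lambda>_. \<rat>)))"
  have "countable D"
    unfolding D_def
    by (intro countable_UN countable_image countable_PiE) (auto simp: countable_rat)
  moreover have "\<exists>y\<in>D. dist x y < e" if e: "e > 0" for x e
  proof -
    obtain n where n: "x \<in> Rspace n" using rvec_in_some_Rspace by blast
    have "\<exists>q\<in>\<rat>. \<bar>coord x i - q\<bar> < e / (real n + 1)" for i
    proof -
      obtain q where "q \<in> \<rat>" "coord x i < q" "q < coord x i + e / (real n + 1)"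
        using Rats_dense_in_real[of "coord x i" "coord x i + e / (real n + 1)"] e by auto
      then show ?thesis by (intro bexI[of _ q]) auto
    qed
    then obtain q where q: "\<And>i. q i \<in> \<rat>" "\<And>i. \<bar>coord x i - q i\<bar> < e / (real n + 1)"
      by metis
    have in_D: "vec_of n (restrict q {..<n}) \<in> D"
      unfolding D_def using q by (intro UN_I[of n] imageI) (auto simp: PiE_def extensional_def)
    have "norm (x - vec_of n (restrict q {..<n})) \<le> (\<Sum>i<n. \<bar>coord (x - vec_of n (restrict q {..<n})) i\<bar>)"
      by (intro norm_le_sum_coord subspace_diff subspace_Rspace n vec_of_in_Rspace)
    also have "\<dots> \<le> (\<Sum>i<n. e / (real n + 1))"
      by (intro sum_mono) (use q(2) in \<open>auto simp: minus_rvec.rep_eq coord_vec_of less_imp_le\<close>)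
    also have "\<dots> < e" using e by (simp add: field_simps)
    finally show ?thesis using in_D by (auto simp: dist_norm)
  qed
  ultimately show ?thesis by blast
qed

instance rvec :: second_countable_topology
proof
  obtain D :: "rvec set" where D: "countable D" "\<And>x e. e > 0 \<Longrightarrow> \<exists>y\<in>D. dist x y < e"
    using countable_dense_rvec by blast
  define B where "B = (\<lambda>(y, n). ball y (1 / real (Suc n))) ` (D \<times> (UNIV :: nat set))"
  have "topological_basis B"
  proof (rule topological_basisI)
    show "open U" if "U \<in> B" for U using that by (auto simp: B_def)
    fix U x assume "open U" "x \<in> (U :: rvec set)"
    then obtain e where e: "e > 0" "ball x e \<subseteq> U" by (meson openE)
    obtain n where "2 / e < real n" using reals_Archimedean2 by blast
    then have n: "2 / e < real (Suc n)" by simp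
    then have n: "1 / real (Suc n) < e / 2" using e by (simp add: field_simps)
    obtain y where y: "y \<in> D" "dist x y < 1 / real (Suc n)"
      using D(2)[of "1 / real (Suc n)" x] by auto
    have "ball y (1 / real (Suc n)) \<subseteq> ball x e"
    proof
      fix z assume "z \<in> ball y (1 / real (Suc n))"
      then have "dist y z < 1 / real (Suc n)" by simp
      then have "dist x z < e"
        using dist_triangle[of x z y] y n by linarith
      then show "z \<in> ball x e" by simp
    qed
    then show "\<exists>B'\<in>B. x \<in> B' \<and> B' \<subseteq> U"
      using y e by (intro bexI[of _ "ball y (1 / real (Suc n))"]) (auto simp: B_def dist_commute)
  qed
  moreover have "countable B" unfolding B_def using D(1) by (intro countable_image countable_SIGMA) auto
  ultimately show "\<exists>B :: rvec set set. countable B \<and> open = generate_topology B"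
    using topological_basis_imp_subbasis by blast
qed

section \<open>Uniform distribution on balls and thin sets\<close>

abbreviation borel_Rspace :: "nat \<Rightarrow> rvec measure" where
  "borel_Rspace d \<equiv> restrict_space borel (Rspace d)"

lemma space_borel_Rspace [simp]: "space (borel_Rspace d) = Rspace d"
  by (simp add: space_restrict_space)

lemma sets_borel_Rspace_iff: "A \<in> sets (borel_Rspace d) \<longleftrightarrow> A \<subseteq> Rspace d \<and> A \<in> sets borel"
  by (subst sets_restrict_space_iff) (auto intro: borel_closed closed_Rspace)

lemma measurable_vec_of [measurable]:
  "vec_of d \<in> Pi\<^sub>M {..<d} (\<lambda>_. lborel) \<rightarrow>\<^sub>M borel_Rspace d"
proof (rule measurable_restrict_space2)
  show "vec_of d \<in> space (Pi\<^sub>M {..<d} (\<lambda>_. lborel)) \<rightarrow> Rspace d"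
    using vec_of_in_Rspace by blast
  show "vec_of d \<in> borel_measurable (Pi\<^sub>M {..<d} (\<lambda>_. lborel))"
    unfolding vec_of_eq by (intro borel_measurable_sum borel_measurable_scaleR) auto
qed

lemma sets_lborel_Rspace [simp, measurable_cong]: "sets (lborel_Rspace d) = sets (borel_Rspace d)"
  by (simp add: lborel_Rspace_def)

lemma space_lborel_Rspace [simp]: "space (lborel_Rspace d) = Rspace d"
  by (simp add: lborel_Rspace_def)

section \<open>Affine change of variables for the volume on \<open>Rspace d\<close>\<close>

lemma emeasure_lborel_affine_vimage:
  assumes "0 < c" "A \<in> sets borel"
  shows "emeasure lborel A = ennreal c * emeasure lborel ((\<lambda>x. t + c * x) -` A)"
proof -
  have "emeasure lborel A =
      emeasure (density (distr lborel borel (\<lambda>x. t + c * x)) (\<lambda>_. ennreal \<bar>c\<bar>)) A"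
    using lborel_real_affine[of c t] assms by simp
  also have "\<dots> = ennreal c * emeasure lborel ((\<lambda>x. t + c * x) -` A)"
    using assms by (simp add: emeasure_density nn_integral_cmult_indicator emeasure_distr)
  finally show ?thesis .
qed

text \<open>Boxes determine the product measure, so the rescaled push-forward only has to agree with
  it on boxes, where the one-dimensional change of variables applies factor by factor.\<close>

lemma emeasure_PiM_lborel_affine:
  fixes c :: real and t :: "'i \<Rightarrow> real"
  assumes I: "finite I" and c: "0 < c" and A: "A \<in> sets (Pi\<^sub>M I (\<lambda>_. lborel))"
  defines "P \<equiv> Pi\<^sub>M I (\<lambda>_. lborel :: real measure)"
  defines "T \<equiv> \<lambda>x. \<lambda>i\<in>I. t i + c * x i"
  shows "emeasure P A = ennreal c ^ card I * emeasure P (T -` A \<inter> space P)"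
proof -
  interpret product_sigma_finite "\<lambda>_::'i. lborel :: real measure" ..
  have T [measurable]: "T \<in> P \<rightarrow>\<^sub>M P" unfolding T_def P_def by measurable
  define P' where "P' = scale_measure (ennreal c ^ card I) (distr P P T)"
  have "P' = P"
    unfolding P_def
  proof (rule PiM_eqI[OF I])
    show "sets P' = sets (Pi\<^sub>M I (\<lambda>_. lborel))" by (simp add: P'_def P_def)
    fix B :: "'i \<Rightarrow> real set" assume B: "\<And>i. i \<in> I \<Longrightarrow> B i \<in> sets lborel"
    have "T -` (Pi\<^sub>E I B) \<inter> space P = Pi\<^sub>E I (\<lambda>i. (\<lambda>x. t i + c * x) -` B i)"
      by (auto simp: T_def P_def space_PiM PiE_def extensional_def Pi_def)
    moreover have "Pi\<^sub>E I B \<in> sets P" unfolding P_def using B I by (intro sets_PiM_I_finite) auto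
    moreover have "(\<lambda>x. t i + c * x) -` B i \<in> sets lborel" if "i \<in> I" for i
      using measurable_sets[of "\<lambda>x. t i + c * x" lborel borel "B i"] B[OF that] by simp
    ultimately have "emeasure (distr P P T) (Pi\<^sub>E I B) =
        (\<Prod>i\<in>I. emeasure lborel ((\<lambda>x. t i + c * x) -` B i))"
      using I emeasure_PiM[of I "\<lambda>i. (\<lambda>x. t i + c * x) -` B i", folded P_def]
      by (simp add: emeasure_distr[OF T])
    then have "emeasure P' (Pi\<^sub>E I B) =
        ennreal c ^ card I * (\<Prod>i\<in>I. emeasure lborel ((\<lambda>x. t i + c * x) -` B i))"
      by (simp add: P'_def)
    also have "\<dots> = (\<Prod>i\<in>I. ennreal c * emeasure lborel ((\<lambda>x. t i + c * x) -` B i))"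
      by (simp add: prod.distrib)
    also have "\<dots> = (\<Prod>i\<in>I. emeasure lborel (B i))"
      using B c by (intro prod.cong refl emeasure_lborel_affine_vimage[symmetric]) auto
    finally show "emeasure P' (Pi\<^sub>E I B) = (\<Prod>i\<in>I. emeasure lborel (B i))" .
  qed
  then have "emeasure P A = emeasure P' A" by simp
  also have "\<dots> = ennreal c ^ card I * emeasure P (T -` A \<inter> space P)"
    using A emeasure_distr[OF T, of A] by (simp add: P'_def P_def)
  finally show ?thesis .
qed

lemma measurable_affine_Rspace:
  assumes "a \<in> Rspace d"
  shows "(\<lambda>y. a + c *\<^sub>R y) \<in> borel_Rspace d \<rightarrow>\<^sub>M borel_Rspace d"
proof (rule measurable_restrict_space2)
  show "(\<lambda>y. a + c *\<^sub>R y) \<in> space (borel_Rspace d) \<rightarrow> Rspace d"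
    using assms by (auto intro!: subspace_add subspace_scale subspace_Rspace)
  show "(\<lambda>y. a + c *\<^sub>R y) \<in> borel_measurable (borel_Rspace d)"
    by (intro borel_measurable_continuous_on_restrict continuous_intros)
qed

text \<open>Used with \<open>c = 1\<close> as translation invariance and with \<open>a = 0\<close>
  for the volume of a dilated ball.\<close>

lemma emeasure_lborel_Rspace_affine:
  assumes a: "a \<in> Rspace d" and c: "0 < c" and A: "A \<in> sets (borel_Rspace d)"
  shows "emeasure (lborel_Rspace d) A =
    ennreal c ^ d * emeasure (lborel_Rspace d) {y \<in> Rspace d. a + c *\<^sub>R y \<in> A}"
proof -
  define P where "P = Pi\<^sub>M {..<d} (\<lambda>_. lborel :: real measure)"
  define T where "T = (\<lambda>x. \<lambda>i\<in>{..<d}. coord a i + c * x i)"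
  have vec: "vec_of d \<in> P \<rightarrow>\<^sub>M borel_Rspace d" unfolding P_def by measurable
  have A': "vec_of d -` A \<inter> space P \<in> sets P" using measurable_sets[OF vec A] .
  have "{y \<in> Rspace d. a + c *\<^sub>R y \<in> A} = (\<lambda>y. a + c *\<^sub>R y) -` A \<inter> space (borel_Rspace d)"
    by auto
  then have B: "{y \<in> Rspace d. a + c *\<^sub>R y \<in> A} \<in> sets (borel_Rspace d)"
    using measurable_sets[OF measurable_affine_Rspace[OF a] A] by simp
  have vecT: "vec_of d (T x) = a + c *\<^sub>R vec_of d x" for x
    using a by (intro rvec_eqI) (auto simp: T_def coord_vec_of plus_rvec.rep_eq scaleR_rvec.rep_eq Rspace_def)
  have T_space: "T x \<in> space P" for x by (auto simp: T_def P_def space_PiM)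
  have "emeasure (lborel_Rspace d) A = emeasure P (vec_of d -` A \<inter> space P)"
    unfolding lborel_Rspace_def P_def[symmetric] by (rule emeasure_distr[OF vec A])
  also have "\<dots> = ennreal c ^ card {..<d} * emeasure P (T -` (vec_of d -` A \<inter> space P) \<inter> space P)"
    unfolding P_def T_def by (rule emeasure_PiM_lborel_affine) (use c A' in \<open>auto simp: P_def\<close>)
  also have "T -` (vec_of d -` A \<inter> space P) \<inter> space P =
      vec_of d -` {y \<in> Rspace d. a + c *\<^sub>R y \<in> A} \<inter> space P"
    using T_space by (auto simp: vecT vec_of_in_Rspace)
  also have "emeasure P \<dots> = emeasure (lborel_Rspace d) {y \<in> Rspace d. a + c *\<^sub>R y \<in> A}"
    unfolding lborel_Rspace_def P_def[symmetric] by (rule emeasure_distr[OF vec B, symmetric])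
  finally show ?thesis by simp
qed

lemma Rspace_cball_sets: "Rspace d \<inter> cball 0 r \<in> sets (borel_Rspace d)"
  by (auto simp: sets_borel_Rspace_iff intro!: borel_closed closed_Int closed_Rspace)

text \<open>The ball lies between two cubes: the one of half side \<open>r\<close>, since
  coordinates are bounded by the norm, and the one of half side \<open>r / (d + 1)\<close>, since
  the norm is at most the sum of the absolute coordinates.\<close>

lemma emeasure_Rspace_cball:
  assumes r: "0 < r"
  shows "emeasure (lborel_Rspace d) (Rspace d \<inter> cball 0 r) \<noteq> 0"
    and "emeasure (lborel_Rspace d) (Rspace d \<inter> cball 0 r) \<noteq> \<infinity>"
proof -
  define P where "P = Pi\<^sub>M {..<d} (\<lambda>_. lborel :: real measure)"
  interpret product_sigma_finite "\<lambda>_::nat. lborel :: real measure" ..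
  have vec: "vec_of d \<in> P \<rightarrow>\<^sub>M borel_Rspace d" unfolding P_def by measurable
  define B where "B = vec_of d -` (Rspace d \<inter> cball 0 r) \<inter> space P"
  have B: "B \<in> sets P" unfolding B_def by (rule measurable_sets[OF vec Rspace_cball_sets])
  have eq: "emeasure (lborel_Rspace d) (Rspace d \<inter> cball 0 r) = emeasure P B"
    unfolding lborel_Rspace_def P_def[symmetric] B_def by (rule emeasure_distr[OF vec Rspace_cball_sets])
  have box: "emeasure P (Pi\<^sub>E {..<d} (\<lambda>_. {-s..s})) = ennreal ((2 * s) ^ d)"
    "Pi\<^sub>E {..<d} (\<lambda>_. {-s..s}) \<in> sets P" if "0 \<le> s" for s
  proof -
    show "Pi\<^sub>E {..<d} (\<lambda>_. {-s..s}) \<in> sets P" unfolding P_def by (intro sets_PiM_I_finite) auto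
    show "emeasure P (Pi\<^sub>E {..<d} (\<lambda>_. {-s..s})) = ennreal ((2 * s) ^ d)"
      unfolding P_def using that by (subst emeasure_PiM) (auto simp: ennreal_power)
  qed
  have "B \<subseteq> Pi\<^sub>E {..<d} (\<lambda>_. {-r..r})"
  proof
    fix x assume x: "x \<in> B"
    have "x i \<in> {-r..r}" if "i < d" for i
      using x abs_coord_le_norm[of "vec_of d x" i] that by (auto simp: B_def coord_vec_of)
    then show "x \<in> Pi\<^sub>E {..<d} (\<lambda>_. {-r..r})"
      using x by (auto simp: B_def P_def space_PiM PiE_def)
  qed
  then have "emeasure P B \<le> ennreal ((2 * r) ^ d)"
    using emeasure_mono[of B _ P] box[of r] r by (metis less_imp_le)
  then show "emeasure (lborel_Rspace d) (Rspace d \<inter> cball 0 r) \<noteq> \<infinity>"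
    unfolding eq by (metis ennreal_neq_top infinity_ennreal_def neq_top_trans)
  define s where "s = r / (real d + 1)"
  have s: "0 < s" using r by (simp add: s_def)
  have "Pi\<^sub>E {..<d} (\<lambda>_. {-s..s}) \<subseteq> B"
  proof
    fix x assume x: "x \<in> Pi\<^sub>E {..<d} (\<lambda>_. {-s..s})"
    have "norm (vec_of d x) \<le> (\<Sum>i<d. \<bar>coord (vec_of d x) i\<bar>)"
      by (intro norm_le_sum_coord vec_of_in_Rspace)
    also have "\<dots> \<le> (\<Sum>i<d. s)"
      using x by (intro sum_mono) (force simp: coord_vec_of PiE_def Pi_def)
    also have "\<dots> \<le> r" using r by (simp add: s_def field_simps)
    finally show "x \<in> B" using x by (auto simp: B_def P_def space_PiM vec_of_in_Rspace PiE_def)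
  qed
  then have "ennreal ((2 * s) ^ d) \<le> emeasure P B"
    using emeasure_mono[OF _ B] box[of s] s by (metis less_imp_le)
  moreover have "0 < ennreal ((2 * s) ^ d)" using s by simp
  ultimately show "emeasure (lborel_Rspace d) (Rspace d \<inter> cball 0 r) \<noteq> 0"
    unfolding eq by (metis leD)
qed

lemma prob_space_uniform_ball: "0 < r \<Longrightarrow> prob_space (uniform_ball d r)"
  unfolding uniform_ball_def by (intro prob_space_uniform_measure emeasure_Rspace_cball)

lemma sets_uniform_ball [simp, measurable_cong]: "sets (uniform_ball d r) = sets (borel_Rspace d)"
  by (simp add: uniform_ball_def)

lemma space_uniform_ball [simp]: "space (uniform_ball d r) = Rspace d"
  by (simp add: uniform_ball_def)

lemma one_plus_inverse_power_le: "1 \<le> d \<Longrightarrow> (1 + 1 / real d) ^ d \<le> 3"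
proof -
  assume d: "1 \<le> d"
  have "(1 + 1 / real d) ^ d \<le> exp (1 / real d) ^ d"
    by (intro power_mono exp_ge_add_one_self) auto
  also have "\<dots> = exp 1" using d by (simp flip: exp_of_nat_mult)
  also have "\<dots> \<le> 3" by (rule exp_le)
  finally show ?thesis .
qed

text \<open>\<open>N\<close> disjoint translates of \<open>X\<close> along \<open>e\<close> fit into the ball of radius \<open>(1 + 1 / d) * r\<close>,
  whose volume is at most \<open>3\<close> times that of the ball of radius \<open>r\<close>.\<close>

lemma thin_set_measure:
  assumes d: "1 \<le> d" and r: "0 < r" and N: "0 < N" and w: "0 \<le> w" "real d * real N * w \<le> r"
    and X: "X \<in> sets (borel_Rspace d)" "X \<subseteq> cball 0 r" and e: "e \<in> Rspace d" "norm e = 1"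
    and thin: "\<And>x y \<mu>. x \<in> X \<Longrightarrow> y \<in> X \<Longrightarrow> y - x = \<mu> *\<^sub>R e \<Longrightarrow> \<bar>\<mu>\<bar> < w"
  shows "measure (uniform_ball d r) X \<le> 3 / real N"
proof -
  let ?L = "lborel_Rspace d"
  define Y where "Y j = {y \<in> Rspace d. (- (real j * w)) *\<^sub>R e + 1 *\<^sub>R y \<in> X}" for j
  define B where "B s = Rspace d \<inter> cball 0 s" for s
  define c where "c = 1 + 1 / real d"
  have shift: "(- (real j * w)) *\<^sub>R e \<in> Rspace d" for j
    using e subspace_Rspace by (intro subspace_scale)
  have Y_sets: "Y j \<in> sets ?L" for j
  proof -
    have "Y j = (\<lambda>y. (- (real j * w)) *\<^sub>R e + 1 *\<^sub>R y) -` X \<inter> space (borel_Rspace d)"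
      by (auto simp: Y_def)
    then show ?thesis using measurable_sets[OF measurable_affine_Rspace[OF shift[of j], of 1] X(1)] by simp
  qed
  have Y_measure: "emeasure ?L (Y j) = emeasure ?L X" for j
    using emeasure_lborel_Rspace_affine[OF shift _ X(1), of 1] by (simp add: Y_def)
  have disj: "disjoint_family_on Y {..<N}"
    unfolding disjoint_family_on_def
  proof safe
    fix i j y assume ij: "i \<noteq> j" and y: "y \<in> Y i" "y \<in> Y j"
    define \<mu> where "\<mu> = (real i - real j) * w"
    have "\<bar>\<mu>\<bar> < w"
      using y by (intro thin[of "(- (real i * w)) *\<^sub>R e + 1 *\<^sub>R y" "(- (real j * w)) *\<^sub>R e + 1 *\<^sub>R y"])
                 (auto simp: Y_def \<mu>_def algebra_simps)
    \<comment> \<open>A common point of two translates gives two points of \<open>X\<close> that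
      differ by \<open>\<mu>\<close> along \<open>e\<close>. Thinness asks for less than
      \<open>w\<close>, while distinct indices make the gap at least \<open>w\<close>.\<close>
    moreover have "1 * w \<le> \<bar>real i - real j\<bar> * w" using ij w by (intro mult_right_mono) auto
    ultimately show "y \<in> {}" using w by (simp add: \<mu>_def abs_mult)
  qed
  have sub: "(\<Union>j<N. Y j) \<subseteq> B (c * r)"
  proof safe
    fix j y assume j: "j < N" and y: "y \<in> Y j"
    have "norm y \<le> norm ((- (real j * w)) *\<^sub>R e + 1 *\<^sub>R y) + norm ((real j * w) *\<^sub>R e)"
      using norm_triangle_ineq[of "(- (real j * w)) *\<^sub>R e + 1 *\<^sub>R y" "(real j * w) *\<^sub>R e"] by simp
    also have "\<dots> \<le> r + real j * w"
      using y X(2) e w by (intro add_mono) (auto simp: Y_def)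
    also have "\<dots> \<le> r + real N * w" using j w by (intro add_left_mono mult_right_mono) auto
    \<comment> \<open>The total shift \<open>N * w\<close> is at most \<open>r / d\<close>, which is
      exactly the enlargement of the ball.\<close>
    also have "\<dots> \<le> c * r" using w d by (simp add: c_def field_simps)
    finally show "y \<in> B (c * r)" using y by (auto simp: B_def Y_def)
  qed
  have B_sets: "B s \<in> sets (borel_Rspace d)" for s unfolding B_def by (rule Rspace_cball_sets)
  have c: "0 < c" by (simp add: c_def add_pos_nonneg)
  have "{y \<in> Rspace d. 0 + c *\<^sub>R y \<in> B (c * r)} = B r"
    using c subspace_scale[OF subspace_Rspace] by (auto simp: B_def)
  then have "emeasure ?L (B (c * r)) = ennreal c ^ d * emeasure ?L (B r)"
    using emeasure_lborel_Rspace_affine[OF subspace_0[OF subspace_Rspace] c B_sets, of "c * r"] by simp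
  moreover have "ennreal c ^ d \<le> 3"
    using ennreal_leI[OF one_plus_inverse_power_le[OF d, folded c_def]] c by (simp add: ennreal_power)
  ultimately have "emeasure ?L (B (c * r)) \<le> 3 * emeasure ?L (B r)"
    by (simp add: mult_right_mono)
  moreover have "of_nat N * emeasure ?L X = emeasure ?L (\<Union>j<N. Y j)"
    using sum_emeasure[OF _ disj, of ?L] Y_sets Y_measure by (simp add: image_subset_iff)
  moreover have "emeasure ?L (\<Union>j<N. Y j) \<le> emeasure ?L (B (c * r))"
    using B_sets by (intro emeasure_mono sub) auto
  ultimately have main: "of_nat N * emeasure ?L X \<le> 3 * emeasure ?L (B r)" by simp
  have Bfin: "emeasure ?L (B r) \<noteq> 0" "emeasure ?L (B r) \<noteq> \<infinity>"
    unfolding B_def using emeasure_Rspace_cball[OF r] by auto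
  have XB: "X \<subseteq> B r" using X sets_borel_Rspace_iff by (auto simp: B_def)
  then have "emeasure ?L X \<le> emeasure ?L (B r)" using B_sets by (intro emeasure_mono) auto
  then have Xfin: "emeasure ?L X \<noteq> \<infinity>" using Bfin by (auto simp: top_unique)
  have m: "real N * measure ?L X \<le> 3 * measure ?L (B r)"
  proof -
    have "ennreal (real N * measure ?L X) \<le> ennreal (3 * measure ?L (B r))"
      using main Bfin Xfin
      by (simp add: ennreal_mult emeasure_eq_ennreal_measure ennreal_of_nat_eq_real_of_nat)
    then show ?thesis by simp
  qed
  have Bpos: "0 < measure ?L (B r)"
    using Bfin by (metis emeasure_eq_ennreal_measure ennreal_0 infinity_ennreal_def measure_nonneg
        order_le_less)
  have "measure (uniform_ball d r) X = measure ?L (B r \<inter> X) / measure ?L (B r)"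
    unfolding uniform_ball_def B_def[symmetric]
    using Bfin X B_sets by (intro measure_uniform_measure) auto
  also have "B r \<inter> X = X" using XB by auto
  also have "measure ?L X / measure ?L (B r) \<le> 3 / real N"
    using m Bpos N by (simp add: field_simps)
  finally show ?thesis .
qed

text \<open>The uniform measure lives on all of \<open>Rspace d\<close>. Failure sets can be cut
  down to the ball at no cost, and only there are stuck iterates known to be localized.\<close>

lemma uniform_ball_outside: "0 < r \<Longrightarrow> measure (uniform_ball d r) (Rspace d - cball 0 r) = 0"
proof -
  assume r: "0 < r"
  interpret prob_space "uniform_ball d r" by (rule prob_space_uniform_ball[OF r])
  have "measure (uniform_ball d r) (Rspace d \<inter> cball 0 r) = 1"
    unfolding uniform_ball_def
    using emeasure_Rspace_cball[OF r, of d] Rspace_cball_sets[of d r]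
    by (subst measure_uniform_measure)
       (auto simp: measure_def enn2real_eq_0_iff)
  moreover have "Rspace d - cball 0 r = space (uniform_ball d r) - (Rspace d \<inter> cball 0 r)" by auto
  ultimately show ?thesis
    using prob_compl[of "Rspace d \<inter> cball 0 r"] Rspace_cball_sets[of d r] by simp
qed

section \<open>Derivatives on the coordinate subspaces\<close>

text \<open>A line inside the subspace turns a derivative within \<open>V\<close> into an ordinary
  two-sided derivative in one real variable, so the later calculus is one-dimensional.\<close>

lemma has_vector_derivative_along_line:
  assumes V: "subspace V" "x \<in> V" "v \<in> V"
    and D: "(f has_derivative D) (at (x + s *\<^sub>R v) within V)"
  shows "((\<lambda>t. f (x + t *\<^sub>R v)) has_vector_derivative D v) (at s)"
proof -
  have sub: "range (\<lambda>t. x + t *\<^sub>R v) \<subseteq> V"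
    using V by (auto intro: subspace_add subspace_scale)
  have "((\<lambda>t. x + t *\<^sub>R v) has_derivative (\<lambda>t. t *\<^sub>R v)) (at s)"
    by (auto intro!: derivative_eq_intros)
  then have "((\<lambda>t. f (x + t *\<^sub>R v)) has_derivative (\<lambda>t. D (t *\<^sub>R v))) (at s)"
    by (rule has_derivative_in_compose) (rule has_derivative_subset[OF D sub])
  moreover have "D (t *\<^sub>R v) = t *\<^sub>R D v" for t
    using has_derivative_linear[OF D] by (rule linear_scale)
  ultimately show ?thesis by (simp add: has_vector_derivative_def)
qed

lemma has_derivative_within_subspace_unique:
  assumes V: "subspace V" "x \<in> V" "v \<in> V"
    and D: "(f has_derivative D) (at x within V)" "(f has_derivative D') (at x within V)"
  shows "D v = D' v"
  using has_vector_derivative_along_line[OF V, of f D 0] has_vector_derivative_along_line[OF V, of f D' 0] D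
  by (auto intro: vector_derivative_unique_at)

lemma has_derivative_within_subspace_cong:
  assumes V: "subspace V" "x \<in> V" and D: "(f has_derivative D) (at x within V)"
    and D': "bounded_linear D'" "\<And>v. v \<in> V \<Longrightarrow> D' v = D v"
  shows "(f has_derivative D') (at x within V)"
proof -
  have "D' (y - x) = D (y - x)" if "y \<in> V" for y using that V by (intro D' subspace_diff)
  then show ?thesis using D D'(1) by (simp add: has_derivative_within_alt)
qed

text \<open>The definite description in \<open>grad\<close> is justified here. Partial derivatives
  supply a representing vector; the difference of two such vectors lies in \<open>Rspace d\<close>
  and is orthogonal to itself.\<close>

lemma gradient_has_derivative:
  assumes F: "F differentiable_on Rspace d" and w: "w \<in> Rspace d"
  shows "grad d F w \<in> Rspace d"
    and "(F has_derivative (\<lambda>h. grad d F w \<bullet> h)) (at w within Rspace d)"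
proof -
  obtain D where D: "(F has_derivative D) (at w within Rspace d)"
    using F w by (auto simp: differentiable_on_def differentiable_def)
  define g where "g = (\<Sum>i<d. D (unit_rvec i) *\<^sub>R unit_rvec i)"
  have g: "g \<in> Rspace d"
    unfolding g_def by (intro subspace_sum subspace_scale subspace_Rspace unit_rvec_in_Rspace) auto
  have "g \<bullet> h = D h" if h: "h \<in> Rspace d" for h
  proof -
    have lin: "linear D" using D by (rule has_derivative_linear)
    have "D h = D (\<Sum>i<d. coord h i *\<^sub>R unit_rvec i)" using Rspace_expansion[OF h] by simp
    also have "\<dots> = (\<Sum>i<d. coord h i * D (unit_rvec i))"
      by (simp add: linear_sum[OF lin] linear_scale[OF lin])
    also have "\<dots> = g \<bullet> h"
      by (simp add: g_def inner_sum_left inner_commute[of "unit_rvec _"] inner_unit_rvec mult.commute)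
    finally show ?thesis by simp
  qed
  then have deriv: "(F has_derivative (\<lambda>h. g \<bullet> h)) (at w within Rspace d)"
    by (intro has_derivative_within_subspace_cong[OF subspace_Rspace w D] bounded_linear_inner_right) auto
  have "\<exists>!g. g \<in> Rspace d \<and> (F has_derivative (\<lambda>h. g \<bullet> h)) (at w within Rspace d)"
  proof (rule ex1I[of _ g])
    fix g' assume g': "g' \<in> Rspace d \<and> (F has_derivative (\<lambda>h. g' \<bullet> h)) (at w within Rspace d)"
    then have "g' - g \<in> Rspace d" using g by (intro subspace_diff subspace_Rspace) auto
    then have "g' \<bullet> (g' - g) = g \<bullet> (g' - g)"
      using has_derivative_within_subspace_unique[OF subspace_Rspace w] g' deriv by blast
    then have "(g' - g) \<bullet> (g' - g) = 0" by (simp add: inner_diff_left)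
    then show "g' = g" by simp
  qed (use g deriv in auto)
  from theI'[OF this] show "grad d F w \<in> Rspace d"
    "(F has_derivative (\<lambda>h. grad d F w \<bullet> h)) (at w within Rspace d)"
    unfolding grad_def by auto
qed

lemma hess_has_derivative:
  "twice_differentiable d F \<Longrightarrow> w \<in> Rspace d \<Longrightarrow>
    (grad d F has_derivative hess d F w) (at w within Rspace d)"
  unfolding hess_def twice_differentiable_def differentiable_on_def
  using frechet_derivative_works by blast

lemma hess_bounded_linear:
  "twice_differentiable d F \<Longrightarrow> w \<in> Rspace d \<Longrightarrow> bounded_linear (hess d F w)"
  using hess_has_derivative has_derivative_bounded_linear by blast

text \<open>The coordinates of \<open>f\<close> from index \<open>d\<close> on vanish along every
  line in \<open>Rspace d\<close>, so their derivatives vanish too.\<close>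

lemma derivative_in_Rspace:
  assumes x: "x \<in> Rspace d" and v: "v \<in> Rspace d"
    and f: "\<And>y. y \<in> Rspace d \<Longrightarrow> f y \<in> Rspace d"
    and D: "(f has_derivative D) (at x within Rspace d)"
  shows "D v \<in> Rspace d"
  unfolding Rspace_def
proof safe
  fix i assume "d \<le> i"
  have "((\<lambda>t. f (x + t *\<^sub>R v)) has_vector_derivative D v) (at 0)"
    using has_vector_derivative_along_line[OF subspace_Rspace x v, of f D 0] D by simp
  then have "((\<lambda>t. coord (f (x + t *\<^sub>R v)) i) has_vector_derivative coord (D v) i) (at 0)"
    by (rule bounded_linear.has_vector_derivative[OF bounded_linear_coord])
  moreover have "f (x + t *\<^sub>R v) \<in> Rspace d" for t
    using x v by (intro f subspace_add subspace_scale subspace_Rspace)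
  then have "coord (f (x + t *\<^sub>R v)) i = 0" for t using \<open>d \<le> i\<close> by (simp add: Rspace_def)
  ultimately have "((\<lambda>t. 0 :: real) has_vector_derivative coord (D v) i) (at 0)" by simp
  then show "coord (D v) i = 0"
    by (rule vector_derivative_unique_at[OF _ has_vector_derivative_const])
qed

lemma hess_in_Rspace:
  "twice_differentiable d F \<Longrightarrow> w \<in> Rspace d \<Longrightarrow> v \<in> Rspace d \<Longrightarrow> hess d F w v \<in> Rspace d"
  by (rule derivative_in_Rspace[OF _ _ _ hess_has_derivative])
     (auto simp: twice_differentiable_def intro: gradient_has_derivative)

text \<open>The mean value theorem is applied to the difference of \<open>F\<close> along two
  parallel segments in direction \<open>v\<close>. It leaves a difference of \<open>g\<close> at two
  points near \<open>u\<close>, and both values are expanded at \<open>u\<close>.\<close>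

lemma second_difference_expansion:
  fixes F :: "'a::real_inner \<Rightarrow> real"
  assumes V: "subspace V" and u: "u \<in> V" and v: "v \<in> V" and w: "w \<in> V"
    and F: "\<And>x. x \<in> V \<Longrightarrow> (F has_derivative (\<lambda>h. g x \<bullet> h)) (at x within V)"
    and g: "(g has_derivative A) (at u within V)" and e: "0 < e"
  shows "\<exists>\<delta>>0. \<forall>t. 0 < t \<and> t < \<delta> \<longrightarrow>
    \<bar>F (u + t *\<^sub>R v + t *\<^sub>R w) - F (u + t *\<^sub>R v) - F (u + t *\<^sub>R w) + F u - t\<^sup>2 * (A w \<bullet> v)\<bar> \<le> e * t\<^sup>2"
proof -
  have A: "linear A" using g by (rule has_derivative_linear)
  define c where "c = norm v + norm w + 1"
  have c: "1 \<le> c" "norm v \<le> c" by (auto simp: c_def)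
  \<comment> \<open>Two remainders of size \<open>e' * (t * c)\<close>, paired with \<open>v\<close>
    of norm at most \<open>c\<close>, then add up to exactly \<open>e * t\<close>.\<close>
  define e' where "e' = e / (2 * c * c)"
  have e': "0 < e'" using e c by (simp add: e'_def)
  then obtain \<delta> where \<delta>: "0 < \<delta>"
    "\<And>y. y \<in> V \<Longrightarrow> norm (y - u) < \<delta> \<Longrightarrow> norm (g y - g u - A (y - u)) \<le> e' * norm (y - u)"
    using g unfolding has_derivative_within_alt by blast
  have main: "\<bar>F (u + t *\<^sub>R v + t *\<^sub>R w) - F (u + t *\<^sub>R v) - F (u + t *\<^sub>R w) + F u - t\<^sup>2 * (A w \<bullet> v)\<bar> \<le> e * t\<^sup>2"
    if t: "0 < t" "t < \<delta> / c" for t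
  proof -
    have tw: "u + t *\<^sub>R w \<in> V" and tv: "t *\<^sub>R v \<in> V" using V u v w by (auto intro: subspace_add subspace_scale)
    define \<phi> where "\<phi> s = F (u + t *\<^sub>R w + s *\<^sub>R (t *\<^sub>R v)) - F (u + s *\<^sub>R (t *\<^sub>R v))" for s
    have line: "((\<lambda>s. F (x + s *\<^sub>R (t *\<^sub>R v))) has_real_derivative
        g (x + s *\<^sub>R (t *\<^sub>R v)) \<bullet> (t *\<^sub>R v)) (at s)" if x: "x \<in> V" for x s
    proof -
      have "x + s *\<^sub>R (t *\<^sub>R v) \<in> V" using x v V by (intro subspace_add subspace_scale)
      then show ?thesis
        unfolding has_real_derivative_iff_has_vector_derivative
        by (rule has_vector_derivative_along_line[OF V x tv F])
    qed
    have "(\<phi> has_real_derivative (g (u + t *\<^sub>R w + s *\<^sub>R (t *\<^sub>R v)) \<bullet> (t *\<^sub>R v)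
        - g (u + s *\<^sub>R (t *\<^sub>R v)) \<bullet> (t *\<^sub>R v))) (at s)" for s
      unfolding \<phi>_def by (intro DERIV_diff line tw u)
    then obtain s where s: "0 < s" "s < 1" and mvt: "\<phi> 1 - \<phi> 0 = (1 - 0) *
        (g (u + t *\<^sub>R w + s *\<^sub>R (t *\<^sub>R v)) \<bullet> (t *\<^sub>R v) - g (u + s *\<^sub>R (t *\<^sub>R v)) \<bullet> (t *\<^sub>R v))"
      using MVT2[of 0 1 \<phi> "\<lambda>s. g (u + t *\<^sub>R w + s *\<^sub>R (t *\<^sub>R v)) \<bullet> (t *\<^sub>R v)
        - g (u + s *\<^sub>R (t *\<^sub>R v)) \<bullet> (t *\<^sub>R v)"] by auto
    define y1 where "y1 = u + t *\<^sub>R w + s *\<^sub>R (t *\<^sub>R v)"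
    define y2 where "y2 = u + s *\<^sub>R (t *\<^sub>R v)"
    have yV: "y1 \<in> V" "y2 \<in> V"
      unfolding y1_def y2_def using V u v w by (auto intro: subspace_add subspace_scale)
    have stv: "norm (s *\<^sub>R (t *\<^sub>R v)) \<le> t * norm v"
      using s t by (simp add: mult_left_le_one_le)
    have "norm (y1 - u) \<le> norm (t *\<^sub>R w) + norm (s *\<^sub>R (t *\<^sub>R v))"
      unfolding y1_def using norm_triangle_ineq[of "t *\<^sub>R w" "s *\<^sub>R (t *\<^sub>R v)"] by simp
    also have "\<dots> \<le> t * norm w + t * norm v" using stv t by simp
    also have "\<dots> \<le> t * c" using t by (simp add: c_def algebra_simps)
    finally have y1: "norm (y1 - u) \<le> t * c" .
    have "norm (y2 - u) \<le> t * norm v" unfolding y2_def using stv by simp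
    also have "\<dots> \<le> t * c" using t c by simp
    finally have y2: "norm (y2 - u) \<le> t * c" .
    have tc: "t * c < \<delta>" using t c by (simp add: field_simps)
    have E: "norm (g y - g u - A (y - u)) \<le> e' * (t * c)" if "y \<in> V" "norm (y - u) \<le> t * c" for y
      using \<delta>(2)[OF that(1)] that tc mult_left_mono[OF that(2), of e'] e' by linarith
    define r1 where "r1 = g y1 - g u - A (y1 - u)"
    define r2 where "r2 = g y2 - g u - A (y2 - u)"
    have "norm (r1 - r2) \<le> 2 * (e' * (t * c))"
      using norm_triangle_ineq4[of r1 r2] E[OF yV(1) y1] E[OF yV(2) y2] by (simp add: r1_def r2_def)
    then have "norm (r1 - r2) * norm v \<le> 2 * (e' * (t * c)) * c"
      using c e' t by (intro mult_mono) auto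
    also have "\<dots> = e * t" using c by (simp add: e'_def field_simps)
    finally have "\<bar>(r1 - r2) \<bullet> v\<bar> \<le> e * t" using Cauchy_Schwarz_ineq2 order_trans by blast
    have "y1 - u = t *\<^sub>R w + (y2 - u)" by (simp add: y1_def y2_def)
    then have "A (y1 - u) = t *\<^sub>R A w + A (y2 - u)"
      by (simp only: linear_add[OF A] linear_scale[OF A])
    then have "g y1 - g y2 = t *\<^sub>R A w + (r1 - r2)" by (simp add: r1_def r2_def)
    then have "(g y1 - g y2) \<bullet> v = t * (A w \<bullet> v) + (r1 - r2) \<bullet> v" by (simp only: inner_add_left inner_scaleR_left)
    moreover have "\<phi> 1 - \<phi> 0 = t * ((g y1 - g y2) \<bullet> v)"
      using mvt by (simp add: y1_def y2_def inner_diff_left algebra_simps)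
    ultimately have "\<phi> 1 - \<phi> 0 - t\<^sup>2 * (A w \<bullet> v) = t * ((r1 - r2) \<bullet> v)"
      by (simp add: power2_eq_square distrib_left)
    then have "\<bar>\<phi> 1 - \<phi> 0 - t\<^sup>2 * (A w \<bullet> v)\<bar> = t * \<bar>(r1 - r2) \<bullet> v\<bar>"
      using t by (simp add: abs_mult)
    also have "\<dots> \<le> t * (e * t)" using \<open>\<bar>(r1 - r2) \<bullet> v\<bar> \<le> e * t\<close> t by simp
    finally show ?thesis by (simp add: \<phi>_def power2_eq_square algebra_simps)
  qed
  show ?thesis
    by (rule exI[of _ "\<delta> / c"]) (use \<delta>(1) c main in auto)
qed

text \<open>The second difference does not change when \<open>v\<close> and \<open>w\<close> are
  exchanged, so both bilinear values are limits of the same quantity divided by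
  \<open>t\<^sup>2\<close>.\<close>

lemma second_derivative_symmetric:
  fixes F :: "'a::real_inner \<Rightarrow> real"
  assumes V: "subspace V" and u: "u \<in> V" and v: "v \<in> V" and w: "w \<in> V"
    and F: "\<And>x. x \<in> V \<Longrightarrow> (F has_derivative (\<lambda>h. g x \<bullet> h)) (at x within V)"
    and g: "(g has_derivative A) (at u within V)"
  shows "A w \<bullet> v = A v \<bullet> w"
proof -
  have "\<bar>A w \<bullet> v - A v \<bullet> w\<bar> \<le> e" if e: "0 < e" for e
  proof -
    have e2: "0 < e / 2" using e by simp
    obtain \<delta>1 where \<delta>1: "0 < \<delta>1" "\<And>t. 0 < t \<Longrightarrow> t < \<delta>1 \<Longrightarrow>
      \<bar>F (u + t *\<^sub>R v + t *\<^sub>R w) - F (u + t *\<^sub>R v) - F (u + t *\<^sub>R w) + F u - t\<^sup>2 * (A w \<bullet> v)\<bar> \<le> e / 2 * t\<^sup>2"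
      using second_difference_expansion[OF V u v w F g e2] by blast
    obtain \<delta>2 where \<delta>2: "0 < \<delta>2" "\<And>t. 0 < t \<Longrightarrow> t < \<delta>2 \<Longrightarrow>
      \<bar>F (u + t *\<^sub>R w + t *\<^sub>R v) - F (u + t *\<^sub>R w) - F (u + t *\<^sub>R v) + F u - t\<^sup>2 * (A v \<bullet> w)\<bar> \<le> e / 2 * t\<^sup>2"
      using second_difference_expansion[OF V u w v F g e2] by blast
    define t where "t = min \<delta>1 \<delta>2 / 2"
    have t: "0 < t" "t < \<delta>1" "t < \<delta>2" using \<delta>1(1) \<delta>2(1) by (auto simp: t_def min_def)
    have "F (u + t *\<^sub>R w + t *\<^sub>R v) = F (u + t *\<^sub>R v + t *\<^sub>R w)" by (simp add: add_ac)
    then have "\<bar>t\<^sup>2 * (A w \<bullet> v) - t\<^sup>2 * (A v \<bullet> w)\<bar> \<le> e / 2 * t\<^sup>2 + e / 2 * t\<^sup>2"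
      using \<delta>1(2)[OF t(1,2)] \<delta>2(2)[OF t(1,3)] by linarith
    moreover have "\<bar>t\<^sup>2 * (A w \<bullet> v) - t\<^sup>2 * (A v \<bullet> w)\<bar> = t\<^sup>2 * \<bar>A w \<bullet> v - A v \<bullet> w\<bar>"
      by (simp add: abs_mult flip: right_diff_distrib)
    ultimately have "t\<^sup>2 * \<bar>A w \<bullet> v - A v \<bullet> w\<bar> \<le> t\<^sup>2 * e" by (simp add: mult.commute)
    then show ?thesis using t by simp
  qed
  then have "\<bar>A w \<bullet> v - A v \<bullet> w\<bar> \<le> 0" by (rule field_le_epsilon) simp
  then show ?thesis by simp
qed

lemma hess_symmetric:
  assumes "twice_differentiable d F" "u \<in> Rspace d" "v \<in> Rspace d" "w \<in> Rspace d"
  shows "v \<bullet> hess d F u w = w \<bullet> hess d F u v"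
  using second_derivative_symmetric[OF subspace_Rspace assms(2-4) _ hess_has_derivative[OF assms(1,2)]]
    gradient_has_derivative(2)[of F d] assms(1)
  by (auto simp: twice_differentiable_def inner_commute)

text \<open>The supremum in \<open>op_norm\<close> means something only for a bounded set; the
  operator norm on the ambient space supplies the bound.\<close>

lemma norm_le_op_norm:
  assumes A: "bounded_linear A" and v: "v \<in> Rspace d"
  shows "norm (A v) \<le> op_norm d A * norm v"
proof (cases "v = 0")
  case False
  interpret A: bounded_linear A by fact
  have "bdd_above ((\<lambda>h. norm (A h)) ` (Rspace d \<inter> cball 0 1))"
  proof (rule bdd_aboveI2)
    fix h assume "h \<in> Rspace d \<inter> cball 0 1"
    then have "onorm A * norm h \<le> onorm A * 1" using onorm_pos_le[OF A] by (intro mult_left_mono) auto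
    then show "norm (A h) \<le> onorm A" using onorm[OF A, of h] by linarith
  qed
  moreover have "v /\<^sub>R norm v \<in> Rspace d \<inter> cball 0 1"
    using v False subspace_scale[OF subspace_Rspace] by auto
  ultimately have "norm (A (v /\<^sub>R norm v)) \<le> op_norm d A"
    unfolding op_norm_def by (rule cSUP_upper2) auto
  then show ?thesis using False by (simp add: A.scaleR field_simps)
qed (use linear_0[OF bounded_linear.linear[OF A]] in simp)

lemma third_deriv_has_derivative:
  "thrice_differentiable d F \<Longrightarrow> w \<in> Rspace d \<Longrightarrow> h \<in> Rspace d \<Longrightarrow>
    ((\<lambda>v. hess d F v h) has_derivative frechet_derivative (\<lambda>v. hess d F v h) (at w within Rspace d))
      (at w within Rspace d)"
  unfolding thrice_differentiable_def differentiable_on_def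
  using frechet_derivative_works by blast

text \<open>Linearity in \<open>h\<close> is not built into \<open>third_deriv\<close>, because
  \<open>h\<close> selects the map that is differentiated. It follows from linearity of each Hessian
  and uniqueness of derivatives within the subspace.\<close>

lemma third_deriv_expansion:
  assumes F: "thrice_differentiable d F" and w: "w \<in> Rspace d" and h: "h \<in> Rspace d" and k: "k \<in> Rspace d"
    and n: "finite I" "\<And>i. i \<in> I \<Longrightarrow> f i \<in> Rspace d" "h = (\<Sum>i\<in>I. c i *\<^sub>R f i)"
  shows "third_deriv d F w h k l = (\<Sum>i\<in>I. c i * third_deriv d F w (f i) k l)"
proof -
  let ?D = "\<lambda>h. frechet_derivative (\<lambda>v. hess d F v h) (at w within Rspace d)"
  have F2: "twice_differentiable d F" using F by (simp add: thrice_differentiable_def)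
  have sum_deriv: "((\<lambda>v. \<Sum>i\<in>I. c i *\<^sub>R hess d F v (f i)) has_derivative (\<lambda>k. \<Sum>i\<in>I. c i *\<^sub>R ?D (f i) k))
      (at w within Rspace d)"
    by (intro has_derivative_sum has_derivative_scaleR_right third_deriv_has_derivative F w n)
  have "(\<Sum>i\<in>I. c i *\<^sub>R hess d F v (f i)) = hess d F v h" if "v \<in> Rspace d" for v
    using bounded_linear.linear[OF hess_bounded_linear[OF F2 that]]
    by (simp add: n(3) linear_sum linear_scale)
  then have "((\<lambda>v. hess d F v h) has_derivative (\<lambda>k. \<Sum>i\<in>I. c i *\<^sub>R ?D (f i) k)) (at w within Rspace d)"
    by (intro has_derivative_transform[OF w _ sum_deriv]) simp
  then have "?D h k = (\<Sum>i\<in>I. c i *\<^sub>R ?D (f i) k)"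
    by (rule has_derivative_within_subspace_unique[OF subspace_Rspace w k third_deriv_has_derivative[OF F w h]])
  then show ?thesis by (simp add: third_deriv_def inner_sum_left)
qed

text \<open>The supremum is over a bounded set because \<open>h\<close> expands in \<open>d\<close>
  basis vectors and each basis slice is bounded linear in \<open>k\<close>. Homogeneity in the three
  arguments then leads from unit vectors to all vectors.\<close>

lemma third_deriv_le_tensor_op_norm:
  assumes F: "thrice_differentiable d F" and w: "w \<in> Rspace d"
    and h: "h \<in> Rspace d" and k: "k \<in> Rspace d" and l: "l \<in> Rspace d"
  shows "\<bar>third_deriv d F w h k l\<bar> \<le> tensor_op_norm d (third_deriv d F w) * norm h * norm k * norm l"
proof -
  let ?T = "third_deriv d F w"
  let ?D = "\<lambda>h. frechet_derivative (\<lambda>v. hess d F v h) (at w within Rspace d)"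
  let ?B = "Rspace d \<inter> cball 0 1"
  have D: "bounded_linear (?D h)" if "h \<in> Rspace d" for h
    using third_deriv_has_derivative[OF F w that] by (rule has_derivative_bounded_linear)
  have "bdd_above ((\<lambda>(h, k, l). \<bar>?T h k l\<bar>) ` (?B \<times> ?B \<times> ?B))"
  proof (rule bdd_aboveI2, clarify)
    fix h k l assume hkl: "h \<in> Rspace d" "h \<in> cball 0 1" "k \<in> Rspace d" "k \<in> cball 0 1"
      "l \<in> Rspace d" "l \<in> cball 0 1"
    have "?T h k l = (\<Sum>i<d. coord h i * ?T (unit_rvec i) k l)"
      by (rule third_deriv_expansion[OF F w hkl(1,3)])
         (use unit_rvec_in_Rspace Rspace_expansion[OF hkl(1)] in auto)
    also have "\<bar>\<dots>\<bar> \<le> (\<Sum>i<d. \<bar>coord h i * ?T (unit_rvec i) k l\<bar>)" by (rule sum_abs)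
    also have "\<dots> \<le> (\<Sum>i<d. onorm (?D (unit_rvec i)))"
    proof (rule sum_mono)
      fix i assume "i \<in> {..<d}"
      then have Di: "bounded_linear (?D (unit_rvec i))" by (intro D unit_rvec_in_Rspace) auto
      have "\<bar>?T (unit_rvec i) k l\<bar> \<le> norm (?D (unit_rvec i) k) * norm l"
        unfolding third_deriv_def by (rule Cauchy_Schwarz_ineq2)
      also have "\<dots> \<le> (onorm (?D (unit_rvec i)) * norm k) * norm l"
        by (intro mult_right_mono onorm Di) auto
      also have "\<dots> \<le> (onorm (?D (unit_rvec i)) * 1) * 1"
        using hkl onorm_pos_le[OF Di] by (intro mult_mono mult_left_mono) auto
      finally have "\<bar>?T (unit_rvec i) k l\<bar> \<le> onorm (?D (unit_rvec i))" by simp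
      moreover have "\<bar>coord h i\<bar> \<le> 1" using abs_coord_le_norm[of h i] hkl by simp
      ultimately have "\<bar>coord h i\<bar> * \<bar>?T (unit_rvec i) k l\<bar> \<le> 1 * onorm (?D (unit_rvec i))"
        by (intro mult_mono) auto
      then show "\<bar>coord h i * ?T (unit_rvec i) k l\<bar> \<le> onorm (?D (unit_rvec i))" by (simp add: abs_mult)
    qed
    finally show "\<bar>?T h k l\<bar> \<le> (\<Sum>i<d. onorm (?D (unit_rvec i)))" .
  qed
  then have unit_bound: "\<bar>?T h k l\<bar> \<le> tensor_op_norm d ?T" if "h \<in> ?B" "k \<in> ?B" "l \<in> ?B" for h k l
    unfolding tensor_op_norm_def Let_def using cSUP_upper[of "(h, k, l)" "?B \<times> ?B \<times> ?B"] that by fastforce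
  \<comment> \<open>For \<open>x = 0\<close> the quotient is \<open>0\<close>, so normalisation
    needs no case distinction.\<close>
  have unit: "x /\<^sub>R norm x \<in> ?B" "x = norm x *\<^sub>R (x /\<^sub>R norm x)" if "x \<in> Rspace d" for x
    using subspace_scale[OF subspace_Rspace that, of "inverse (norm x)"] by (auto simp: field_simps)
  define h' k' l' where defs: "h' = h /\<^sub>R norm h" "k' = k /\<^sub>R norm k" "l' = l /\<^sub>R norm l"
  \<comment> \<open>Homogeneity in \<open>h\<close> is the expansion over an index set with one
    element.\<close>
  have "?T h k l = (\<Sum>i\<in>{()}. norm h * ?T h' k l)"
    by (rule third_deriv_expansion[OF F w h k]) (use unit[OF h] in \<open>auto simp: defs\<close>)
  also have "\<dots> = norm h * (norm k * (norm l * ?T h' k' l'))"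
  proof -
    have "linear (?D h')" using D unit(1)[OF h] by (simp add: defs bounded_linear.linear)
    then have "?D h' k = norm k *\<^sub>R ?D h' k'"
      by (subst unit(2)[OF k]) (simp only: defs(2) linear_scale)
    moreover have "?D h' k' \<bullet> l = norm l * (?D h' k' \<bullet> l')"
      by (subst unit(2)[OF l]) (simp only: defs(3) inner_scaleR_right)
    ultimately show ?thesis by (simp add: third_deriv_def)
  qed
  finally have "\<bar>?T h k l\<bar> = norm h * norm k * norm l * \<bar>?T h' k' l'\<bar>" by (simp add: abs_mult mult_ac)
  also have "\<dots> \<le> norm h * norm k * norm l * tensor_op_norm d ?T"
    unfolding defs using h k l by (intro mult_left_mono unit_bound unit) auto
  finally show ?thesis by (simp add: mult_ac)
qed

section \<open>Lipschitz bounds and continuity of the Hessian\<close>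

lemma third_order_self_bounding_cases:
  assumes "third_order_self_bounding d F \<rho>1 \<rho>2"
  obtains (smooth) "thrice_differentiable d F"
      "\<And>w. w \<in> Rspace d \<Longrightarrow> tensor_op_norm d (third_deriv d F w) \<le> \<rho>2 (F w)"
    | (lipschitz) \<delta> where "0 < \<delta>" "\<And>w w'. w \<in> Rspace d \<Longrightarrow> w' \<in> Rspace d \<Longrightarrow> norm (w - w') \<le> \<delta> \<Longrightarrow>
         op_norm d (\<lambda>h. hess d F w h - hess d F w' h) \<le> \<rho>2 (F w) * norm (w - w')"
  using assms unfolding third_order_self_bounding_def
  apply (elim conjE disjE exE)
   apply (rule smooth; simp)
  apply (rule lipschitz; blast)
  done

lemma hess_lipschitz_on_segment:
  assumes F: "third_order_self_bounding d F \<rho>1 \<rho>2" and nonneg: "\<And>z. z \<in> Rspace d \<Longrightarrow> 0 \<le> F z"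
    and x: "x \<in> Rspace d" and y: "y \<in> Rspace d" and v: "v \<in> Rspace d"
    and seg: "\<And>s. 0 \<le> s \<Longrightarrow> s \<le> 1 \<Longrightarrow> F (x + s *\<^sub>R (y - x)) \<le> K"
  shows "norm (hess d F y v - hess d F x v) \<le> \<rho>2 K * norm (y - x) * norm v"
proof -
  have F2: "twice_differentiable d F" and \<rho>2: "self_bound_fun \<rho>2"
    using F by (auto simp: third_order_self_bounding_def second_order_self_bounding_def)
  define z where "z s = x + s *\<^sub>R (y - x)" for s
  have yx: "y - x \<in> Rspace d" using x y by (intro subspace_diff subspace_Rspace)
  have z: "z s \<in> Rspace d" for s
    unfolding z_def using x yx by (intro subspace_add subspace_scale subspace_Rspace)
  have level: "\<rho>2 (F (z s)) \<le> \<rho>2 K" if "0 \<le> s" "s \<le> 1" for s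
  proof -
    have "mono_on {0..} \<rho>2" using \<rho>2 by (simp add: self_bound_fun_def)
    moreover have "0 \<le> F (z s)" by (rule nonneg[OF z])
    moreover have "F (z s) \<le> K" using seg[OF that] by (simp add: z_def)
    ultimately show ?thesis by (intro mono_onD[of "{0..}" \<rho>2]) auto
  qed
  from F show ?thesis
  proof (cases rule: third_order_self_bounding_cases)
    case smooth
    \<comment> \<open>Pairing the Hessians with their own difference reduces to the scalar mean
      value theorem; one factor \<open>norm l\<close> is cancelled at the end.\<close>
    define l where "l = hess d F y v - hess d F x v"
    have l: "l \<in> Rspace d"
      unfolding l_def using F2 x y v by (intro subspace_diff subspace_Rspace hess_in_Rspace)
    have "((\<lambda>t. hess d F (z t) v \<bullet> l) has_real_derivative third_deriv d F (z s) v (y - x) l) (at s)" for s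
    proof -
      have "((\<lambda>t. hess d F (x + t *\<^sub>R (y - x)) v) has_vector_derivative
          frechet_derivative (\<lambda>u. hess d F u v) (at (z s) within Rspace d) (y - x)) (at s)"
        using has_vector_derivative_along_line[OF subspace_Rspace x yx, of "\<lambda>u. hess d F u v"]
          third_deriv_has_derivative[OF smooth(1) z v] by (simp add: z_def)
      then have "((\<lambda>t. hess d F (x + t *\<^sub>R (y - x)) v \<bullet> l) has_vector_derivative
          frechet_derivative (\<lambda>u. hess d F u v) (at (z s) within Rspace d) (y - x) \<bullet> l) (at s)"
        by (rule bounded_linear.has_vector_derivative[OF bounded_linear_inner_left])
      then show ?thesis
        by (simp add: has_real_derivative_iff_has_vector_derivative z_def third_deriv_def)
    qed
    then obtain s where s: "0 < s" "s < 1" and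
      mvt: "hess d F (z 1) v \<bullet> l - hess d F (z 0) v \<bullet> l = (1 - 0) * third_deriv d F (z s) v (y - x) l"
      using MVT2[of 0 1 "\<lambda>t. hess d F (z t) v \<bullet> l" "\<lambda>s. third_deriv d F (z s) v (y - x) l"] by auto
    have "norm l * norm l = l \<bullet> l" by (simp add: power2_norm_eq_inner flip: power2_eq_square)
    also have "\<dots> = hess d F y v \<bullet> l - hess d F x v \<bullet> l"
      by (simp only: inner_diff_left[symmetric] l_def[symmetric])
    also have "\<dots> = hess d F (z 1) v \<bullet> l - hess d F (z 0) v \<bullet> l" by (simp add: z_def)
    also have "\<dots> \<le> \<bar>third_deriv d F (z s) v (y - x) l\<bar>" using mvt by simp
    also have "\<dots> \<le> tensor_op_norm d (third_deriv d F (z s)) * norm v * norm (y - x) * norm l"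
      by (intro third_deriv_le_tensor_op_norm smooth z v yx l)
    also have "\<dots> \<le> \<rho>2 K * norm v * norm (y - x) * norm l"
      using smooth(2)[OF z, of s] level[of s] s by (intro mult_right_mono) auto
    finally have "norm l * norm l \<le> (\<rho>2 K * norm (y - x) * norm v) * norm l" by (simp add: mult_ac)
    moreover have "0 \<le> \<rho>2 K"
      using \<rho>2 seg[of 0] nonneg[OF x] by (auto simp: self_bound_fun_def)
    ultimately have "norm l \<le> \<rho>2 K * norm (y - x) * norm v"
      by (cases "l = 0") (auto simp: mult_le_cancel_right)
    then show ?thesis by (simp add: l_def)
  next
    case (lipschitz \<delta>)
    \<comment> \<open>Each of the \<open>n\<close> pieces is shorter than \<open>\<delta>\<close>.
      The bound is linear in the length, so summing the pieces removes \<open>n\<close>, and with it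
      \<open>\<delta>\<close>.\<close>
    obtain n :: nat where n: "norm (y - x) / \<delta> < real n" using reals_Archimedean2 by blast
    then have n_pos: "0 < real n" using lipschitz(1) by (meson divide_nonneg_pos norm_ge_zero order_le_less_trans)
    define p where "p i = z (real i / real n)" for i
    have step: "norm (hess d F (p (Suc i)) v - hess d F (p i) v) \<le> \<rho>2 K * (norm (y - x) / real n) * norm v"
      if i: "i < n" for i
    proof -
      have "p (Suc i) - p i = (1 / real n) *\<^sub>R (y - x)"
        by (simp add: p_def z_def add_divide_distrib scaleR_add_left)
      then have dist: "norm (p (Suc i) - p i) = norm (y - x) / real n" by simp
      have "norm (hess d F (p (Suc i)) v - hess d F (p i) v)
          \<le> op_norm d (\<lambda>h. hess d F (p (Suc i)) h - hess d F (p i) h) * norm v"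
        using F2 z v unfolding p_def
        by (intro norm_le_op_norm[of "\<lambda>h. hess d F _ h - hess d F _ h"] bounded_linear_sub hess_bounded_linear)
      also have "\<dots> \<le> (\<rho>2 (F (p (Suc i))) * norm (p (Suc i) - p i)) * norm v"
      proof (intro mult_right_mono lipschitz(2))
        show "norm (p (Suc i) - p i) \<le> \<delta>"
          unfolding dist using n lipschitz(1) n_pos by (simp add: field_simps)
      qed (simp_all add: p_def z)
      also have "\<dots> \<le> (\<rho>2 K * norm (p (Suc i) - p i)) * norm v"
        using i unfolding p_def by (intro mult_right_mono level) auto
      finally show ?thesis by (simp add: dist)
    qed
    have "norm (hess d F (p k) v - hess d F (p 0) v) \<le> real k * (\<rho>2 K * (norm (y - x) / real n) * norm v)"
      if "k \<le> n" for k
      using that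
    proof (induction k)
      case (Suc k)
      have "norm (hess d F (p (Suc k)) v - hess d F (p 0) v)
          \<le> norm (hess d F (p (Suc k)) v - hess d F (p k) v) + norm (hess d F (p k) v - hess d F (p 0) v)"
        using norm_triangle_ineq[of "hess d F (p (Suc k)) v - hess d F (p k) v" "hess d F (p k) v - hess d F (p 0) v"]
        by simp
      also have "\<dots> \<le> \<rho>2 K * (norm (y - x) / real n) * norm v
          + real k * (\<rho>2 K * (norm (y - x) / real n) * norm v)"
        using Suc step[of k] by (intro add_mono) auto
      finally show ?case by (simp add: algebra_simps add_divide_distrib)
    qed simp
    from this[of n] show ?thesis using n_pos by (simp add: p_def z_def)
  qed
qed

lemma hess_continuous:
  assumes F: "third_order_self_bounding d F \<rho>1 \<rho>2" and v: "v \<in> Rspace d"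
  shows "continuous_on (Rspace d) (\<lambda>w. hess d F w v)"
proof -
  have F2: "twice_differentiable d F"
    using F by (auto simp: third_order_self_bounding_def second_order_self_bounding_def)
  from F show ?thesis
  proof (cases rule: third_order_self_bounding_cases)
    case smooth
    then show ?thesis using v by (auto simp: thrice_differentiable_def intro: differentiable_imp_continuous_on)
  next
    case (lipschitz \<delta>)
    show ?thesis
      unfolding continuous_on_def
    proof
      fix w assume w: "w \<in> Rspace d"
      have "((\<lambda>w'. \<rho>2 (F w) * norm (w - w') * norm v) \<longlongrightarrow> \<rho>2 (F w) * norm (w - w) * norm v) (at w within Rspace d)"
        by (intro tendsto_intros)
      then have lim: "((\<lambda>w'. \<rho>2 (F w) * norm (w - w') * norm v) \<longlongrightarrow> 0) (at w within Rspace d)" by simp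
      have "\<forall>\<^sub>F w' in at w within Rspace d. norm (hess d F w' v - hess d F w v) \<le> \<rho>2 (F w) * norm (w - w') * norm v"
        unfolding eventually_at
      proof (intro exI[of _ \<delta>] conjI ballI impI lipschitz(1))
        fix w' assume w': "w' \<in> Rspace d" "w' \<noteq> w \<and> dist w' w < \<delta>"
        then have near: "norm (w - w') \<le> \<delta>" by (simp add: dist_norm norm_minus_commute)
        have "norm (hess d F w v - hess d F w' v) \<le> op_norm d (\<lambda>h. hess d F w h - hess d F w' h) * norm v"
          using F2 w w' v
          by (intro norm_le_op_norm[of "\<lambda>h. hess d F _ h - hess d F _ h"] bounded_linear_sub hess_bounded_linear)
        also have "\<dots> \<le> (\<rho>2 (F w) * norm (w - w')) * norm v"
          using w w' by (intro mult_right_mono lipschitz(2) near) auto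
        finally show "norm (hess d F w' v - hess d F w v) \<le> \<rho>2 (F w) * norm (w - w') * norm v"
          by (simp add: norm_minus_commute)
      qed
      then have "((\<lambda>w'. hess d F w' v - hess d F w v) \<longlongrightarrow> 0) (at w within Rspace d)"
        by (rule Lim_null_comparison[OF _ lim])
      then show "((\<lambda>w'. hess d F w' v) \<longlongrightarrow> hess d F w v) (at w within Rspace d)"
        by (rule LIM_zero_cancel)
    qed
  qed
qed

text \<open>The target condition has to be an event. It quantifies over uncountably many
  \<open>v\<close>, so measurability for each \<open>v\<close> would not be enough, whereas closed
  sets may be intersected freely.\<close>

lemma psd_shifted_hess_closed:
  assumes F: "third_order_self_bounding d F \<rho>1 \<rho>2"
  shows "closed {w \<in> Rspace d. psd d (\<lambda>v. hess d F w v + c *\<^sub>R v)}"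
proof -
  have "closed {w \<in> Rspace d. 0 \<le> v \<bullet> (hess d F w v + c *\<^sub>R v)}" if v: "v \<in> Rspace d" for v
    by (intro continuous_on_closed_Collect_le continuous_intros hess_continuous[OF F v] closed_Rspace)
  moreover have "{w \<in> Rspace d. psd d (\<lambda>v. hess d F w v + c *\<^sub>R v)} =
      (\<Inter>v\<in>Rspace d. {w \<in> Rspace d. 0 \<le> v \<bullet> (hess d F w v + c *\<^sub>R v)})"
    using subspace_0[OF subspace_Rspace] by (auto simp: psd_def)
  ultimately show ?thesis by (metis (no_types, lifting) closed_INT)
qed

section \<open>Gradient descent near strict saddles\<close>

lemma psd_form_Cauchy_Schwarz:
  fixes A :: "'a::real_inner \<Rightarrow> 'a"
  assumes V: "subspace V" and A: "linear A"
    and sym: "\<And>x y. x \<in> V \<Longrightarrow> y \<in> V \<Longrightarrow> x \<bullet> A y = y \<bullet> A x"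
    and psd: "\<And>x. x \<in> V \<Longrightarrow> 0 \<le> x \<bullet> A x"
    and xy: "x \<in> V" "y \<in> V"
  shows "(x \<bullet> A y)\<^sup>2 \<le> (x \<bullet> A x) * (y \<bullet> A y)"
proof -
  define a b c where abc: "a = x \<bullet> A x" "b = x \<bullet> A y" "c = y \<bullet> A y"
  have quad: "0 \<le> a + 2 * b * t + c * t\<^sup>2" for t
  proof -
    have "0 \<le> (x + t *\<^sub>R y) \<bullet> A (x + t *\<^sub>R y)"
      using V xy by (intro psd subspace_add subspace_scale)
    also have "\<dots> = a + 2 * b * t + c * t\<^sup>2"
      using sym[of y x] xy
      by (simp add: abc linear_add[OF A] linear_scale[OF A] inner_add_left inner_add_right
          power2_eq_square algebra_simps)
    finally show ?thesis .
  qed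
  have c: "0 \<le> c" unfolding abc using psd xy by blast
  have "b\<^sup>2 \<le> a * c"
  proof (cases "c = 0")
    case True
    have "b = 0"
    proof (rule ccontr)
      assume "b \<noteq> 0"
      \<comment> \<open>At this \<open>t\<close> the affine function \<open>a + 2 * b * t\<close>
        has the value \<open>-1\<close>.\<close>
      then show False using quad[of "- (a + 1) / (2 * b)"] True by simp
    qed
    then show ?thesis using True by simp
  next
    case False
    then have "0 < c" using c by simp
    \<comment> \<open>The point \<open>- b / c\<close> minimises the quadratic polynomial.\<close>
    have "0 \<le> a + 2 * b * (- b / c) + c * (- b / c)\<^sup>2" by (rule quad)
    also have "\<dots> = a - b\<^sup>2 / c" using \<open>0 < c\<close> by (simp add: field_simps power2_eq_square)
    finally show ?thesis using \<open>0 < c\<close> by (simp add: field_simps)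
  qed
  then show ?thesis by (simp add: abc)
qed

text \<open>Cauchy-Schwarz for the form with \<open>y = A x\<close> gives
  \<open>norm (A x) ^ 4 \<le> m\<^sup>2 * norm x ^ 2 * norm (A x) ^ 2\<close>, and a factor
  \<open>norm (A x) ^ 2\<close> cancels.\<close>

lemma psd_operator_norm_bound:
  fixes A :: "'a::real_inner \<Rightarrow> 'a"
  assumes V: "subspace V" and A: "linear A" and A_in: "\<And>x. x \<in> V \<Longrightarrow> A x \<in> V"
    and sym: "\<And>x y. x \<in> V \<Longrightarrow> y \<in> V \<Longrightarrow> x \<bullet> A y = y \<bullet> A x"
    and psd: "\<And>x. x \<in> V \<Longrightarrow> 0 \<le> x \<bullet> A x"
    and upper: "\<And>x. x \<in> V \<Longrightarrow> x \<bullet> A x \<le> m * (x \<bullet> x)"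
    and m: "0 \<le> m" and x: "x \<in> V"
  shows "norm (A x) \<le> m * norm x"
proof (cases "A x = 0")
  case False
  have "(x \<bullet> A (A x))\<^sup>2 \<le> (x \<bullet> A x) * (A x \<bullet> A (A x))"
    by (rule psd_form_Cauchy_Schwarz[OF V A sym psd x A_in[OF x]])
  also have "\<dots> \<le> (m * (x \<bullet> x)) * (m * (A x \<bullet> A x))"
    using x A_in psd m by (intro mult_mono upper) auto
  also have "x \<bullet> A (A x) = A x \<bullet> A x" using sym x A_in by blast
  finally have "(A x \<bullet> A x) * (A x \<bullet> A x) \<le> (m\<^sup>2 * (x \<bullet> x)) * (A x \<bullet> A x)"
    by (simp add: power2_eq_square mult_ac)
  moreover have "0 < A x \<bullet> A x" using False by simp
  ultimately have "A x \<bullet> A x \<le> m\<^sup>2 * (x \<bullet> x)" using mult_right_le_imp_le by blast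
  then have "(norm (A x))\<^sup>2 \<le> (m * norm x)\<^sup>2"
    by (simp add: power_mult_distrib power2_norm_eq_inner)
  then show ?thesis using m by (simp add: power2_le_iff_abs_le abs_mult)
qed (use m in simp)

text \<open>The eigenvector is a minimiser of the quadratic form on the unit sphere; the Cauchy-Schwarz
  inequality for the shifted, positive semidefinite form shows that it is one.\<close>

lemma negative_eigenvector:
  fixes A :: "'a::real_inner \<Rightarrow> 'a"
  assumes V: "subspace V" and cpt: "compact (V \<inter> sphere 0 1)"
    and A: "bounded_linear A" and A_in: "\<And>x. x \<in> V \<Longrightarrow> A x \<in> V"
    and sym: "\<And>x y. x \<in> V \<Longrightarrow> y \<in> V \<Longrightarrow> x \<bullet> A y = y \<bullet> A x"
    and v: "v \<in> V" "v \<bullet> A v < - \<gamma> * (v \<bullet> v)"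
  obtains l e where "\<gamma> < l" "e \<in> V" "norm e = 1" "A e = - l *\<^sub>R e"
    "\<And>x. x \<in> V \<Longrightarrow> - l * (x \<bullet> x) \<le> x \<bullet> A x"
proof -
  have linA: "linear A" using A by (rule bounded_linear.linear)
  have v0: "v \<noteq> 0" using v by auto
  have normed: "x /\<^sub>R norm x \<in> V \<inter> sphere 0 1" if "x \<in> V" "x \<noteq> 0" for x
    using that subspace_scale[OF V] by simp
  have "continuous_on (V \<inter> sphere 0 1) (\<lambda>x. x \<bullet> A x)"
    by (intro continuous_intros linear_continuous_on A)
  then obtain e where e: "e \<in> V" "norm e = 1"
    "\<And>x. x \<in> V \<inter> sphere 0 1 \<Longrightarrow> e \<bullet> A e \<le> x \<bullet> A x"
    using continuous_attains_inf[OF cpt, of "\<lambda>x. x \<bullet> A x"] normed[OF v(1) v0]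
    by (metis (no_types, lifting) IntE empty_iff mem_sphere_0)
  define l where "l = - (e \<bullet> A e)"
  have rayleigh: "- l * (x \<bullet> x) \<le> x \<bullet> A x" if "x \<in> V" for x
  proof (cases "x = 0")
    case False
    have "- l \<le> (x /\<^sub>R norm x) \<bullet> A (x /\<^sub>R norm x)"
      using e(3)[OF normed[OF that False]] by (simp add: l_def)
    also have "\<dots> = (x \<bullet> A x) / (x \<bullet> x)"
      by (simp add: linear_scale[OF linA] power2_norm_eq_inner[symmetric] power2_eq_square field_simps)
    finally show ?thesis using False by (simp add: field_simps)
  qed (simp add: linear_0[OF linA])
  have "- l * (v \<bullet> v) < - \<gamma> * (v \<bullet> v)" using rayleigh[OF v(1)] v(2) by linarith
  then have "\<gamma> < l" using v0 by simp
  define B where "B = (\<lambda>x. A x + l *\<^sub>R x)"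
  have linB: "linear B"
    unfolding B_def by (intro linear_compose_add linA linear_compose_scale_right linear_ident)
  have symB: "x \<bullet> B y = y \<bullet> B x" if "x \<in> V" "y \<in> V" for x y
    using sym[OF that] by (simp add: B_def inner_add_right inner_commute)
  have psdB: "0 \<le> x \<bullet> B x" if "x \<in> V" for x
    using rayleigh[OF that] by (simp add: B_def inner_add_right)
  have Be: "B e \<in> V" unfolding B_def using e V A_in by (intro subspace_add subspace_scale)
  have "e \<bullet> B e = 0"
    using e(2) unfolding norm_eq_1 by (simp add: B_def inner_add_right inner_diff_right l_def)
  then have "(B e \<bullet> B e)\<^sup>2 \<le> 0"
    using psd_form_Cauchy_Schwarz[OF V linB symB psdB Be e(1)] by simp
  then have "B e = 0" by simp
  then have "A e = - l *\<^sub>R e" by (simp add: B_def eq_neg_iff_add_eq_0)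
  with \<open>\<gamma> < l\<close> e rayleigh that show ?thesis by blast
qed

text \<open>The curvature bound is only known while \<open>h\<close> stays below the level \<open>K\<close>, and the resulting
  Taylor bound in turn keeps \<open>h\<close> below \<open>K\<close>.\<close>

lemma taylor_bound_continuation:
  fixes h h' h'' :: "real \<Rightarrow> real"
  assumes h: "\<And>s. (h has_real_derivative h' s) (at s)"
    and h': "\<And>s. (h' has_real_derivative h'' s) (at s)"
    and curv: "\<And>s. h s \<le> K \<Longrightarrow> h'' s \<le> m"
    and bound: "\<And>s. 0 \<le> s \<Longrightarrow> s \<le> S \<Longrightarrow> h 0 + h' 0 * s + m / 2 * s\<^sup>2 < K"
    and s: "0 \<le> s" "s \<le> S"
  shows "h s \<le> h 0 + h' 0 * s + m / 2 * s\<^sup>2"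
proof -
  have cont: "continuous_on T h" for T
    using h by (meson DERIV_isCont continuous_at_imp_continuous_on)
  have taylor: "h t \<le> h 0 + h' 0 * t + m / 2 * t\<^sup>2"
    if t: "0 \<le> t" and le: "\<And>s. 0 \<le> s \<Longrightarrow> s \<le> t \<Longrightarrow> h s \<le> K" for t
  proof (cases "t = 0")
    case False
    define D where "D = (\<lambda>n :: nat. if n = 0 then h else if n = 1 then h' else h'')"
    have "\<exists>c>0. c < t \<and> h t = (\<Sum>k<2. D k 0 / fact k * t ^ k) + D 2 c / fact 2 * t ^ 2"
      by (rule Maclaurin) (use t False h h' in \<open>auto simp: D_def less_2_cases_iff\<close>)
    then obtain c where c: "0 < c" "c < t" "h t = h 0 + h' 0 * t + h'' c / 2 * t\<^sup>2"
      by (auto simp: D_def numeral_2_eq_2)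
    have "h'' c \<le> m" using c le by (intro curv) auto
    then have "h'' c / 2 * t\<^sup>2 \<le> m / 2 * t\<^sup>2" by (intro mult_right_mono) auto
    then show ?thesis using c by linarith
  qed simp
  have "h t < K" if t: "0 \<le> t" "t \<le> S" for t
  proof (rule ccontr)
    assume "\<not> h t < K"
    \<comment> \<open>At the first parameter \<open>t0\<close> where \<open>K\<close> is reached,
      the left limit still gives \<open>h t0 \<le> K\<close>. The Taylor bound therefore holds up to
      \<open>t0\<close>, and being strictly below \<open>K\<close> it contradicts
      \<open>K \<le> h t0\<close>.\<close>
    define E where "E = {0..S} \<inter> {s. K \<le> h s}"
    have "E \<noteq> {}" using \<open>\<not> h t < K\<close> t by (auto simp: E_def)
    moreover have "closed {s. K \<le> h s}" by (intro closed_Collect_le cont continuous_on_const)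
    then have "compact E" unfolding E_def by (intro compact_Int_closed) auto
    ultimately obtain t0 where t0: "t0 \<in> E" "\<And>s. s \<in> E \<Longrightarrow> t0 \<le> s"
      using compact_attains_inf by metis
    have below: "h s < K" if "0 \<le> s" "s < t0" for s
      using t0(2)[of s] t0(1) that by (force simp: E_def)
    have t0_pos: "0 < t0"
      using bound[of 0] t0(1) s by (cases "t0 = 0") (auto simp: E_def)
    have "h t0 \<le> K"
    proof (rule tendsto_upperbound)
      show "(h \<longlongrightarrow> h t0) (at_left t0)"
        using h[of t0] DERIV_isCont by (auto simp: isCont_def intro: filterlim_at_split[THEN iffD1, THEN conjunct1])
      show "\<forall>\<^sub>F s in at_left t0. h s \<le> K"
        using eventually_at_left_real[OF t0_pos]
        by eventually_elim (auto intro: less_imp_le below)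
    qed simp
    then have "h t0 \<le> h 0 + h' 0 * t0 + m / 2 * t0\<^sup>2"
      using below t0_pos by (intro taylor) (auto simp: order_le_less)
    also have "\<dots> < K" using t0(1) by (intro bound) (auto simp: E_def)
    finally show False using t0(1) by (auto simp: E_def)
  qed
  then show ?thesis using s by (intro taylor) (auto intro: less_imp_le)
qed

text \<open>Derivatives enter only along lines, which frees the dynamics from derivatives within a
  subspace. Descent steps are taken from levels up to \<open>f0 + 1\<close>; the curvature bound
  reaches one unit further, as the continuation argument needs a strict gap.\<close>

locale self_bounded_landscape =
  fixes V :: "'a::real_inner set" and F :: "'a \<Rightarrow> real" and g :: "'a \<Rightarrow> 'a" and H :: "'a \<Rightarrow> 'a \<Rightarrow> 'a"
    and f0 M :: real
  assumes V: "subspace V" and cpt: "compact (V \<inter> sphere 0 1)"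
    and F_nonneg: "\<And>x. x \<in> V \<Longrightarrow> 0 \<le> F x"
    and g_in: "\<And>x. x \<in> V \<Longrightarrow> g x \<in> V"
    and F_deriv: "\<And>x v s. x \<in> V \<Longrightarrow> v \<in> V \<Longrightarrow>
      ((\<lambda>s. F (x + s *\<^sub>R v)) has_real_derivative g (x + s *\<^sub>R v) \<bullet> v) (at s)"
    and g_deriv: "\<And>x v s. x \<in> V \<Longrightarrow> v \<in> V \<Longrightarrow>
      ((\<lambda>s. g (x + s *\<^sub>R v)) has_vector_derivative H (x + s *\<^sub>R v) v) (at s)"
    and H_linear: "\<And>x. x \<in> V \<Longrightarrow> bounded_linear (H x)"
    and H_in: "\<And>x v. x \<in> V \<Longrightarrow> v \<in> V \<Longrightarrow> H x v \<in> V"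
    and H_sym: "\<And>x v w. x \<in> V \<Longrightarrow> v \<in> V \<Longrightarrow> w \<in> V \<Longrightarrow> v \<bullet> H x w = w \<bullet> H x v"
    and H_bound: "\<And>x v. x \<in> V \<Longrightarrow> v \<in> V \<Longrightarrow> F x \<le> f0 + 2 \<Longrightarrow> norm (H x v) \<le> M * norm v"
    and M_pos: "0 < M"
begin

lemma line_in: "x \<in> V \<Longrightarrow> v \<in> V \<Longrightarrow> x + s *\<^sub>R v \<in> V"
  by (intro subspace_add subspace_scale V)

lemma taylor_bound:
  assumes x: "x \<in> V" and v: "v \<in> V"
    and bound: "\<And>s. 0 \<le> s \<Longrightarrow> s \<le> S \<Longrightarrow> F x + (g x \<bullet> v) * s + M * (norm v)\<^sup>2 / 2 * s\<^sup>2 < f0 + 2"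
    and s: "0 \<le> s" "s \<le> S"
  shows "F (x + s *\<^sub>R v) \<le> F x + (g x \<bullet> v) * s + M * (norm v)\<^sup>2 / 2 * s\<^sup>2"
proof -
  have "F (x + s *\<^sub>R v) \<le>
      F (x + 0 *\<^sub>R v) + (g (x + 0 *\<^sub>R v) \<bullet> v) * s + M * (norm v)\<^sup>2 / 2 * s\<^sup>2"
  proof (rule taylor_bound_continuation[where h = "\<lambda>s. F (x + s *\<^sub>R v)" and K = "f0 + 2"
        and h' = "\<lambda>s. g (x + s *\<^sub>R v) \<bullet> v" and h'' = "\<lambda>s. H (x + s *\<^sub>R v) v \<bullet> v", OF _ _ _ _ s])
    show "((\<lambda>s. F (x + s *\<^sub>R v)) has_real_derivative g (x + s *\<^sub>R v) \<bullet> v) (at s)" for s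
      using F_deriv x v by blast
    have "((\<lambda>s. g (x + s *\<^sub>R v) \<bullet> v) has_vector_derivative H (x + s *\<^sub>R v) v \<bullet> v) (at s)" for s
      by (rule bounded_linear.has_vector_derivative[OF bounded_linear_inner_left g_deriv[OF x v]])
    then show "((\<lambda>s. g (x + s *\<^sub>R v) \<bullet> v) has_real_derivative H (x + s *\<^sub>R v) v \<bullet> v) (at s)" for s
      by (simp add: has_real_derivative_iff_has_vector_derivative)
    show "H (x + s *\<^sub>R v) v \<bullet> v \<le> M * (norm v)\<^sup>2" if "F (x + s *\<^sub>R v) \<le> f0 + 2" for s
    proof -
      have "H (x + s *\<^sub>R v) v \<bullet> v \<le> norm (H (x + s *\<^sub>R v) v) * norm v"
        by (rule norm_cauchy_schwarz)
      also have "\<dots> \<le> (M * norm v) * norm v"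
        by (intro mult_right_mono H_bound line_in x v that) auto
      finally show ?thesis by (simp add: power2_eq_square mult_ac)
    qed
  qed (use bound in simp)
  then show ?thesis by simp
qed

text \<open>Along the negative gradient the Taylor bound is \<open>F x\<close> minus
  \<open>norm (g x) ^ 2 * s * (1 - M * s / 2)\<close>. It never exceeds \<open>F x\<close> for
  \<open>0 \<le> s \<le> 1 / M\<close>, hence stays below \<open>f0 + 2\<close>.\<close>

lemma descent_step:
  assumes x: "x \<in> V" and Fx: "F x \<le> f0 + 1"
  shows "F (x - (1 / M) *\<^sub>R g x) \<le> F x - (norm (g x))\<^sup>2 / (2 * M)"
proof -
  have v: "- g x \<in> V" using x g_in V by (simp add: subspace_neg)
  have eq: "F x + (g x \<bullet> - g x) * s + M * (norm (- g x))\<^sup>2 / 2 * s\<^sup>2 =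
      F x - (norm (g x))\<^sup>2 * (s * (1 - M * s / 2))" for s
    unfolding power2_norm_eq_inner by (simp add: power2_eq_square algebra_simps)
  have "F (x + (1 / M) *\<^sub>R (- g x)) \<le>
      F x + (g x \<bullet> - g x) * (1 / M) + M * (norm (- g x))\<^sup>2 / 2 * (1 / M)\<^sup>2"
  proof (rule taylor_bound[OF x v])
    fix s :: real assume s: "0 \<le> s" "s \<le> 1 / M"
    then have "s * M \<le> 1" using M_pos by (simp add: field_simps)
    then have "0 \<le> (norm (g x))\<^sup>2 * (s * (1 - M * s / 2))"
      using s by (intro mult_nonneg_nonneg) (auto simp: mult.commute)
    then show "F x + (g x \<bullet> - g x) * s + M * (norm (- g x))\<^sup>2 / 2 * s\<^sup>2 < f0 + 2"
      unfolding eq using Fx by linarith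
  qed (use M_pos in auto)
  also have "\<dots> = F x - (norm (g x))\<^sup>2 / (2 * M)"
    unfolding eq using M_pos by (simp add: field_simps)
  finally show ?thesis by simp
qed

text \<open>One descent step cannot lower \<open>F\<close> by more than \<open>F x\<close>, because
  \<open>F\<close> is nonnegative.\<close>

lemma gradient_bound:
  assumes x: "x \<in> V" and Fx: "F x \<le> f0"
  shows "norm (g x) \<le> sqrt (2 * M * f0)"
proof (rule real_le_rsqrt)
  have "x - (1 / M) *\<^sub>R g x \<in> V" using x g_in V by (intro subspace_diff subspace_scale)
  then have "0 \<le> F x - (norm (g x))\<^sup>2 / (2 * M)"
    using F_nonneg descent_step[OF x] Fx order_trans by fastforce
  then have "(norm (g x))\<^sup>2 / (2 * M) \<le> f0" using Fx by linarith
  then show "(norm (g x))\<^sup>2 \<le> 2 * M * f0" using M_pos by (simp add: field_simps)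
qed

text \<open>Serves twice: it limits the rise of \<open>F\<close> caused by a perturbation, and it
  keeps \<open>F\<close> below \<open>f0 + 1\<close> within radius \<open>R\<close>, where the
  Hessian is to be Lipschitz.\<close>

lemma nearby_value:
  assumes x: "x \<in> V" and y: "y \<in> V" and Fx: "F x \<le> f0"
    and near: "norm (g x) * norm (y - x) + M / 2 * (norm (y - x))\<^sup>2 \<le> 1"
  shows "F y \<le> F x + norm (g x) * norm (y - x) + M / 2 * (norm (y - x))\<^sup>2"
proof -
  have v: "y - x \<in> V" using x y V by (intro subspace_diff)
  have le: "(g x \<bullet> (y - x)) * s + M * (norm (y - x))\<^sup>2 / 2 * s\<^sup>2
      \<le> norm (g x) * norm (y - x) + M / 2 * (norm (y - x))\<^sup>2" if "0 \<le> s" "s \<le> 1" for s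
  proof -
    have "(g x \<bullet> (y - x)) * s \<le> (norm (g x) * norm (y - x)) * 1"
      using that norm_cauchy_schwarz by (intro mult_mono) auto
    moreover have "M * (norm (y - x))\<^sup>2 / 2 * s\<^sup>2 \<le> M * (norm (y - x))\<^sup>2 / 2 * 1"
      using that M_pos by (intro mult_left_mono) (auto simp: power_le_one)
    ultimately show ?thesis by simp
  qed
  have "F (x + 1 *\<^sub>R (y - x)) \<le>
      F x + (g x \<bullet> (y - x)) * 1 + M * (norm (y - x))\<^sup>2 / 2 * 1\<^sup>2"
  proof (rule taylor_bound[OF x v, of 1])
    fix s :: real assume "0 \<le> s" "s \<le> 1"
    then show "F x + (g x \<bullet> (y - x)) * s + M * (norm (y - x))\<^sup>2 / 2 * s\<^sup>2 < f0 + 2"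
      using le[of s] Fx near by linarith
  qed auto
  then show ?thesis using le[of 1] by simp
qed

section \<open>Descent and localization of gradient descent iterates\<close>

definition gd :: "'a \<Rightarrow> 'a" where
  "gd x = x - (1 / M) *\<^sub>R g x"

lemma gd_in: "x \<in> V \<Longrightarrow> gd x \<in> V"
  unfolding gd_def using g_in V by (intro subspace_diff subspace_scale)

lemma gd_iter_in: "x \<in> V \<Longrightarrow> (gd ^^ n) x \<in> V"
  by (induction n) (auto intro: gd_in)

lemma gd_iter_descent:
  assumes "x \<in> V" "F x \<le> f0 + 1"
  shows "F ((gd ^^ n) x) \<le> F x - (\<Sum>i<n. (norm (g ((gd ^^ i) x)))\<^sup>2) / (2 * M)"
proof (induction n)
  case (Suc n)
  have "0 \<le> (\<Sum>i<n. (norm (g ((gd ^^ i) x)))\<^sup>2) / (2 * M)"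
    using M_pos by (intro divide_nonneg_pos sum_nonneg) auto
  then have "F ((gd ^^ n) x) \<le> f0 + 1" using Suc assms by linarith
  then have "F ((gd ^^ Suc n) x) \<le> F ((gd ^^ n) x) - (norm (g ((gd ^^ n) x)))\<^sup>2 / (2 * M)"
    using descent_step[OF gd_iter_in[OF assms(1)]] by (simp add: gd_def)
  then show ?case using Suc by (simp add: add_divide_distrib)
qed simp

lemma gd_iter_antimono:
  assumes "x \<in> V" "F x \<le> f0 + 1" "m \<le> n"
  shows "F ((gd ^^ n) x) \<le> F ((gd ^^ m) x)"
proof -
  have le: "F ((gd ^^ k) y) \<le> F y" if "y \<in> V" "F y \<le> f0 + 1" for k y
  proof -
    have "0 \<le> (\<Sum>i<k. (norm (g ((gd ^^ i) y)))\<^sup>2) / (2 * M)"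
      using M_pos by (intro divide_nonneg_pos sum_nonneg) auto
    then show ?thesis using gd_iter_descent[OF that, of k] by linarith
  qed
  have "F ((gd ^^ (n - m)) ((gd ^^ m) x)) \<le> F ((gd ^^ m) x)"
    using le[of x m] assms by (intro le gd_iter_in) auto
  moreover have "(gd ^^ (n - m)) ((gd ^^ m) x) = (gd ^^ n) x"
    using assms(3) by (metis comp_apply funpow_add le_add_diff_inverse2)
  ultimately show ?thesis by simp
qed

text \<open>The distance travelled is at most the sum of the step lengths. Cauchy-Schwarz over the
  \<open>n\<close> steps turns it into the sum of squared gradients, which the decrease of
  \<open>F\<close> pays for.\<close>

lemma gd_iter_localized:
  assumes "x \<in> V" "F x \<le> f0 + 1"
  shows "(norm ((gd ^^ n) x - x))\<^sup>2 \<le> 2 * real n / M * (F x - F ((gd ^^ n) x))"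
proof -
  define a where "a i = norm (g ((gd ^^ i) x))" for i
  have "norm ((gd ^^ n) x - x) \<le> (1 / M) * (\<Sum>i<n. a i)"
  proof (induction n)
    case (Suc n)
    have "norm ((gd ^^ Suc n) x - x) =
        norm (((gd ^^ n) x - x) - (1 / M) *\<^sub>R g ((gd ^^ n) x))"
      by (simp add: gd_def algebra_simps)
    also have "\<dots> \<le> norm ((gd ^^ n) x - x) + (1 / M) * a n"
      using M_pos norm_triangle_ineq4[of "(gd ^^ n) x - x" "(1 / M) *\<^sub>R g ((gd ^^ n) x)"]
      by (simp add: a_def)
    finally show ?case using Suc by (simp add: distrib_left)
  qed simp
  then have "(norm ((gd ^^ n) x - x))\<^sup>2 \<le> ((1 / M) * (\<Sum>i<n. a i))\<^sup>2"
    by (intro power_mono) auto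
  also have "\<dots> \<le> (1 / M)\<^sup>2 * (real n * (\<Sum>i<n. (a i)\<^sup>2))"
    unfolding power_mult_distrib
    using sum_squared_le_sum_of_squares[of a "{..<n}"]
    by (intro mult_left_mono) (auto simp: mult.commute)
  also have "\<dots> = 2 * real n / M * ((\<Sum>i<n. (a i)\<^sup>2) / (2 * M))"
    using M_pos by (simp add: power2_eq_square)
  also have "\<dots> \<le> 2 * real n / M * (F x - F ((gd ^^ n) x))"
    using gd_iter_descent[OF assms, of n] M_pos by (intro mult_left_mono) (auto simp: a_def)
  finally show ?thesis .
qed

end

locale lipschitz_landscape = self_bounded_landscape +
  fixes R \<rho> :: real
  assumes H_lipschitz: "\<And>u x v. u \<in> V \<Longrightarrow> x \<in> V \<Longrightarrow> v \<in> V \<Longrightarrow> F u \<le> f0 \<Longrightarrow> norm (x - u) \<le> R \<Longrightarrow>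
      norm (H x v - H u v) \<le> \<rho> * norm (x - u) * norm v"
    and \<rho>_nonneg: "0 \<le> \<rho>"
begin

text \<open>The ball of radius \<open>D\<close> around \<open>u\<close> contains the segment from
  \<open>y\<close> to \<open>x\<close>, so along it the Hessian differs from \<open>H u\<close> by
  at most \<open>\<rho> * D\<close>.\<close>

lemma gradient_difference:
  assumes u: "u \<in> V" "F u \<le> f0" and x: "x \<in> V" "norm (x - u) \<le> D"
    and y: "y \<in> V" "norm (y - u) \<le> D" and D: "D \<le> R"
  shows "norm (g x - g y - H u (x - y)) \<le> \<rho> * D * norm (x - y)"
proof -
  define v where "v = x - y"
  have v: "v \<in> V" unfolding v_def using V x y by (intro subspace_diff)
  define \<phi> where "\<phi> = (\<lambda>s. g (y + s *\<^sub>R v) - s *\<^sub>R H u v)"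
  have "norm (\<phi> 1 - \<phi> 0) \<le> (\<rho> * D * norm v) * norm (1 - 0 :: real)"
  proof (rule differentiable_bound[of "{0..1}" \<phi> "\<lambda>s h. h *\<^sub>R (H (y + s *\<^sub>R v) v - H u v)"])
    fix s :: real assume s: "s \<in> {0..1}"
    have "(\<phi> has_vector_derivative (H (y + s *\<^sub>R v) v - H u v)) (at s)"
      unfolding \<phi>_def
      by (intro has_vector_derivative_diff g_deriv y v)
         (auto intro!: derivative_eq_intros simp: has_vector_derivative_def)
    then show "(\<phi> has_derivative (\<lambda>h. h *\<^sub>R (H (y + s *\<^sub>R v) v - H u v))) (at s within {0..1})"
      unfolding has_vector_derivative_def by (rule has_derivative_at_withinI)
    have seg: "norm (y + s *\<^sub>R v - u) \<le> D"
    proof -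
      have "y + s *\<^sub>R v - u = (1 - s) *\<^sub>R (y - u) + s *\<^sub>R (x - u)"
        by (simp add: v_def algebra_simps)
      also have "norm \<dots> \<le> (1 - s) * norm (y - u) + s * norm (x - u)"
        using norm_triangle_ineq[of "(1 - s) *\<^sub>R (y - u)" "s *\<^sub>R (x - u)"] s by simp
      also have "\<dots> \<le> (1 - s) * D + s * D"
        using s x y by (intro add_mono mult_left_mono) auto
      finally show ?thesis by (simp add: algebra_simps)
    qed
    have "norm (H (y + s *\<^sub>R v) v - H u v) \<le> \<rho> * norm (y + s *\<^sub>R v - u) * norm v"
      using seg D by (intro H_lipschitz line_in u y v) auto
    also have "\<dots> \<le> \<rho> * D * norm v"
      using seg \<rho>_nonneg by (intro mult_right_mono mult_left_mono) auto
    finally have *: "norm (H (y + s *\<^sub>R v) v - H u v) \<le> \<rho> * D * norm v" .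
    show "onorm (\<lambda>h. h *\<^sub>R (H (y + s *\<^sub>R v) v - H u v)) \<le> \<rho> * D * norm v"
    proof (rule onorm_le)
      fix h :: real
      show "norm (h *\<^sub>R (H (y + s *\<^sub>R v) v - H u v)) \<le> \<rho> * D * norm v * norm h"
        using mult_right_mono[OF *, of "\<bar>h\<bar>"] by (simp add: mult.commute)
    qed
  qed auto
  then show ?thesis by (simp add: \<phi>_def v_def algebra_simps)
qed

text \<open>The error \<open>q t\<close> against the exact linear dynamics \<open>(1 + l / M) ^ t * \<mu> * e\<close> is propagated by
  an operator of norm at most \<open>1 + l / M\<close> and grows by at most a \<open>\<rho> * D / M\<close> fraction of the
  difference per step.\<close>

lemma coupled_divergence:
  assumes u: "u \<in> V" "F u \<le> f0" and xy: "x \<in> V" "y \<in> V"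
    and near: "\<And>t. t < n \<Longrightarrow> norm ((gd ^^ t) x - u) \<le> D" "\<And>t. t < n \<Longrightarrow> norm ((gd ^^ t) y - u) \<le> D"
    and D: "0 \<le> D" "D \<le> R" and small: "3 * real n * \<rho> * D \<le> M"
    and e: "e \<in> V" "norm e = 1" "H u e = - l *\<^sub>R e" and l: "0 \<le> l"
    and lowest: "\<And>z. z \<in> V \<Longrightarrow> - l * (z \<bullet> z) \<le> z \<bullet> H u z"
    and diff: "x - y = \<mu> *\<^sub>R e"
  shows "\<bar>\<mu>\<bar> / 2 * (1 + l / M) ^ n \<le> norm ((gd ^^ n) x - (gd ^^ n) y)"
proof -
  define b where "b = 1 + l / M"
  define \<kappa> where "\<kappa> = \<rho> * D / M"
  define B where "B = (\<lambda>z. z - (1 / M) *\<^sub>R H u z)"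
  define q where "q t = ((gd ^^ t) x - (gd ^^ t) y) - (b ^ t * \<mu>) *\<^sub>R e" for t
  have b: "1 \<le> b" using l M_pos by (simp add: b_def)
  have \<kappa>: "0 \<le> \<kappa>" using \<rho>_nonneg D M_pos by (simp add: \<kappa>_def)
  have linH: "linear (H u)" using H_linear[OF u(1)] by (rule bounded_linear.linear)
  have linB: "linear B"
    unfolding B_def by (intro linear_compose_sub linear_ident linear_compose_scale_right linH)
  \<comment> \<open>The form of \<open>B\<close> is nonnegative because the step is
    \<open>1 / M\<close> and the Hessian at \<open>u\<close> is at most \<open>M\<close>; it is at
    most \<open>b\<close> because \<open>- l\<close> is the lowest curvature at
    \<open>u\<close>.\<close>
  have B_norm: "norm (B z) \<le> b * norm z" if z: "z \<in> V" for z
  proof (rule psd_operator_norm_bound[OF V linB])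
    show "B z \<in> V" if "z \<in> V" for z
      unfolding B_def using that V u by (intro subspace_diff subspace_scale H_in)
    show "z \<bullet> B w = w \<bullet> B z" if "z \<in> V" "w \<in> V" for z w
      using H_sym[OF u(1) that] by (simp add: B_def inner_diff_right inner_commute)
    show "0 \<le> z \<bullet> B z" if "z \<in> V" for z
    proof -
      have "z \<bullet> H u z \<le> norm z * norm (H u z)" by (rule norm_cauchy_schwarz)
      also have "\<dots> \<le> norm z * (M * norm z)"
        using u that by (intro mult_left_mono H_bound) auto
      finally have "z \<bullet> H u z \<le> M * (z \<bullet> z)"
        by (simp add: power2_norm_eq_inner[symmetric] power2_eq_square mult_ac)
      then show ?thesis using M_pos by (simp add: B_def inner_diff_right field_simps)
    qed
    show "z \<bullet> B z \<le> b * (z \<bullet> z)" if "z \<in> V" for z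
      using divide_right_mono[of "- (z \<bullet> H u z)" "l * (z \<bullet> z)" M] lowest[OF that] M_pos
      by (simp add: B_def b_def inner_diff_right algebra_simps)
  qed (use b z in auto)
  \<comment> \<open>The smallness assumption says \<open>3 / 2 * n * \<kappa> \<le> 1 / 2\<close>.
    The error thus stays below half of the main term and the whole difference below
    \<open>3 / 2\<close> of it; that \<open>3 / 2\<close> is what enters the next error.\<close>
  have q_bound: "norm (q t) \<le> 3 / 2 * real t * \<kappa> * (b ^ t * \<bar>\<mu>\<bar>)" if "t \<le> n" for t
    using that
  proof (induction t)
    case 0
    then show ?case by (simp add: q_def diff)
  next
    case (Suc t)
    define dx where "dx = (gd ^^ t) x - (gd ^^ t) y"
    define err where "err = g ((gd ^^ t) x) - g ((gd ^^ t) y) - H u dx"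
    have bt: "0 \<le> b ^ t * \<bar>\<mu>\<bar>" using b by simp
    have IH: "norm (q t) \<le> 3 / 2 * real t * \<kappa> * (b ^ t * \<bar>\<mu>\<bar>)" using Suc by simp
    have "3 * real t * \<kappa> \<le> 3 * real n * \<kappa>" using Suc \<kappa> by (intro mult_right_mono) auto
    also have "\<dots> \<le> 1" using small M_pos by (simp add: \<kappa>_def field_simps)
    finally have "3 / 2 * real t * \<kappa> \<le> 1 / 2" by linarith
    then have "3 / 2 * real t * \<kappa> * (b ^ t * \<bar>\<mu>\<bar>) \<le> 1 / 2 * (b ^ t * \<bar>\<mu>\<bar>)"
      using bt by (rule mult_right_mono)
    moreover have "norm dx \<le> norm (q t) + b ^ t * \<bar>\<mu>\<bar>"
      using norm_triangle_ineq[of "q t" "(b ^ t * \<mu>) *\<^sub>R e"] e b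
      by (simp add: q_def dx_def abs_mult)
    ultimately have dx: "norm dx \<le> 3 / 2 * (b ^ t * \<bar>\<mu>\<bar>)" using IH by linarith
    have "norm err \<le> \<rho> * D * norm dx"
      unfolding err_def dx_def using Suc near D
      by (intro gradient_difference u gd_iter_in xy) auto
    then have err: "norm ((1 / M) *\<^sub>R err) \<le> \<kappa> * norm dx"
      using M_pos by (simp add: \<kappa>_def divide_right_mono)
    have "B e = b *\<^sub>R e" by (simp add: B_def b_def e(3) algebra_simps)
    then have "q (Suc t) = B (q t) - (1 / M) *\<^sub>R err"
      by (simp add: q_def linear_diff[OF linB] linear_scale[OF linB])
         (simp add: B_def err_def dx_def gd_def linear_diff[OF linH] algebra_simps)
    moreover have "q t \<in> V"
      unfolding q_def using V xy e by (intro subspace_diff subspace_scale gd_iter_in)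
    ultimately have "norm (q (Suc t)) \<le> b * norm (q t) + \<kappa> * norm dx"
      using norm_triangle_ineq4[of "B (q t)" "(1 / M) *\<^sub>R err"] B_norm[of "q t"] err by simp
    also have "\<dots> \<le> b * (3 / 2 * real t * \<kappa> * (b ^ t * \<bar>\<mu>\<bar>)) + \<kappa> * (3 / 2 * (b ^ t * \<bar>\<mu>\<bar>))"
      using IH dx b \<kappa> by (intro add_mono mult_left_mono) auto
    also have "\<dots> \<le> b * (3 / 2 * real t * \<kappa> * (b ^ t * \<bar>\<mu>\<bar>)) + b * (\<kappa> * (3 / 2 * (b ^ t * \<bar>\<mu>\<bar>)))"
      using mult_right_mono[OF b, of "\<kappa> * (3 / 2 * (b ^ t * \<bar>\<mu>\<bar>))"] \<kappa> bt by simp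
    also have "\<dots> = 3 / 2 * real (Suc t) * \<kappa> * (b ^ Suc t * \<bar>\<mu>\<bar>)"
      by (simp add: algebra_simps)
    finally show ?case .
  qed
  have bn: "0 \<le> b ^ n * \<bar>\<mu>\<bar>" using b by simp
  have "3 / 2 * real n * \<kappa> * (b ^ n * \<bar>\<mu>\<bar>) \<le> 1 / 2 * (b ^ n * \<bar>\<mu>\<bar>)"
    using bn small M_pos by (intro mult_right_mono) (auto simp: \<kappa>_def field_simps)
  then have "norm (q n) \<le> 1 / 2 * (b ^ n * \<bar>\<mu>\<bar>)" by (rule order_trans[OF q_bound[OF order_refl]])
  moreover have "b ^ n * \<bar>\<mu>\<bar> \<le> norm ((gd ^^ n) x - (gd ^^ n) y) + norm (q n)"
    using norm_triangle_ineq4[of "(gd ^^ n) x - (gd ^^ n) y" "q n"] e b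
    by (simp add: q_def abs_mult)
  ultimately show ?thesis by (simp add: b_def mult.commute)
qed

text \<open>The perturbation raises \<open>F\<close> by at most \<open>fth\<close> and a stuck run
  ends less than \<open>fth\<close> below \<open>F u\<close>, so its total decrease is at most
  \<open>2 * fth\<close>. This confines it to distance \<open>S\<close> from \<open>u + z\<close>,
  and \<open>norm z \<le> S\<close> gives the second \<open>S\<close>.\<close>

lemma stuck_localized:
  assumes u: "u \<in> V" "F u \<le> f0" "norm (g u) \<le> \<epsilon>" and z: "z \<in> V" "norm z \<le> r"
    and stuck: "F u - fth < F ((gd ^^ n) (u + z))"
    and r: "\<epsilon> * r + M / 2 * r\<^sup>2 \<le> fth" "r \<le> S" and fth: "fth \<le> 1" "4 * real n * fth \<le> M * S\<^sup>2"
    and S: "0 \<le> S" and t: "t \<le> n"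
  shows "norm ((gd ^^ t) (u + z) - u) \<le> 2 * S"
proof -
  have uz: "u + z \<in> V" using V u z by (intro subspace_add)
  have "norm (g u) * norm (u + z - u) + M / 2 * (norm (u + z - u))\<^sup>2 \<le> \<epsilon> * r + M / 2 * r\<^sup>2"
    using u z M_pos order_trans[OF norm_ge_zero u(3)]
    by (intro add_mono mult_mono mult_left_mono power_mono) auto
  then have le: "norm (g u) * norm (u + z - u) + M / 2 * (norm (u + z - u))\<^sup>2 \<le> fth" using r by linarith
  then have "F (u + z) \<le> F u + norm (g u) * norm (u + z - u) + M / 2 * (norm (u + z - u))\<^sup>2"
    using fth by (intro nearby_value u uz) auto
  then have Fz: "F (u + z) \<le> F u + fth" using le by linarith
  then have Fz1: "F (u + z) \<le> f0 + 1" using u fth by linarith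
  have fth0: "0 \<le> fth"
    using le M_pos by (meson add_nonneg_nonneg divide_nonneg_nonneg less_imp_le mult_nonneg_nonneg norm_ge_zero
        order_trans zero_le_numeral zero_le_power2)
  have "F (u + z) - F ((gd ^^ t) (u + z)) \<le> 2 * fth"
    using gd_iter_antimono[OF uz Fz1 t] stuck Fz by linarith
  have "(norm ((gd ^^ t) (u + z) - (u + z)))\<^sup>2
      \<le> 2 * real t / M * (F (u + z) - F ((gd ^^ t) (u + z)))"
    by (rule gd_iter_localized[OF uz Fz1])
  also have "\<dots> \<le> 2 * real n / M * (2 * fth)"
    using \<open>_ \<le> 2 * fth\<close> t M_pos gd_iter_antimono[OF uz Fz1, of 0 t]
    by (intro mult_mono divide_right_mono) auto
  also have "\<dots> \<le> S\<^sup>2" using fth M_pos by (simp add: field_simps)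
  finally have "norm ((gd ^^ t) (u + z) - (u + z)) \<le> S" using S by (rule power2_le_imp_le)
  moreover have "norm ((gd ^^ t) (u + z) - u) \<le> norm ((gd ^^ t) (u + z) - (u + z)) + norm z"
    using norm_triangle_ineq[of "(gd ^^ t) (u + z) - (u + z)" z] by (simp add: algebra_simps)
  ultimately show ?thesis using z r by linarith
qed

text \<open>Two stuck runs end within \<open>2 * S\<close> of \<open>u\<close>, hence within
  \<open>4 * S\<close> of each other, and divergence bounds half the grown offset by this; hence the
  \<open>8 * S\<close>. The actual rate depends on \<open>u\<close>, so it is replaced by the
  smaller one with \<open>\<gamma>\<close>.\<close>

lemma stuck_set_thin:
  assumes u: "u \<in> V" "F u \<le> f0" "norm (g u) \<le> \<epsilon>"
    and saddle: "v \<in> V" "v \<bullet> H u v < - \<gamma> * (v \<bullet> v)" "0 \<le> \<gamma>"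
    and r: "\<epsilon> * r + M / 2 * r\<^sup>2 \<le> fth" "r \<le> S" and fth: "fth \<le> 1" "4 * real n * fth \<le> M * S\<^sup>2"
    and S: "0 \<le> S" "2 * S \<le> R" "6 * real n * \<rho> * S \<le> M"
    and w: "8 * S < (1 + \<gamma> / M) ^ n * w"
  obtains e where "e \<in> V" "norm e = 1"
    "\<And>z z' \<mu>. z \<in> V \<Longrightarrow> norm z \<le> r \<Longrightarrow> F u - fth < F ((gd ^^ n) (u + z)) \<Longrightarrow>
      z' \<in> V \<Longrightarrow> norm z' \<le> r \<Longrightarrow> F u - fth < F ((gd ^^ n) (u + z')) \<Longrightarrow>
      z' - z = \<mu> *\<^sub>R e \<Longrightarrow> \<bar>\<mu>\<bar> < w"
proof -
  obtain l e where le: "\<gamma> < l" "e \<in> V" "norm e = 1" "H u e = - l *\<^sub>R e"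
    "\<And>x. x \<in> V \<Longrightarrow> - l * (x \<bullet> x) \<le> x \<bullet> H u x"
    using negative_eigenvector[OF V cpt H_linear[OF u(1)] H_in[OF u(1)] H_sym[OF u(1)] saddle(1,2)]
    by blast
  show thesis
  proof (rule that[OF le(2,3)])
    fix z z' \<mu>
    assume z: "z \<in> V" "norm z \<le> r" "F u - fth < F ((gd ^^ n) (u + z))"
      and z': "z' \<in> V" "norm z' \<le> r" "F u - fth < F ((gd ^^ n) (u + z'))"
      and diff: "z' - z = \<mu> *\<^sub>R e"
    note near = stuck_localized[OF u z r fth S(1)] stuck_localized[OF u z' r fth S(1)]
    have pos: "0 < (1 + \<gamma> / M) ^ n" using saddle(3) M_pos by (simp add: add_pos_nonneg)
    have "\<bar>\<mu>\<bar> / 2 * (1 + l / M) ^ n \<le> norm ((gd ^^ n) (u + z') - (gd ^^ n) (u + z))"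
    proof (rule coupled_divergence[OF u(1,2), where D = "2 * S" and e = e])
      show "u + z' \<in> V" "u + z \<in> V" using V u z z' by (auto intro: subspace_add)
    qed (use near S le saddle diff in auto)
    also have "\<dots> \<le> 4 * S"
      using near[of n] norm_triangle_ineq4[of "(gd ^^ n) (u + z') - u" "(gd ^^ n) (u + z) - u"]
      by simp
    finally have "\<bar>\<mu>\<bar> * (1 + l / M) ^ n \<le> 8 * S" by simp
    moreover have "(1 + \<gamma> / M) ^ n \<le> (1 + l / M) ^ n"
      using le(1) saddle(3) M_pos by (intro power_mono add_left_mono divide_right_mono) auto
    then have "\<bar>\<mu>\<bar> * (1 + \<gamma> / M) ^ n \<le> \<bar>\<mu>\<bar> * (1 + l / M) ^ n" by (intro mult_left_mono) auto
    ultimately have "\<bar>\<mu>\<bar> * (1 + \<gamma> / M) ^ n < w * (1 + \<gamma> / M) ^ n" using w by (simp add: mult.commute)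
    then show "\<bar>\<mu>\<bar> < w" using pos by simp
  qed
qed

end

section \<open>Runs of perturbed gradient descent\<close>

locale pgd_process =
  fixes d :: nat and F :: "rvec \<Rightarrow> real" and \<eta> r gth fth :: real and n :: nat
  assumes grad_in: "\<And>w. w \<in> Rspace d \<Longrightarrow> grad d F w \<in> Rspace d"
    and continuous_F: "continuous_on (Rspace d) F"
    and continuous_grad: "continuous_on (Rspace d) (grad d F)"
    and r_pos: "0 < r"
begin

text \<open>\<open>step\<close> and \<open>pos\<close> continue the run past its return, and
  \<open>alive\<close> records whether it is still genuine. Measurability and independence can then
  be treated for vector-valued maps instead of options.\<close>

definition step :: "rvec \<Rightarrow> rvec \<Rightarrow> rvec" where
  "step z u = (if gth < norm (grad d F u) then gd_step d F \<eta> u else (gd_step d F \<eta> ^^ n) (u + z))"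

definition continues :: "rvec \<Rightarrow> rvec \<Rightarrow> bool" where
  "continues z u \<longleftrightarrow> gth < norm (grad d F u) \<or> F ((gd_step d F \<eta> ^^ n) (u + z)) - F u \<le> - fth"

primrec pos :: "rvec \<Rightarrow> (nat \<Rightarrow> rvec) \<Rightarrow> nat \<Rightarrow> rvec" where
  "pos w \<xi> 0 = w"
| "pos w \<xi> (Suc k) = step (\<xi> k) (pos w \<xi> k)"

definition alive :: "rvec \<Rightarrow> (nat \<Rightarrow> rvec) \<Rightarrow> nat \<Rightarrow> bool" where
  "alive w \<xi> k \<longleftrightarrow> (\<forall>j<k. continues (\<xi> j) (pos w \<xi> j))"

abbreviation noise :: "(nat \<Rightarrow> rvec) measure" where
  "noise \<equiv> pgd_noise d r"

lemma pgd_round_eq: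
  "pgd_round d F \<eta> gth fth n z u = (if continues z u then Some (step z u) else None)"
  by (auto simp: pgd_round_def continues_def step_def Let_def)

lemma pgd_candidate_eq:
  "pgd_candidate d F \<eta> gth fth n w \<xi> k = (if alive w \<xi> k then Some (pos w \<xi> k) else None)"
  by (induction k) (auto simp: alive_def pgd_round_eq less_Suc_eq)

lemma gd_step_in: "u \<in> Rspace d \<Longrightarrow> gd_step d F \<eta> u \<in> Rspace d"
  unfolding gd_step_def by (intro subspace_diff subspace_scale subspace_Rspace grad_in)

lemma gd_iter_in: "u \<in> Rspace d \<Longrightarrow> (gd_step d F \<eta> ^^ k) u \<in> Rspace d"
  by (induction k) (auto intro: gd_step_in)

lemma step_in: "z \<in> Rspace d \<Longrightarrow> u \<in> Rspace d \<Longrightarrow> step z u \<in> Rspace d"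
  by (auto simp: step_def intro!: gd_step_in gd_iter_in subspace_add subspace_Rspace)

lemma noise_in: "\<xi> \<in> space noise \<Longrightarrow> \<xi> k \<in> Rspace d"
  by (auto simp: pgd_noise_def space_PiM)

lemma pos_in: "w \<in> Rspace d \<Longrightarrow> (\<And>j. \<xi> j \<in> Rspace d) \<Longrightarrow> pos w \<xi> k \<in> Rspace d"
  by (induction k) (auto intro: step_in)

text \<open>Causality of the run: the start of round \<open>k\<close> depends on earlier
  perturbations only, so it is independent of \<open>\<xi> k\<close>.\<close>

lemma pos_cong: "(\<And>j. j < k \<Longrightarrow> \<xi> j = \<xi>' j) \<Longrightarrow> pos w \<xi> k = pos w \<xi>' k"
  by (induction k) auto

lemma alive_cong:
  assumes "\<And>j. j < k \<Longrightarrow> \<xi> j = \<xi>' j"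
  shows "alive w \<xi> k = alive w \<xi>' k"
proof -
  have "pos w \<xi> j = pos w \<xi>' j" if "j < k" for j using that assms by (intro pos_cong) auto
  then show ?thesis using assms by (simp add: alive_def)
qed

section \<open>Measurability of the run\<close>

lemma measurable_Rspace_add [measurable (raw)]:
  assumes "f \<in> M \<rightarrow>\<^sub>M borel_Rspace d" "g \<in> M \<rightarrow>\<^sub>M borel_Rspace d"
  shows "(\<lambda>x. f x + g x) \<in> M \<rightarrow>\<^sub>M borel_Rspace d"
proof (rule measurable_restrict_space2)
  show "(\<lambda>x. f x + g x) \<in> space M \<rightarrow> Rspace d"
    using measurable_space[OF assms(1)] measurable_space[OF assms(2)]
    by (auto intro!: subspace_add subspace_Rspace)
  have "f \<in> borel_measurable M" "g \<in> borel_measurable M"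
    using assms by (simp_all add: measurable_restrict_space2_iff)
  then show "(\<lambda>x. f x + g x) \<in> borel_measurable M" by (rule borel_measurable_add)
qed

lemma measurable_F [measurable]: "F \<in> borel_Rspace d \<rightarrow>\<^sub>M borel"
  by (rule borel_measurable_continuous_on_restrict[OF continuous_F])

lemma measurable_norm_grad [measurable]: "(\<lambda>u. norm (grad d F u)) \<in> borel_Rspace d \<rightarrow>\<^sub>M borel"
  by (intro borel_measurable_continuous_on_restrict continuous_intros continuous_grad)

lemma measurable_gd_step [measurable]: "gd_step d F \<eta> \<in> borel_Rspace d \<rightarrow>\<^sub>M borel_Rspace d"
proof (rule measurable_restrict_space2)
  show "gd_step d F \<eta> \<in> space (borel_Rspace d) \<rightarrow> Rspace d"
    using gd_step_in by auto
  show "gd_step d F \<eta> \<in> borel_measurable (borel_Rspace d)"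
    unfolding gd_step_def
    by (intro borel_measurable_continuous_on_restrict continuous_intros continuous_grad)
qed

lemma measurable_gd_iter [measurable]: "gd_step d F \<eta> ^^ k \<in> borel_Rspace d \<rightarrow>\<^sub>M borel_Rspace d"
proof (induction k)
  case (Suc k)
  note [measurable] = Suc
  show ?case unfolding funpow.simps comp_def by measurable
qed (simp add: id_def)

lemma measurable_step [measurable (raw)]:
  assumes [measurable]: "f \<in> M \<rightarrow>\<^sub>M borel_Rspace d" "g \<in> M \<rightarrow>\<^sub>M borel_Rspace d"
  shows "(\<lambda>x. step (f x) (g x)) \<in> M \<rightarrow>\<^sub>M borel_Rspace d"
  unfolding step_def by measurable

lemma measurable_continues [measurable (raw)]:
  assumes [measurable]: "f \<in> M \<rightarrow>\<^sub>M borel_Rspace d" "g \<in> M \<rightarrow>\<^sub>M borel_Rspace d"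
  shows "Measurable.pred M (\<lambda>x. continues (f x) (g x))"
  unfolding continues_def by measurable

lemma measurable_noise_component [measurable]: "(\<lambda>\<xi>. \<xi> k) \<in> noise \<rightarrow>\<^sub>M borel_Rspace d"
proof -
  have "(\<lambda>\<xi>. \<xi> k) \<in> noise \<rightarrow>\<^sub>M uniform_ball d r"
    unfolding pgd_noise_def by (rule measurable_component_singleton) simp
  then show ?thesis by (simp cong: measurable_cong_sets)
qed

lemma measurable_pos:
  assumes w: "w \<in> Rspace d"
  shows "(\<lambda>\<xi>. pos w \<xi> k) \<in> noise \<rightarrow>\<^sub>M borel_Rspace d"
proof (induction k)
  case (Suc k)
  note [measurable] = Suc
  show ?case unfolding pos.simps by measurable
qed (use w in simp)

lemma measurable_alive:
  assumes w: "w \<in> Rspace d"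
  shows "Measurable.pred noise (\<lambda>\<xi>. alive w \<xi> k)"
proof -
  note [measurable] = measurable_pos[OF w]
  show ?thesis unfolding alive_def by measurable
qed

lemma pgd_calls_eq:
  "pgd_calls d F \<eta> gth fth n w \<xi> k =
    (\<Sum>j<k. if alive w \<xi> j then (if gth < norm (grad d F (pos w \<xi> j)) then 1 else 1 + n) else 0)"
  unfolding pgd_calls_def by (intro sum.cong) (auto simp: pgd_candidate_eq round_calls_def)

lemma measurable_pgd_calls:
  assumes w: "w \<in> Rspace d"
  shows "(\<lambda>\<xi>. pgd_calls d F \<eta> gth fth n w \<xi> k) \<in> noise \<rightarrow>\<^sub>M count_space UNIV"
proof -
  note [measurable] = measurable_pos[OF w] measurable_alive[OF w]
  show ?thesis unfolding pgd_calls_eq by measurable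
qed

lemma prob_space_noise: "prob_space noise"
  unfolding pgd_noise_def by (intro prob_space_PiM prob_space_uniform_ball r_pos)

text \<open>Round \<open>k\<close> starts from a point determined by the perturbations before \<open>k\<close>; splitting the noise
  at \<open>k\<close> makes this point independent of the perturbation \<open>\<xi> k\<close>.\<close>

lemma round_failure_probability:
  assumes w: "w \<in> Rspace d" and Q: "Measurable.pred (borel_Rspace d) Q" and p: "0 \<le> p"
    and bound: "\<And>\<xi>. \<xi> \<in> space noise \<Longrightarrow> alive w \<xi> k \<Longrightarrow> \<not> Q (pos w \<xi> k) \<Longrightarrow>
      measure (uniform_ball d r) {z \<in> Rspace d. \<not> continues z (pos w \<xi> k)} \<le> p"
  defines "fail \<equiv> {\<xi> \<in> space noise. alive w \<xi> k \<and> \<not> Q (pos w \<xi> k) \<and> \<not> continues (\<xi> k) (pos w \<xi> k)}"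
  shows "fail \<in> sets noise" "measure noise fail \<le> p"
proof -
  note [measurable] = measurable_pos[OF w] measurable_alive[OF w] Q
  show fail: "fail \<in> sets noise" unfolding fail_def by measurable
  interpret U: prob_space "uniform_ball d r" by (rule prob_space_uniform_ball[OF r_pos])
  interpret S: sequence_space "uniform_ball d r" ..
  have noise_eq: "noise = S.S" by (simp add: pgd_noise_def)
  interpret N: prob_space noise by (rule prob_space_noise)
  \<comment> \<open>The first \<open>k\<close> perturbations are frozen in \<open>\<xi>\<close>, and
    entry \<open>0\<close> of a fresh sequence plays the part of perturbation \<open>k\<close>.
    Gluing two independent sequences at \<open>k\<close> reproduces the noise, so the probability is
    an average of the measures of these sections.\<close>
  define G where "G \<xi> = {\<xi>' \<in> space noise. alive w \<xi> k \<and> \<not> Q (pos w \<xi> k) \<and> \<not> continues (\<xi>' 0) (pos w \<xi> k)}" for \<xi>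
  have comb: "(\<lambda>(\<xi>, \<xi>'). comb_seq k \<xi> \<xi>') \<in> noise \<Otimes>\<^sub>M noise \<rightarrow>\<^sub>M noise"
    unfolding noise_eq by (rule measurable_comb_seq)
  have "emeasure noise fail = emeasure (distr (noise \<Otimes>\<^sub>M noise) noise (\<lambda>(\<xi>, \<xi>'). comb_seq k \<xi> \<xi>')) fail"
    unfolding noise_eq by (subst S.PiM_comb_seq) simp
  also have "\<dots> = emeasure (noise \<Otimes>\<^sub>M noise)
      ((\<lambda>(\<xi>, \<xi>'). comb_seq k \<xi> \<xi>') -` fail \<inter> space (noise \<Otimes>\<^sub>M noise))"
    by (rule emeasure_distr[OF comb fail])
  also have "\<dots> = (\<integral>\<^sup>+\<xi>. emeasure noise (Pair \<xi> -`
      ((\<lambda>(\<xi>, \<xi>'). comb_seq k \<xi> \<xi>') -` fail \<inter> space (noise \<Otimes>\<^sub>M noise))) \<partial>noise)"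
    by (rule N.emeasure_pair_measure_alt[OF measurable_sets[OF comb fail]])
  also have "\<dots> \<le> (\<integral>\<^sup>+\<xi>. ennreal p \<partial>noise)"
  proof (rule nn_integral_mono)
    fix \<xi> assume \<xi>: "\<xi> \<in> space noise"
    have "comb_seq k \<xi> \<xi>' \<in> fail \<longleftrightarrow> \<xi>' \<in> G \<xi>" if \<xi>': "\<xi>' \<in> space noise" for \<xi>'
    proof -
      have "comb_seq k \<xi> \<xi>' \<in> space noise" using measurable_space[OF comb, of "(\<xi>, \<xi>')"] \<xi> \<xi>'
        by (simp add: space_pair_measure)
      moreover have "comb_seq k \<xi> \<xi>' k = \<xi>' 0" using comb_seq_add[of k \<xi> \<xi>' 0] by simp
      moreover have "pos w (comb_seq k \<xi> \<xi>') k = pos w \<xi> k" "alive w (comb_seq k \<xi> \<xi>') k = alive w \<xi> k"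
        by (auto intro!: pos_cong alive_cong simp: comb_seq_less)
      ultimately show ?thesis using \<xi>' by (simp add: fail_def G_def)
    qed
    then have "Pair \<xi> -` ((\<lambda>(\<xi>, \<xi>'). comb_seq k \<xi> \<xi>') -` fail \<inter> space (noise \<Otimes>\<^sub>M noise)) = G \<xi>"
      using \<xi> by (auto simp: space_pair_measure G_def)
    moreover have "emeasure noise (G \<xi>) \<le> ennreal p"
    proof (cases "alive w \<xi> k \<and> \<not> Q (pos w \<xi> k)")
      case True
      define u where "u = pos w \<xi> k"
      have u: "u \<in> Rspace d" unfolding u_def by (rule pos_in[OF w noise_in[OF \<xi>]])
      define X where "X = {z \<in> Rspace d. \<not> continues z u}"
      have [measurable]: "Measurable.pred (borel_Rspace d) (\<lambda>z. continues z u)"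
        by (rule measurable_continues) (use u in auto)
      have "{z \<in> space (borel_Rspace d). \<not> continues z u} \<in> sets (borel_Rspace d)"
        by measurable
      then have X: "X \<in> sets (uniform_ball d r)" by (simp add: X_def)
      have "G \<xi> = (\<lambda>\<xi>'. \<xi>' 0) -` X \<inter> space S.S"
        using True noise_in by (auto simp: G_def X_def u_def noise_eq[symmetric])
      then have "emeasure noise (G \<xi>) = emeasure (distr S.S (uniform_ball d r) (\<lambda>\<xi>'. \<xi>' 0)) X"
        unfolding noise_eq using X by (subst emeasure_distr) auto
      also have "\<dots> = emeasure (uniform_ball d r) X" by (subst S.PiM_component) auto
      also have "\<dots> \<le> ennreal p"
        using bound[OF \<xi>] True by (simp add: X_def u_def U.emeasure_eq_measure ennreal_leI)
      finally show ?thesis .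
    qed (auto simp: G_def)
    ultimately show "emeasure noise (Pair \<xi> -`
      ((\<lambda>(\<xi>, \<xi>'). comb_seq k \<xi> \<xi>') -` fail \<inter> space (noise \<Otimes>\<^sub>M noise))) \<le> ennreal p" by simp
  qed
  also have "\<dots> = ennreal p" by (simp add: N.emeasure_space_1)
  finally show "measure noise fail \<le> p" using p by (simp add: N.emeasure_eq_measure)
qed

text \<open>Every oracle call of a run without failed rounds pays for a decrease \<open>c\<close> of \<open>F\<close>, so the
  nonnegativity of \<open>F\<close> bounds the number of calls before a point satisfying \<open>Q\<close> is reached.\<close>

lemma output_if_no_failure:
  assumes w: "w \<in> Rspace d" "F w \<le> f0" and \<xi>: "\<And>j. \<xi> j \<in> Rspace d"
    and nonneg: "\<And>u. u \<in> Rspace d \<Longrightarrow> 0 \<le> F u" and c: "0 < c"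
    and descent: "\<And>u. u \<in> Rspace d \<Longrightarrow> F u \<le> f0 \<Longrightarrow> gth < norm (grad d F u) \<Longrightarrow> F (gd_step d F \<eta> u) \<le> F u - c"
    and fth: "c * (1 + real n) \<le> fth" and T: "f0 / c + 1 + real n < real T"
    and ok: "\<And>k. k < T \<Longrightarrow> alive w \<xi> k \<Longrightarrow> \<not> Q (pos w \<xi> k) \<Longrightarrow> F (pos w \<xi> k) \<le> f0 \<Longrightarrow> continues (\<xi> k) (pos w \<xi> k)"
  shows "\<exists>k<T. alive w \<xi> k \<and> Q (pos w \<xi> k) \<and> pgd_calls d F \<eta> gth fth n w \<xi> (Suc k) \<le> T"
proof (rule ccontr)
  let ?N = "pgd_calls d F \<eta> gth fth n w \<xi>"
  assume none: "\<not> ?thesis"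
  have posV: "pos w \<xi> k \<in> Rspace d" for k using w \<xi> by (intro pos_in)
  \<comment> \<open>The part \<open>k \<le> ?N k\<close> holds as every round costs at least one
    call; at \<open>k = T\<close> the invariant yields \<open>c * T \<le> f0\<close>, against the
    choice of \<open>T\<close>.\<close>
  have "alive w \<xi> k \<and> F (pos w \<xi> k) + c * real (?N k) \<le> f0 \<and> k \<le> ?N k" if "k \<le> T" for k
    using that
  proof (induction k)
    case 0
    then show ?case using w by (simp add: alive_def pgd_calls_eq)
  next
    case (Suc k)
    define u where "u = pos w \<xi> k"
    define m where "m = (if gth < norm (grad d F u) then 1 else 1 + n)"
    have IH: "alive w \<xi> k" "F u + c * real (?N k) \<le> f0" "k \<le> ?N k" using Suc by (auto simp: u_def)
    have u: "u \<in> Rspace d" unfolding u_def by (rule posV)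
    have Fu: "F u \<le> f0"
      using IH(2) mult_nonneg_nonneg[of c "real (?N k)"] c by linarith
    have calls: "?N (Suc k) = ?N k + m" using IH by (simp add: pgd_calls_eq m_def u_def)
    have "c * real (?N k) \<le> f0" using IH(2) nonneg[OF u] by linarith
    then have "real (?N k) \<le> f0 / c" using c by (simp add: field_simps)
    \<comment> \<open>Earlier rounds use at most \<open>f0 / c\<close> calls and one more round at
      most \<open>1 + n\<close>, which explains the lower bound on \<open>T\<close>: if
      \<open>Q u\<close> held, the point would count as output in time.\<close>
    then have "?N (Suc k) \<le> T" using T calls by (auto simp: m_def)
    then have "\<not> Q u" using none Suc IH by (auto simp: u_def)
    then have cont: "continues (\<xi> k) u" using ok Suc IH Fu by (simp add: u_def)
    have "F (step (\<xi> k) u) \<le> F u - c * real m"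
    proof (cases "gth < norm (grad d F u)")
      case True
      then show ?thesis using descent[OF u Fu] by (simp add: step_def m_def)
    next
      case False
      then show ?thesis using cont fth by (simp add: step_def m_def continues_def)
    qed
    moreover have "alive w \<xi> (Suc k)" using IH cont by (auto simp: alive_def less_Suc_eq u_def)
    moreover have "1 \<le> m" by (simp add: m_def)
    ultimately show ?case using IH calls by (simp add: u_def algebra_simps)
  qed
  from this[of T] have "F (pos w \<xi> T) + c * real (?N T) \<le> f0" "T \<le> ?N T" by auto
  then have "c * real T \<le> f0" using nonneg[OF posV, of T] c
    mult_left_mono[of "real T" "real (?N T)" c] by linarith
  then have "real T \<le> f0 / c" using c by (simp add: field_simps)
  then show False using T by linarith
qed

text \<open>A union bound over the failure events of the first \<open>T\<close> rounds; outside them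
  the energy argument is deterministic.\<close>

lemma pgd_success_probability:
  assumes w: "w \<in> Rspace d" "F w \<le> f0"
    and nonneg: "\<And>u. u \<in> Rspace d \<Longrightarrow> 0 \<le> F u" and c: "0 < c"
    and descent: "\<And>u. u \<in> Rspace d \<Longrightarrow> F u \<le> f0 \<Longrightarrow> gth < norm (grad d F u) \<Longrightarrow> F (gd_step d F \<eta> u) \<le> F u - c"
    and fth: "c * (1 + real n) \<le> fth" and T: "f0 / c + 1 + real n < real T"
    and Q: "Measurable.pred (borel_Rspace d) Q" and p: "0 \<le> p" "real T * p \<le> \<delta>"
    and escape: "\<And>u. u \<in> Rspace d \<Longrightarrow> F u \<le> f0 \<Longrightarrow> norm (grad d F u) \<le> gth \<Longrightarrow> \<not> Q u \<Longrightarrow>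
      measure (uniform_ball d r) {z \<in> Rspace d. - fth < F ((gd_step d F \<eta> ^^ n) (u + z)) - F u} \<le> p"
  shows "measure noise {\<xi> \<in> space noise. \<exists>v. pgd_outputs_within d F \<eta> gth fth n w \<xi> T v \<and> Q v} \<ge> 1 - \<delta>"
proof -
  interpret N: prob_space noise by (rule prob_space_noise)
  note [measurable] = measurable_pos[OF w(1)] measurable_alive[OF w(1)] measurable_pgd_calls[OF w(1)] Q
  define ok where "ok = {\<xi> \<in> space noise. \<exists>v. pgd_outputs_within d F \<eta> gth fth n w \<xi> T v \<and> Q v}"
  have "ok = {\<xi> \<in> space noise. \<exists>k<T. alive w \<xi> k \<and> Q (pos w \<xi> k) \<and>
      pgd_calls d F \<eta> gth fth n w \<xi> (Suc k) \<le> T}"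
    by (auto simp: ok_def pgd_outputs_within_def pgd_candidate_eq split: if_splits)
  then have ok: "ok \<in> sets noise" "\<And>\<xi>. \<xi> \<in> space noise \<Longrightarrow> \<xi> \<in> ok \<longleftrightarrow>
      (\<exists>k<T. alive w \<xi> k \<and> Q (pos w \<xi> k) \<and> pgd_calls d F \<eta> gth fth n w \<xi> (Suc k) \<le> T)"
    by auto
  \<comment> \<open>Escape is known only up to level \<open>f0\<close>. Declaring higher points good
    makes the failure bound hold at every point, and the energy argument inspects only points of
    level at most \<open>f0\<close>.\<close>
  define Q' where "Q' u \<longleftrightarrow> Q u \<or> f0 < F u" for u
  have Q': "Measurable.pred (borel_Rspace d) Q'" unfolding Q'_def by measurable
  define fail where "fail k = {\<xi> \<in> space noise. alive w \<xi> k \<and> \<not> Q' (pos w \<xi> k) \<and>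
      \<not> continues (\<xi> k) (pos w \<xi> k)}" for k
  have stuck: "measure (uniform_ball d r) {z \<in> Rspace d. \<not> continues z (pos w \<xi> k)} \<le> p"
    if "\<xi> \<in> space noise" "\<not> Q' (pos w \<xi> k)" for \<xi> k
  proof (cases "gth < norm (grad d F (pos w \<xi> k))")
    case True
    then show ?thesis using p by (simp add: continues_def)
  next
    case False
    have "pos w \<xi> k \<in> Rspace d" by (rule pos_in[OF w(1) noise_in[OF that(1)]])
    from escape[OF this] False show ?thesis
      using that(2)
      by (simp add: continues_def Q'_def not_le)
  qed
  have fail: "fail k \<in> sets noise" "measure noise (fail k) \<le> p" for k
    unfolding fail_def using round_failure_probability[OF w(1) Q' p(1), of k] stuck by auto
  have "space noise - (\<Union>k<T. fail k) \<subseteq> ok"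
  proof
    fix \<xi> assume \<xi>: "\<xi> \<in> space noise - (\<Union>k<T. fail k)"
    have "\<exists>k<T. alive w \<xi> k \<and> Q (pos w \<xi> k) \<and> pgd_calls d F \<eta> gth fth n w \<xi> (Suc k) \<le> T"
      by (rule output_if_no_failure[OF w _ nonneg c descent fth T])
         (use \<xi> noise_in in \<open>auto simp: fail_def Q'_def\<close>)
    then show "\<xi> \<in> ok" using ok \<xi> by auto
  qed
  then have "measure noise (space noise - (\<Union>k<T. fail k)) \<le> measure noise ok"
    using ok by (intro N.finite_measure_mono)
  moreover have "measure noise (space noise - (\<Union>k<T. fail k)) = 1 - measure noise (\<Union>k<T. fail k)"
    using fail by (intro N.prob_compl) auto
  moreover have "measure noise (\<Union>k<T. fail k) \<le> (\<Sum>k<T. measure noise (fail k))"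
    using fail by (intro N.finite_measure_subadditive_finite) auto
  moreover have "\<dots> \<le> (\<Sum>k<T. p)" using fail by (intro sum_mono)
  ultimately show ?thesis using p by (simp add: ok_def)
qed

end

section \<open>Choice of parameters\<close>

text \<open>\<open>exp (x / 4)\<close> is the seventh power of \<open>exp (x / 28)\<close>, hence at
  least \<open>(x / 28) ^ 7\<close>, one power more than required. The floor \<open>12\<close> later
  gives \<open>3 * ln X \<le> \<iota> / 4\<close>.\<close>

lemma exp_dominates_power6:
  assumes "0 < Q"
  obtains A :: real where "12 \<le> A" "\<And>x. A \<le> x \<Longrightarrow> Q * x ^ 6 < exp (x / 4)"
proof
  let ?A = "max 12 (Q * 28 ^ 7 + 1)"
  show "12 \<le> ?A" by simp
  fix x assume x: "?A \<le> x"
  then have pos: "0 < x" by simp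
  have "Q * 28 ^ 7 * x ^ 6 < x * x ^ 6" using x pos by (intro mult_strict_right_mono) auto
  then have "Q * x ^ 6 < (x / 28) ^ 7" by (simp add: power_divide field_simps eval_nat_numeral)
  also have "\<dots> \<le> exp (x / 28) ^ 7"
  proof (rule power_mono)
    show "x / 28 \<le> exp (x / 28)" using exp_ge_add_one_self[of "x / 28"] by linarith
  qed (use pos in simp)
  also have "\<dots> = exp (x / 4)" by (simp flip: exp_of_nat_mult)
  finally show "Q * x ^ 6 < exp (x / 4)" .
qed

text \<open>On the unit interval \<open>1 + x\<close> dominates \<open>exp (x / 2)\<close>; the
  halved exponent is the price.\<close>

lemma exp_le_one_plus_power:
  fixes x :: real
  assumes "0 \<le> x" "x \<le> 1" "y \<le> real n * x"
  shows "exp (y / 2) \<le> (1 + x) ^ n"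
proof -
  have "x * x \<le> x * 1" using assms by (intro mult_left_mono) auto
  then have "exp (x / 2) \<le> 1 + x"
    using exp_bound[of "x / 2"] assms by (simp add: power2_eq_square)
  then have "exp (x / 2) ^ n \<le> (1 + x) ^ n" by (intro power_mono) auto
  moreover have "exp (y / 2) \<le> exp (x / 2) ^ n" using assms by (simp flip: exp_of_nat_mult)
  ultimately show ?thesis by linarith
qed

text \<open>\<open>s\<close> is \<open>sqrt \<epsilon>\<close>, \<open>\<iota>\<close> is a large multiple of the logarithmic factor, \<open>S\<close> is the radius in which
  stuck iterates remain, \<open>c\<close> is the decrease of \<open>F\<close> per oracle call, and \<open>w\<close> is the width of the
  stuck region, of which \<open>N\<close> copies are packed.\<close>

lemma pgd_parameters_aux:
  fixes f0 M \<rho> R A B s \<delta> \<iota> :: real and d :: nat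
  assumes f0: "0 \<le> f0" and M: "1 \<le> M" and \<rho>: "1 \<le> \<rho>" and R: "R * M \<le> 1" "M \<le> 6 * R * \<rho>"
    and s: "0 < s" "s < M" and d: "1 \<le> d" and \<delta>: "0 < \<delta>" "\<delta> < 1" and \<iota>: "1 \<le> \<iota>"
    and B: "B = 4608 * f0 * \<rho>\<^sup>2 * M + 5 * M ^ 4"
    and width: "6144 * M\<^sup>2 * \<rho> * B * \<iota> ^ 6 * (real d / (\<delta> * s ^ 6)) < exp (\<iota> / 2)"
  obtains r fth S w c :: real and n T N :: nat where
    "0 < r" "0 < fth" "0 < n" "s\<^sup>2 * r + M / 2 * r\<^sup>2 \<le> fth" "r \<le> S" "fth \<le> 1"
    "4 * real n * fth \<le> M * S\<^sup>2" "0 \<le> S" "2 * S \<le> R" "6 * real n * \<rho> * S \<le> M"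
    "8 * S < (1 + s / M) ^ n * w" "0 \<le> w" "real d * real N * w \<le> r" "0 < N"
    "0 < c" "c \<le> s ^ 4 / (2 * M)" "c * (1 + real n) \<le> fth" "f0 / c + 1 + real n < real T"
    "real T * (3 / real N) \<le> \<delta>" "real T \<le> B * \<iota> ^ 4 / s ^ 4"
proof -
  \<comment> \<open>With this many steps \<open>(1 + s / M) ^ n\<close> reaches
    \<open>exp (\<iota> / 2)\<close>.\<close>
  define a where "a = \<iota> * M / s"
  define n where "n = nat \<lceil>a\<rceil>"
  have "s * 1 \<le> M * \<iota>" using s \<iota> M by (intro mult_mono) auto
  then have a: "1 \<le> a" using s by (simp add: a_def field_simps)
  have n: "a \<le> real n" "real n \<le> 2 * a" using a unfolding n_def by linarith+
  have n1: "1 \<le> real n" using a n by linarith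
  \<comment> \<open>Solves \<open>6 * n * \<rho> * S = M\<close> for the largest admissible
    \<open>n = 2 * a\<close>.\<close>
  define S where "S = s / (12 * \<rho> * \<iota>)"
  have S: "0 < S" using s \<rho> \<iota> by (simp add: S_def)
  \<comment> \<open>Equality in \<open>4 * n * fth \<le> M * S\<^sup>2\<close>; next,
    \<open>r\<close> is the radius at which \<open>(s\<^sup>2 + M) * r\<close> equals
    \<open>fth\<close>.\<close>
  define fth where "fth = S\<^sup>2 * M / (4 * real n)"
  have fth: "0 < fth" using S M n1 by (simp add: fth_def)
  define r where "r = fth / (s\<^sup>2 + M)"
  have sM: "1 \<le> s\<^sup>2 + M" using M by (simp add: add_increasing)
  have r: "0 < r" using fth sM by (simp add: r_def)
  \<comment> \<open>This is \<open>S\<^sup>2 * M / (8 * (2 * a)\<^sup>2)\<close>, and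
    \<open>4608 = 8 * 4 * 144\<close>.\<close>
  define c where "c = s ^ 4 / (4608 * \<rho>\<^sup>2 * M * \<iota> ^ 4)"
  have c: "0 < c" using s \<rho> M \<iota> by (simp add: c_def)
  define T where "T = nat \<lceil>f0 / c\<rceil> + 2 + n"
  have f0c: "0 \<le> f0 / c" using f0 c by simp
  have T: "f0 / c + 2 + real n \<le> real T" "real T \<le> f0 / c + 3 + real n"
    unfolding T_def using f0c by linarith+
  \<comment> \<open>Sharing \<open>\<delta>\<close> among \<open>T\<close> rounds, each failing with
    probability at most \<open>3 / N\<close>.\<close>
  define N where "N = nat \<lceil>3 * real T / \<delta>\<rceil>"
  have T\<delta>: "1 \<le> real T / \<delta>" using T f0c \<delta> by (simp add: field_simps)
  have N: "3 * real T / \<delta> \<le> real N" "real N \<le> 4 * (real T / \<delta>)"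
    using T\<delta> unfolding N_def by linarith+
  have N1: "1 \<le> real N" using N T\<delta> by linarith
  define w where "w = r / (real d * real N)"
  have S2R: "2 * S \<le> R"
  proof -
    have "s * 1 \<le> M * \<iota>" using s \<iota> M by (intro mult_mono) auto
    also have "\<dots> \<le> (6 * R * \<rho>) * \<iota>" using R \<iota> by (intro mult_right_mono) auto
    finally show ?thesis using \<rho> \<iota> by (simp add: S_def field_simps)
  qed
  have SM: "S * M \<le> 1 / 2"
    using mult_right_mono[OF S2R, of M] M R by linarith
  have S1: "S \<le> 1" using mult_left_mono[OF M, of S] S SM by linarith
  have fthS: "fth \<le> S"
  proof -
    have "S * (S * M) \<le> S * (1 / 2)" using SM S by (intro mult_left_mono) auto
    also have "\<dots> \<le> S * (4 * real n)" using S n1 by (intro mult_left_mono) auto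
    finally show ?thesis using n1 by (simp add: fth_def field_simps power2_eq_square)
  qed
  have r_le: "r \<le> fth" using mult_left_mono[OF sM, of fth] fth sM by (simp add: r_def divide_le_eq)
  have s2: "s\<^sup>2 \<le> M\<^sup>2" using s by (intro power_mono) auto
  have s4: "1 \<le> M ^ 4 / s ^ 4" using s by (simp add: power_mono)
  show thesis
  proof (rule that[of r fth n S w N c T])
    show "0 < n" using n1 by (cases n) auto
    have "M / 2 * r\<^sup>2 \<le> M * r"
      using mult_left_mono[of r 1 "M * r"] r_le fthS S1 r M by (simp add: power2_eq_square)
    then have "s\<^sup>2 * r + M / 2 * r\<^sup>2 \<le> (s\<^sup>2 + M) * r" by (simp add: algebra_simps)
    also have "\<dots> = fth" using sM by (simp add: r_def)
    finally show "s\<^sup>2 * r + M / 2 * r\<^sup>2 \<le> fth" .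
    show "4 * real n * fth \<le> M * S\<^sup>2" using n1 by (simp add: fth_def)
    have "6 * real n * \<rho> * S = real n * s / (2 * \<iota>)" using \<rho> \<iota> by (simp add: S_def field_simps)
    also have "\<dots> \<le> 2 * a * s / (2 * \<iota>)" using n s \<iota> by (intro divide_right_mono mult_right_mono) auto
    also have "\<dots> = M" using s \<iota> by (simp add: a_def)
    finally show "6 * real n * \<rho> * S \<le> M" .
    show "real d * real N * w \<le> r" using d N1 by (simp add: w_def)
    show "0 < N" using N1 by (cases N) auto
    have "1 * 1 \<le> \<rho>\<^sup>2 * \<iota> ^ 4" using \<rho> \<iota> by (intro mult_mono one_le_power) auto
    then have "(2 * M) * 1 \<le> (4608 * M) * (\<rho>\<^sup>2 * \<iota> ^ 4)" using M by (intro mult_mono) auto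
    then have "2 * M \<le> 4608 * \<rho>\<^sup>2 * M * \<iota> ^ 4" by (simp add: mult_ac)
    then show "c \<le> s ^ 4 / (2 * M)" unfolding c_def using M s by (intro divide_left_mono) auto
    have c_S: "8 * (2 * a)\<^sup>2 * c = S\<^sup>2 * M"
      using s \<rho> \<iota> M by (simp add: c_def S_def a_def field_simps power2_eq_square eval_nat_numeral)
    have "(real n)\<^sup>2 \<le> (2 * a)\<^sup>2" using n by (intro power_mono) auto
    then have "8 * (real n)\<^sup>2 * c \<le> 8 * (2 * a)\<^sup>2 * c"
      using c by (intro mult_right_mono mult_left_mono) auto
    also note c_S
    finally have "8 * (real n)\<^sup>2 * c \<le> S\<^sup>2 * M" .
    then have "c * (2 * real n) \<le> fth"
      using n1 by (simp add: fth_def field_simps power2_eq_square)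
    moreover have "c * (1 + real n) \<le> c * (2 * real n)" using c n1 by (intro mult_left_mono) auto
    ultimately show "c * (1 + real n) \<le> fth" by linarith
    show "f0 / c + 1 + real n < real T" using T by linarith
    show "real T * (3 / real N) \<le> \<delta>" using N \<delta> N1 by (simp add: field_simps)
    have \<iota>4: "\<iota> \<le> \<iota> ^ 4" "1 \<le> \<iota> ^ 4" using \<iota> by (auto intro: self_le_power one_le_power)
    \<comment> \<open>The two terms of \<open>B\<close> are the share of \<open>f0 / c\<close> and
      \<open>5 * M ^ 4\<close>, of which \<open>3\<close> absorbs the additive constant and
      \<open>2\<close> absorbs \<open>n\<close>.\<close>
    have T_bound: "real T \<le> B * \<iota> ^ 4 / s ^ 4"
    proof -
      have "f0 / c = 4608 * f0 * \<rho>\<^sup>2 * M * \<iota> ^ 4 / s ^ 4" by (simp add: c_def)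
      moreover have "3 \<le> 3 * M ^ 4 * \<iota> ^ 4 / s ^ 4"
        using mult_mono[OF s4 \<iota>4(2)] by simp
      moreover have "real n \<le> 2 * M ^ 4 * \<iota> ^ 4 / s ^ 4"
      proof -
        have "a = \<iota> * (M * s ^ 3) / s ^ 4" using s by (simp add: a_def eval_nat_numeral)
        also have "\<dots> \<le> \<iota> ^ 4 * (M * M ^ 3) / s ^ 4"
          using s \<iota>4 \<iota> M by (intro divide_right_mono mult_mono mult_left_mono power_mono) auto
        also have "\<iota> ^ 4 * (M * M ^ 3) / s ^ 4 = M ^ 4 * \<iota> ^ 4 / s ^ 4" by (simp add: eval_nat_numeral)
        finally have "2 * a \<le> 2 * (M ^ 4 * \<iota> ^ 4 / s ^ 4)" by linarith
        then show ?thesis using n by simp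
      qed
      ultimately have "real T \<le> 4608 * f0 * \<rho>\<^sup>2 * M * \<iota> ^ 4 / s ^ 4 + 3 * M ^ 4 * \<iota> ^ 4 / s ^ 4
          + 2 * M ^ 4 * \<iota> ^ 4 / s ^ 4"
        using T by linarith
      also have "\<dots> = B * \<iota> ^ 4 / s ^ 4"
        by (simp add: B add_divide_distrib[symmetric] algebra_simps)
      finally show ?thesis .
    qed
    then show "real T \<le> B * \<iota> ^ 4 / s ^ 4" .
    have B0: "0 \<le> B" unfolding B using f0 M \<rho> by auto
    have w_pos: "0 < w" using r d N1 by (simp add: w_def)
    \<comment> \<open>This ratio is only polynomial in \<open>\<iota>\<close>: \<open>N\<close>
      contributes \<open>\<iota> ^ 4 / s ^ 4\<close>, while \<open>n\<close> and
      \<open>1 / S\<close> contribute one factor \<open>\<iota> / s\<close> each. The constant is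
      \<open>6144 = 32 * 4 * 2 * 2 * 12\<close>.\<close>
    have "8 * S / w = 32 * real d * real N * ((s\<^sup>2 + M) * (real n / (S * M)))"
      using S r M n1 sM d N1 by (simp add: w_def r_def fth_def field_simps power2_eq_square)
    also have "\<dots> \<le> 32 * real d * (4 * (B * \<iota> ^ 4 / s ^ 4 / \<delta>)) * (2 * M\<^sup>2 * (2 * a / (S * M)))"
    proof (intro mult_mono mult_left_mono divide_right_mono)
      show "real N \<le> 4 * (B * \<iota> ^ 4 / s ^ 4 / \<delta>)"
        using N T_bound \<delta> divide_right_mono[OF T_bound, of \<delta>] by linarith
      show "s\<^sup>2 + M \<le> 2 * M\<^sup>2" using s2 M self_le_power[OF M, of 2] by simp
    qed (use n S M N1 \<delta> sM B0 \<iota> s in \<open>auto intro!: divide_nonneg_nonneg mult_nonneg_nonneg\<close>)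
    also have "\<dots> = 6144 * M\<^sup>2 * \<rho> * B * \<iota> ^ 6 * (real d / (\<delta> * s ^ 6))"
      using s \<rho> \<iota> M \<delta> by (simp add: a_def S_def field_simps eval_nat_numeral)
    also have "\<dots> < exp (\<iota> / 2)" by (rule width)
    also have "\<dots> \<le> (1 + s / M) ^ n"
      by (rule exp_le_one_plus_power) (use s M n in \<open>auto simp: a_def field_simps\<close>)
    finally show "8 * S < (1 + s / M) ^ n * w" using w_pos by (simp add: field_simps)
    show "0 \<le> w" using w_pos by simp
  qed (use r fth S S1 S2R r_le fthS c in auto)
qed

lemma pgd_parameters:
  fixes f0 M \<rho> R :: real
  assumes f0: "0 \<le> f0" and M: "1 \<le> M" and \<rho>: "1 \<le> \<rho>" and R: "R * M \<le> 1" "M \<le> 6 * R * \<rho>"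
  obtains C :: real where "0 < C"
    "\<And>(d :: nat) \<epsilon> \<delta>. 1 \<le> d \<Longrightarrow> 0 < \<epsilon> \<Longrightarrow> sqrt \<epsilon> < M \<Longrightarrow> 0 < \<delta> \<Longrightarrow> \<delta> < 1 \<Longrightarrow>
      \<exists>(r :: real) fth S w c. \<exists>(n :: nat) T N.
        0 < r \<and> 0 < fth \<and> 0 < n \<and> \<epsilon> * r + M / 2 * r\<^sup>2 \<le> fth \<and> r \<le> S \<and> fth \<le> 1 \<and>
        4 * real n * fth \<le> M * S\<^sup>2 \<and> 0 \<le> S \<and> 2 * S \<le> R \<and> 6 * real n * \<rho> * S \<le> M \<and>
        8 * S < (1 + sqrt \<epsilon> / M) ^ n * w \<and> 0 \<le> w \<and> real d * real N * w \<le> r \<and> 0 < N \<and>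
        0 < c \<and> c \<le> \<epsilon>\<^sup>2 / (2 * M) \<and> c * (1 + real n) \<le> fth \<and> f0 / c + 1 + real n < real T \<and>
        real T * (3 / real N) \<le> \<delta> \<and>
        real T \<le> C * max 1 (1 / \<epsilon>\<^sup>2 * ln (real d / (\<epsilon> * \<delta>)) ^ 4)"
proof -
  define B where "B = 4608 * f0 * \<rho>\<^sup>2 * M + 5 * M ^ 4"
  have B: "0 < B" unfolding B_def using f0 M \<rho> by (intro add_nonneg_pos) auto
  define Q where "Q = 6144 * M\<^sup>2 * \<rho> * B"
  have Q: "0 < Q" using M \<rho> B by (simp add: Q_def)
  obtain A where A: "12 \<le> A" "\<And>x. A \<le> x \<Longrightarrow> Q * x ^ 6 < exp (x / 4)"
    using exp_dominates_power6[OF Q] by blast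
  show thesis
  proof (rule that[of "9 * (B * A ^ 4)"])
    show "0 < 9 * (B * A ^ 4)" using B A(1) by simp
    fix d :: nat and \<epsilon> \<delta> :: real
    assume d: "1 \<le> d" and \<epsilon>: "0 < \<epsilon>" "sqrt \<epsilon> < M" and \<delta>: "0 < \<delta>" "\<delta> < 1"
    define X where "X = real d / (\<epsilon> * \<delta>)"
    have X: "0 < X" using d \<epsilon> \<delta> by (simp add: X_def)
    define L where "L = max 1 (ln X)"
    have L: "1 \<le> L" "ln X \<le> L" by (auto simp: L_def)
    define \<iota> where "\<iota> = A * L"
    have \<iota>: "A \<le> \<iota>" "12 * L \<le> \<iota>"
      using A(1) L mult_left_mono[of 1 L A] mult_right_mono[of 12 A L] by (auto simp: \<iota>_def)
    define s where "s = sqrt \<epsilon>"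
    have s: "0 < s" "s < M" "s\<^sup>2 = \<epsilon>" using \<epsilon> by (auto simp: s_def)
    have s4: "s ^ 4 = \<epsilon>\<^sup>2" "s ^ 6 = \<epsilon> ^ 3" by (simp_all flip: s(3) power_mult)
    \<comment> \<open>The width condition sees dimension, tolerance and confidence only through a
      power of \<open>X\<close>, so a multiple of \<open>ln X\<close> suffices for
      \<open>\<iota>\<close>. One half of \<open>exp (\<iota> / 2)\<close>, in the exponent, absorbs
      this power and the other half the polynomial in \<open>\<iota>\<close>.\<close>
    have "real d / (\<delta> * \<epsilon> ^ 3) \<le> X ^ 3"
    proof -
      have "real d / (\<delta> * \<epsilon> ^ 3) = real d * \<delta>\<^sup>2 / (\<delta> * \<epsilon>) ^ 3"
        using \<delta> \<epsilon> by (simp add: field_simps eval_nat_numeral)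
      also have "\<dots> \<le> real d ^ 3 / (\<delta> * \<epsilon>) ^ 3"
      proof (intro divide_right_mono)
        have "real d * \<delta>\<^sup>2 \<le> real d * 1" using \<delta> by (intro mult_left_mono power_le_one) auto
        also have "\<dots> \<le> real d ^ 3" using d by (simp add: self_le_power)
        finally show "real d * \<delta>\<^sup>2 \<le> real d ^ 3" .
      qed (use \<delta> \<epsilon> in simp)
      finally show ?thesis by (simp add: X_def power_divide mult.commute)
    qed
    also have "\<dots> = exp (3 * ln X)" using exp_of_nat_mult[of 3 "ln X"] X by simp
    also have "\<dots> \<le> exp (\<iota> / 4)" using L \<iota> by simp
    finally have dX: "real d / (\<delta> * s ^ 6) \<le> exp (\<iota> / 4)" by (simp add: s4)
    have "Q * \<iota> ^ 6 * (real d / (\<delta> * s ^ 6)) \<le> Q * \<iota> ^ 6 * exp (\<iota> / 4)"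
      using Q by (intro mult_left_mono dX) auto
    also have "\<dots> < exp (\<iota> / 4) * exp (\<iota> / 4)" using A(2)[OF \<iota>(1)] by (intro mult_strict_right_mono) auto
    also have "\<dots> = exp (\<iota> / 2)" by (simp flip: exp_add)
    finally have width: "6144 * M\<^sup>2 * \<rho> * B * \<iota> ^ 6 * (real d / (\<delta> * s ^ 6)) < exp (\<iota> / 2)"
      by (simp add: Q_def)
    define Y where "Y = 1 / \<epsilon>\<^sup>2 * ln X ^ 4"
    have Y: "1 \<le> max 1 Y" "Y \<le> max 1 Y" by auto
    have BA: "0 \<le> B * A ^ 4" using B A(1) by simp
    have T_le: "B * \<iota> ^ 4 / s ^ 4 \<le> 9 * (B * A ^ 4) * max 1 Y"
    proof (cases "1 \<le> ln X")
      case True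
      have "B * \<iota> ^ 4 / s ^ 4 = (B * A ^ 4) * Y"
        using True by (simp add: \<iota>_def L_def s4 power_mult_distrib max_def Y_def)
      also have "\<dots> \<le> (B * A ^ 4) * max 1 Y" by (intro mult_left_mono Y BA)
      also have "\<dots> \<le> (9 * (B * A ^ 4)) * max 1 Y" using BA Y(1) by (intro mult_right_mono) auto
      finally show ?thesis .
    next
      case False
      \<comment> \<open>A small or negative logarithm occurs only for large tolerance:
        \<open>d \<ge> 1\<close> and \<open>\<delta> < 1\<close> force
        \<open>\<epsilon> \<ge> 1 / 3\<close>. Hence the factor \<open>9\<close> and the maximum
        with \<open>1\<close>.\<close>
      then have "X < exp 1" using X by (metis exp_less_mono exp_ln not_le)
      then have "X \<le> 3" using exp_le by linarith
      then have "real d \<le> 3 * (\<epsilon> * \<delta>)" using \<epsilon> \<delta> by (simp add: X_def field_simps)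
      also have "\<dots> \<le> 3 * (\<epsilon> * 1)" using \<epsilon> \<delta> by (intro mult_left_mono) auto
      finally have "1 \<le> 3 * \<epsilon>" using d by linarith
      then have "1 / \<epsilon> \<le> 3" using \<epsilon> by (simp add: field_simps)
      then have "(1 / \<epsilon>)\<^sup>2 \<le> 3\<^sup>2" using \<epsilon> by (intro power_mono) auto
      then have e9: "1 / \<epsilon>\<^sup>2 \<le> 9" by (simp add: power_divide)
      have "B * \<iota> ^ 4 / s ^ 4 = (B * A ^ 4) * (1 / \<epsilon>\<^sup>2)"
        using False by (simp add: \<iota>_def L_def s4 max_def)
      also have "\<dots> \<le> (B * A ^ 4) * 9" by (intro mult_left_mono e9 BA)
      also have "\<dots> = 9 * (B * A ^ 4) * 1" by simp
      also have "\<dots> \<le> 9 * (B * A ^ 4) * max 1 Y"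
        using BA by (intro mult_left_mono Y) auto
      finally show ?thesis .
    qed
    have "1 \<le> \<iota>" using \<iota> A(1) by simp
    obtain r fth S w c :: real and n T N :: nat where params:
      "0 < r" "0 < fth" "0 < n" "s\<^sup>2 * r + M / 2 * r\<^sup>2 \<le> fth" "r \<le> S" "fth \<le> 1"
      "4 * real n * fth \<le> M * S\<^sup>2" "0 \<le> S" "2 * S \<le> R" "6 * real n * \<rho> * S \<le> M"
      "8 * S < (1 + s / M) ^ n * w" "0 \<le> w" "real d * real N * w \<le> r" "0 < N"
      "0 < c" "c \<le> s ^ 4 / (2 * M)" "c * (1 + real n) \<le> fth" "f0 / c + 1 + real n < real T"
      "real T * (3 / real N) \<le> \<delta>" "real T \<le> B * \<iota> ^ 4 / s ^ 4"
      by (rule pgd_parameters_aux[OF f0 M \<rho> R s(1,2) d \<delta> \<open>1 \<le> \<iota>\<close> B_def width])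
    show "\<exists>(r :: real) fth S w c. \<exists>(n :: nat) T N.
        0 < r \<and> 0 < fth \<and> 0 < n \<and> \<epsilon> * r + M / 2 * r\<^sup>2 \<le> fth \<and> r \<le> S \<and> fth \<le> 1 \<and>
        4 * real n * fth \<le> M * S\<^sup>2 \<and> 0 \<le> S \<and> 2 * S \<le> R \<and> 6 * real n * \<rho> * S \<le> M \<and>
        8 * S < (1 + sqrt \<epsilon> / M) ^ n * w \<and> 0 \<le> w \<and> real d * real N * w \<le> r \<and> 0 < N \<and>
        0 < c \<and> c \<le> \<epsilon>\<^sup>2 / (2 * M) \<and> c * (1 + real n) \<le> fth \<and> f0 / c + 1 + real n < real T \<and>
        real T * (3 / real N) \<le> \<delta> \<and>
        real T \<le> 9 * (B * A ^ 4) * max 1 (1 / \<epsilon>\<^sup>2 * ln (real d / (\<epsilon> * \<delta>)) ^ 4)"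
      using params(1-19)[unfolded s(3) s4, unfolded s_def] order_trans[OF params(20) T_le, unfolded Y_def X_def]
      by - (rule exI[of _ r], rule exI[of _ fth], rule exI[of _ S], rule exI[of _ w], rule exI[of _ c],
          rule exI[of _ n], rule exI[of _ T], rule exI[of _ N], intro conjI)
  qed
qed

section \<open>Escape from strict saddles\<close>

text \<open>The condition on \<open>R\<close> keeps \<open>F\<close> at most \<open>f0 + 1\<close>
  on every segment of length at most \<open>R\<close> from a point of level \<open>f0\<close> or
  less, so the single value \<open>\<rho>2 (f0 + 1)\<close> serves as Lipschitz constant.\<close>

lemma Rspace_landscape:
  assumes min: "has_min_value_zero d F" and reg: "third_order_self_bounding d F \<rho>1 \<rho>2"
    and M: "0 < M" "\<rho>1 (f0 + 2) \<le> M" and \<rho>: "0 \<le> \<rho>" "\<rho>2 (f0 + 1) \<le> \<rho>"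
    and f0: "0 \<le> f0" and R: "R * (sqrt (2 * M * f0) + M / 2 * R) \<le> 1"
  shows "lipschitz_landscape (Rspace d) F (grad d F) (hess d F) f0 M R \<rho>"
proof -
  have F2: "twice_differentiable d F" and \<rho>1: "self_bound_fun \<rho>1" and
    op: "\<And>w. w \<in> Rspace d \<Longrightarrow> op_norm d (hess d F w) \<le> \<rho>1 (F w)"
    using reg by (auto simp: third_order_self_bounding_def second_order_self_bounding_def)
  then have F1: "F differentiable_on Rspace d" by (simp add: twice_differentiable_def)
  have nonneg: "0 \<le> F w" if "w \<in> Rspace d" for w
    using min that by (auto simp: has_min_value_zero_def)
  have line: "x + s *\<^sub>R v \<in> Rspace d" if "x \<in> Rspace d" "v \<in> Rspace d" for x v s
    using that by (intro subspace_add subspace_scale subspace_Rspace)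
  interpret self_bounded_landscape "Rspace d" F "grad d F" "hess d F" f0 M
  proof (rule self_bounded_landscape.intro)
    have "Rspace d \<inter> sphere 0 1 = (Rspace d \<inter> cball 0 1) \<inter> sphere 0 1" by auto
    moreover have "closed {x::rvec. norm x = 1}" by (intro closed_Collect_eq continuous_intros)
    then have "closed (sphere (0::rvec) 1)" by (simp add: sphere_def)
    ultimately show "compact (Rspace d \<inter> sphere 0 1)"
      by (simp only: compact_Int_closed[OF compact_Rspace_cball])
    show "((\<lambda>s. F (x + s *\<^sub>R v)) has_real_derivative grad d F (x + s *\<^sub>R v) \<bullet> v) (at s)"
      if "x \<in> Rspace d" "v \<in> Rspace d" for x v s
      unfolding has_real_derivative_iff_has_vector_derivative
      by (rule has_vector_derivative_along_line[OF subspace_Rspace that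
            gradient_has_derivative(2)[OF F1 line[OF that]]])
    show "((\<lambda>s. grad d F (x + s *\<^sub>R v)) has_vector_derivative hess d F (x + s *\<^sub>R v) v) (at s)"
      if "x \<in> Rspace d" "v \<in> Rspace d" for x v s
      by (rule has_vector_derivative_along_line[OF subspace_Rspace that
            hess_has_derivative[OF F2 line[OF that]]])
    show "norm (hess d F x v) \<le> M * norm v"
      if "x \<in> Rspace d" "v \<in> Rspace d" "F x \<le> f0 + 2" for x v
    proof -
      have "mono_on {0..} \<rho>1" using \<rho>1 by (simp add: self_bound_fun_def)
      then have "\<rho>1 (F x) \<le> \<rho>1 (f0 + 2)"
        using that nonneg[OF that(1)] by (intro mono_onD[of "{0..}" \<rho>1]) auto
      then have "op_norm d (hess d F x) \<le> M" using op[OF that(1)] M by linarith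
      then have "op_norm d (hess d F x) * norm v \<le> M * norm v" by (intro mult_right_mono) auto
      then show ?thesis
        using norm_le_op_norm[OF hess_bounded_linear[OF F2 that(1)] that(2)] by linarith
    qed
  qed (use M nonneg F1 F2 in \<open>auto intro: subspace_Rspace gradient_has_derivative
      hess_bounded_linear hess_in_Rspace hess_symmetric\<close>)
  show ?thesis
  proof
    show "norm (hess d F x v - hess d F u v) \<le> \<rho> * norm (x - u) * norm v"
      if u: "u \<in> Rspace d" "F u \<le> f0" and x: "x \<in> Rspace d" "norm (x - u) \<le> R"
        and v: "v \<in> Rspace d" for u x v
    proof -
      have "norm (hess d F x v - hess d F u v) \<le> \<rho>2 (f0 + 1) * norm (x - u) * norm v"
      proof (rule hess_lipschitz_on_segment[OF reg nonneg u(1) x(1) v])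
        fix s :: real assume s: "0 \<le> s" "s \<le> 1"
        define y where "y = u + s *\<^sub>R (x - u)"
        have y: "y \<in> Rspace d"
          unfolding y_def using u x by (intro line subspace_diff subspace_Rspace)
        have "norm (y - u) \<le> 1 * norm (x - u)"
          unfolding y_def using s by (simp add: mult_left_le_one_le)
        then have yR: "norm (y - u) \<le> R" using x by linarith
        then have R0: "0 \<le> R" using norm_ge_zero order_trans by blast
        have "norm (grad d F u) * norm (y - u) + M / 2 * (norm (y - u))\<^sup>2
            \<le> sqrt (2 * M * f0) * R + M / 2 * R\<^sup>2"
          using yR M f0 gradient_bound[OF u] by (intro add_mono mult_mono mult_left_mono power_mono) auto
        also have "\<dots> \<le> 1" using R by (simp add: algebra_simps power2_eq_square)
        finally have le1: "norm (grad d F u) * norm (y - u) + M / 2 * (norm (y - u))\<^sup>2 \<le> 1" .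
        show "F (u + s *\<^sub>R (x - u)) \<le> f0 + 1"
          using nearby_value[OF u(1) y u(2) le1] le1 u by (simp add: y_def)
      qed
      also have "\<dots> \<le> \<rho> * norm (x - u) * norm v" using \<rho> by (intro mult_right_mono) auto
      finally show ?thesis .
    qed
  qed (use \<rho> in auto)
qed

lemma escape_probability:
  assumes land: "lipschitz_landscape (Rspace d) F (grad d F) (hess d F) f0 M R \<rho>"
    and proc: "pgd_process d F r"
    and d: "1 \<le> d" and \<epsilon>: "0 < \<epsilon>"
    and u: "u \<in> Rspace d" "F u \<le> f0" "norm (grad d F u) \<le> \<epsilon>"
    and saddle: "\<not> psd d (\<lambda>v. hess d F u v + sqrt \<epsilon> *\<^sub>R v)"
    and r: "\<epsilon> * r + M / 2 * r\<^sup>2 \<le> fth" "r \<le> S" and fth: "fth \<le> 1" "4 * real n * fth \<le> M * S\<^sup>2"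
    and S: "0 \<le> S" "2 * S \<le> R" "6 * real n * \<rho> * S \<le> M"
    and w: "8 * S < (1 + sqrt \<epsilon> / M) ^ n * w" "0 \<le> w" "real d * real N * w \<le> r" and N: "0 < N"
  shows "measure (uniform_ball d r)
    {z \<in> Rspace d. - fth < F ((gd_step d F (1 / M) ^^ n) (u + z)) - F u} \<le> 3 / real N"
proof -
  interpret lipschitz_landscape "Rspace d" F "grad d F" "hess d F" f0 M R \<rho> by (rule land)
  interpret P: pgd_process d F "1 / M" r \<epsilon> fth n by (rule proc)
  interpret U: prob_space "uniform_ball d r" by (rule prob_space_uniform_ball[OF P.r_pos])
  have gd: "gd = gd_step d F (1 / M)" by (auto simp: gd_def gd_step_def)
  obtain v where v: "v \<in> Rspace d" "v \<bullet> hess d F u v < - sqrt \<epsilon> * (v \<bullet> v)"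
    using saddle by (auto simp: psd_def inner_add_right not_le)
  have s0: "0 \<le> sqrt \<epsilon>" using \<epsilon> by simp
  obtain e where e: "e \<in> Rspace d" "norm e = 1"
    and thin: "\<And>z z' \<mu>. z \<in> Rspace d \<Longrightarrow> norm z \<le> r \<Longrightarrow> F u - fth < F ((gd ^^ n) (u + z)) \<Longrightarrow>
      z' \<in> Rspace d \<Longrightarrow> norm z' \<le> r \<Longrightarrow> F u - fth < F ((gd ^^ n) (u + z')) \<Longrightarrow>
      z' - z = \<mu> *\<^sub>R e \<Longrightarrow> \<bar>\<mu>\<bar> < w"
    by (rule stuck_set_thin[OF u v s0 r fth S w(1)]) blast
  define E where "E = {z \<in> Rspace d. - fth < F ((gd_step d F (1 / M) ^^ n) (u + z)) - F u}"
  have "{z \<in> space (borel_Rspace d). - fth < F ((gd_step d F (1 / M) ^^ n) (u + z)) - F u} \<in> sets (borel_Rspace d)"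
  proof -
    have "(\<lambda>z. u + z) \<in> borel_Rspace d \<rightarrow>\<^sub>M borel_Rspace d"
      by (rule P.measurable_Rspace_add) (use u in auto)
    note [measurable] = measurable_compose[OF this measurable_compose[OF P.measurable_gd_iter P.measurable_F]]
    show ?thesis by measurable
  qed
  then have E: "E \<in> sets (borel_Rspace d)" by (simp add: E_def)
  define X where "X = E \<inter> (Rspace d \<inter> cball 0 r)"
  have X: "X \<in> sets (borel_Rspace d)" unfolding X_def by (rule sets.Int[OF E Rspace_cball_sets])
  have out: "Rspace d - cball 0 r \<in> sets (borel_Rspace d)"
  proof -
    have "Rspace d - cball 0 r = space (borel_Rspace d) - (Rspace d \<inter> cball 0 r)" by auto
    then show ?thesis using Rspace_cball_sets[of d r] by (metis sets.compl_sets)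
  qed
  have "measure (uniform_ball d r) E \<le> measure (uniform_ball d r) (X \<union> (Rspace d - cball 0 r))"
    using X out by (intro U.finite_measure_mono) (auto simp: X_def E_def)
  also have "\<dots> \<le> measure (uniform_ball d r) X + measure (uniform_ball d r) (Rspace d - cball 0 r)"
    using X out by (intro measure_Un_le) auto
  also have "measure (uniform_ball d r) (Rspace d - cball 0 r) = 0"
    by (rule uniform_ball_outside[OF P.r_pos])
  also have "measure (uniform_ball d r) X \<le> 3 / real N"
  proof (rule thin_set_measure[OF d P.r_pos N w(2,3) X _ e])
    show "X \<subseteq> cball 0 r" by (auto simp: X_def)
    show "\<bar>\<mu>\<bar> < w" if "x \<in> X" "y \<in> X" "y - x = \<mu> *\<^sub>R e" for x y \<mu>
      using that by (intro thin[of x y]) (auto simp: X_def E_def gd)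
  qed
  finally show ?thesis by (simp add: E_def)
qed

lemma pgd_process_of_regular:
  assumes "third_order_self_bounding d F \<rho>1 \<rho>2" "0 < r"
  shows "pgd_process d F r"
proof
  have F2: "F differentiable_on Rspace d" "grad d F differentiable_on Rspace d"
    using assms by (auto simp: third_order_self_bounding_def second_order_self_bounding_def
        twice_differentiable_def)
  show "continuous_on (Rspace d) F" "continuous_on (Rspace d) (grad d F)"
    using F2 by (auto intro: differentiable_imp_continuous_on)
  show "grad d F w \<in> Rspace d" if "w \<in> Rspace d" for w
    by (rule gradient_has_derivative(1)[OF F2(1) that])
qed (rule assms(2))

text \<open>Escape is a hypothesis so that both tolerance regimes share this conclusion, the large
  one with \<open>p = 0\<close>.\<close>

lemma pgd_finds_second_order_point:
  assumes reg: "third_order_self_bounding d F \<rho>1 \<rho>2"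
    and land: "lipschitz_landscape (Rspace d) F (grad d F) (hess d F) f0 M R \<rho>"
    and w: "w0 \<in> Rspace d" "F w0 \<le> f0" and r: "0 < r" and \<epsilon>: "0 < \<epsilon>"
    and c: "0 < c" "c \<le> \<epsilon>\<^sup>2 / (2 * M)" "c * (1 + real n) \<le> fth" "f0 / c + 1 + real n < real T"
    and p: "0 \<le> p" "real T * p \<le> \<delta>"
    and escape: "\<And>u. u \<in> Rspace d \<Longrightarrow> F u \<le> f0 \<Longrightarrow> norm (grad d F u) \<le> \<epsilon> \<Longrightarrow>
      \<not> psd d (\<lambda>v. hess d F u v + sqrt \<epsilon> *\<^sub>R v) \<Longrightarrow>
      measure (uniform_ball d r) {z \<in> Rspace d. - fth < F ((gd_step d F (1 / M) ^^ n) (u + z)) - F u} \<le> p"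
  shows "measure (pgd_noise d r) {\<xi> \<in> space (pgd_noise d r).
    \<exists>v. pgd_outputs_within d F (1 / M) \<epsilon> fth n w0 \<xi> T v \<and> norm (grad d F v) \<le> \<epsilon> \<and>
      psd d (\<lambda>h. hess d F v h + sqrt \<epsilon> *\<^sub>R h)} \<ge> 1 - \<delta>"
proof -
  interpret lipschitz_landscape "Rspace d" F "grad d F" "hess d F" f0 M R \<rho> by (rule land)
  interpret P: pgd_process d F "1 / M" r \<epsilon> fth n by (rule pgd_process_of_regular[OF reg r])
  define Q where "Q v \<longleftrightarrow> norm (grad d F v) \<le> \<epsilon> \<and> psd d (\<lambda>h. hess d F v h + sqrt \<epsilon> *\<^sub>R h)" for v
  have "{v \<in> space (borel_Rspace d). psd d (\<lambda>h. hess d F v h + sqrt \<epsilon> *\<^sub>R h)} \<in> sets (borel_Rspace d)"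
    using psd_shifted_hess_closed[OF reg, of "sqrt \<epsilon>"]
    by (auto simp: sets_borel_Rspace_iff intro: borel_closed)
  then have [measurable]: "Measurable.pred (borel_Rspace d) (\<lambda>v. psd d (\<lambda>h. hess d F v h + sqrt \<epsilon> *\<^sub>R h))"
    by (simp add: pred_def)
  note [measurable] = P.measurable_norm_grad
  have Q: "Measurable.pred (borel_Rspace d) Q" unfolding Q_def by measurable
  have "measure (pgd_noise d r) {\<xi> \<in> space (pgd_noise d r).
      \<exists>v. pgd_outputs_within d F (1 / M) \<epsilon> fth n w0 \<xi> T v \<and> Q v} \<ge> 1 - \<delta>"
  proof (rule P.pgd_success_probability[OF w F_nonneg c(1) _ c(3,4) Q p])
    show "F (gd_step d F (1 / M) u) \<le> F u - c"
      if u: "u \<in> Rspace d" "F u \<le> f0" "\<epsilon> < norm (grad d F u)" for u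
    proof -
      have "\<epsilon>\<^sup>2 / (2 * M) \<le> (norm (grad d F u))\<^sup>2 / (2 * M)"
        using u \<epsilon> M_pos by (intro divide_right_mono power_mono) auto
      then show ?thesis
        using descent_step[OF u(1)] u(2) c(2) by (simp add: gd_step_def)
    qed
  qed (use escape in \<open>auto simp: Q_def\<close>)
  then show ?thesis by (simp add: Q_def)
qed

text \<open>If \<open>sqrt \<epsilon>\<close> exceeds the curvature bound \<open>M\<close> of the sublevel set, no point of it is a
  strict saddle, so the escape condition is vacuous.\<close>

lemma pgd_large_tolerance:
  assumes M: "1 \<le> M" and \<epsilon>: "0 < \<epsilon>" "M \<le> sqrt \<epsilon>" and \<delta>: "0 < \<delta>" and f0: "0 \<le> f0"
  obtains T :: nat where "real T \<le> 2 * f0 + 4"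
    "\<And>d F w0 R \<rho> \<rho>1 \<rho>2. third_order_self_bounding d F \<rho>1 \<rho>2 \<Longrightarrow>
      lipschitz_landscape (Rspace d) F (grad d F) (hess d F) f0 M R \<rho> \<Longrightarrow> w0 \<in> Rspace d \<Longrightarrow> F w0 \<le> f0 \<Longrightarrow>
      measure (pgd_noise d 1) {\<xi> \<in> space (pgd_noise d 1).
        \<exists>v. pgd_outputs_within d F (1 / M) \<epsilon> (\<epsilon>\<^sup>2 / M) 1 w0 \<xi> T v \<and> norm (grad d F v) \<le> \<epsilon> \<and>
          psd d (\<lambda>h. hess d F v h + sqrt \<epsilon> *\<^sub>R h)} \<ge> 1 - \<delta>"
proof -
  \<comment> \<open>With one inner step the threshold \<open>\<epsilon>\<^sup>2 / M\<close> is
    exactly \<open>c * (1 + 1)\<close>.\<close>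
  define c where "c = \<epsilon>\<^sup>2 / (2 * M)"
  have c: "0 < c" using \<epsilon> M by (simp add: c_def)
  have s1: "1 \<le> sqrt \<epsilon>" using M \<epsilon> by linarith
  then have e1: "1 \<le> \<epsilon>" by simp
  have "sqrt \<epsilon> * 1 \<le> sqrt \<epsilon> * sqrt \<epsilon>" using s1 by (intro mult_left_mono) auto
  then have "M \<le> \<epsilon>" using \<epsilon> by simp
  also have "\<epsilon> \<le> \<epsilon>\<^sup>2" using e1 by (simp add: self_le_power)
  finally have "M * f0 \<le> \<epsilon>\<^sup>2 * f0" using f0 by (intro mult_right_mono) auto
  \<comment> \<open>Since \<open>1 \<le> M \<le> sqrt \<epsilon>\<close> gives
    \<open>M \<le> \<epsilon>\<^sup>2\<close>, the number of calls is bounded independently of the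
    tolerance.\<close>
  then have f0c: "f0 / c \<le> 2 * f0" using \<epsilon> M by (simp add: c_def field_simps)
  have f0c0: "0 \<le> f0 / c" using f0 c by simp
  define T where "T = nat \<lceil>f0 / c\<rceil> + 3"
  have T: "f0 / c + 3 \<le> real T" "real T \<le> f0 / c + 4" unfolding T_def using f0c0 by linarith+
  show thesis
  proof (rule that[of T])
    show "real T \<le> 2 * f0 + 4" using T f0c by linarith
    fix d F w0 R \<rho> \<rho>1 \<rho>2
    assume reg: "third_order_self_bounding d F \<rho>1 \<rho>2"
      and land: "lipschitz_landscape (Rspace d) F (grad d F) (hess d F) f0 M R \<rho>"
      and w0: "w0 \<in> Rspace d" "F w0 \<le> f0"
    interpret lipschitz_landscape "Rspace d" F "grad d F" "hess d F" f0 M R \<rho> by (rule land)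
    have no_saddle: "psd d (\<lambda>v. hess d F u v + sqrt \<epsilon> *\<^sub>R v)" if u: "u \<in> Rspace d" "F u \<le> f0" for u
      unfolding psd_def
    proof
      fix v assume v: "v \<in> Rspace d"
      have "- (v \<bullet> hess d F u v) \<le> norm v * norm (hess d F u v)"
        using norm_cauchy_schwarz[of v "- hess d F u v"] by simp
      also have "\<dots> \<le> norm v * (M * norm v)" using u v by (intro mult_left_mono H_bound) auto
      also have "\<dots> = M * (v \<bullet> v)" by (simp add: power2_norm_eq_inner[symmetric] power2_eq_square)
      also have "\<dots> \<le> sqrt \<epsilon> * (v \<bullet> v)" using \<epsilon> by (intro mult_right_mono) auto
      finally show "0 \<le> v \<bullet> (hess d F u v + sqrt \<epsilon> *\<^sub>R v)" by (simp add: inner_add_right)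
    qed
    show "measure (pgd_noise d 1) {\<xi> \<in> space (pgd_noise d 1).
        \<exists>v. pgd_outputs_within d F (1 / M) \<epsilon> (\<epsilon>\<^sup>2 / M) 1 w0 \<xi> T v \<and> norm (grad d F v) \<le> \<epsilon> \<and>
          psd d (\<lambda>h. hess d F v h + sqrt \<epsilon> *\<^sub>R h)} \<ge> 1 - \<delta>"
      by (rule pgd_finds_second_order_point[OF reg land w0 _ \<epsilon>(1) c, where p = 0])
         (use no_saddle T \<delta> M in \<open>auto simp: c_def\<close>)
  qed
qed

theorem theorem3p4:
  fixes \<rho>1 \<rho>2 :: "real \<Rightarrow> real" and f0 :: real
  shows "\<exists>C>0. \<forall>d::nat. \<forall>\<epsilon>::real. \<forall>\<delta>::real. 1 \<le> d \<and> 0 < \<epsilon> \<and> 0 < \<delta> \<and> \<delta> < 1 \<longrightarrow>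
    (\<exists>\<eta> r gthres fthres :: real. \<exists>tthres T :: nat.
       0 < \<eta> \<and> 0 < r \<and> 0 < gthres \<and> 0 < fthres \<and> 0 < tthres \<and>
       real T \<le> C * max 1 (1 / \<epsilon>\<^sup>2 * ln (real d / (\<epsilon> * \<delta>)) ^ 4) \<and>
       (\<forall>(F :: rvec \<Rightarrow> real) w0.
          has_min_value_zero d F \<and> third_order_self_bounding d F \<rho>1 \<rho>2 \<and>
          w0 \<in> Rspace d \<and> F w0 = f0 \<longrightarrow>
          measure (pgd_noise d r)
            {\<xi> \<in> space (pgd_noise d r).
               \<exists>w. pgd_outputs_within d F \<eta> gthres fthres tthres w0 \<xi> T w \<and>
                   norm (grad d F w) \<le> \<epsilon> \<and>
                   psd d (\<lambda>v. hess d F w v + sqrt \<epsilon> *\<^sub>R v)} \<ge> 1 - \<delta>))"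
proof (cases "0 \<le> f0")
  case False
  \<comment> \<open>No admissible run starts at a negative value, so the claim is vacuous and any
    parameters serve.\<close>
  have "has_min_value_zero d F \<Longrightarrow> w0 \<in> Rspace d \<Longrightarrow> F w0 \<noteq> f0" for d F w0
    using False by (auto simp: has_min_value_zero_def)
  then show ?thesis
    by (intro exI[of _ 1] conjI allI impI exI[of _ "1::real"] exI[of _ "1::nat"] exI[of _ "0::nat"]) auto
next
  case f0: True
  define M where "M = max 1 (\<rho>1 (f0 + 2))"
  have M: "1 \<le> M" "\<rho>1 (f0 + 2) \<le> M" by (auto simp: M_def)
  define G where "G = sqrt (2 * M * f0)"
  have G: "0 \<le> G" using M f0 by (simp add: G_def)
  \<comment> \<open>One radius that meets both \<open>R * M \<le> 1\<close> and
    \<open>R * (G + M / 2 * R) \<le> 1\<close>, where \<open>G\<close> bounds the gradient on the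
    sublevel set.\<close>
  define R where "R = 1 / (G + M + 1)"
  have R: "0 < R" "R * (G + M + 1) = 1" using G M by (auto simp: R_def)
  have RG: "0 \<le> R * G" and RMpos: "0 \<le> R * M" using R G M by auto
  have R_eq: "R * G + R * M + R = 1" using R(2) by (simp add: algebra_simps)
  have RM: "R * M \<le> 1" using R_eq RG R(1) by linarith
  have R1: "R \<le> 1" using R_eq RG RMpos by linarith
  have "R * (M / 2 * R) = R * M * (R / 2)" by simp
  also have "\<dots> \<le> R * M * 1" using R1 RMpos by (intro mult_left_mono) auto
  finally have "R * (M / 2 * R) \<le> R * M * 1" .
  then have RGM: "R * (G + M / 2 * R) \<le> 1" using R_eq R(1) unfolding distrib_left by linarith
  \<comment> \<open>The Lipschitz constant is enlarged to \<open>M / (6 * R)\<close> so that the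
    confinement radius \<open>2 * S\<close> fits into \<open>R\<close>.\<close>
  define \<rho> where "\<rho> = max (max 1 (\<rho>2 (f0 + 1))) (M / (6 * R))"
  have \<rho>: "1 \<le> \<rho>" "\<rho>2 (f0 + 1) \<le> \<rho>" "M / (6 * R) \<le> \<rho>" by (auto simp: \<rho>_def)
  then have M_le: "M \<le> 6 * R * \<rho>" using R by (simp add: field_simps)
  have land: "lipschitz_landscape (Rspace d) F (grad d F) (hess d F) f0 M R \<rho>"
    if "has_min_value_zero d F" "third_order_self_bounding d F \<rho>1 \<rho>2" for d F
    by (rule Rspace_landscape[OF that _ M(2) _ \<rho>(2) f0 RGM[unfolded G_def]]) (use M \<rho> in auto)
  obtain C where C: "0 < C"
    "\<And>(d :: nat) \<epsilon> \<delta>. 1 \<le> d \<Longrightarrow> 0 < \<epsilon> \<Longrightarrow> sqrt \<epsilon> < M \<Longrightarrow> 0 < \<delta> \<Longrightarrow> \<delta> < 1 \<Longrightarrow>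
      \<exists>(r :: real) fth S w c. \<exists>(n :: nat) T N.
        0 < r \<and> 0 < fth \<and> 0 < n \<and> \<epsilon> * r + M / 2 * r\<^sup>2 \<le> fth \<and> r \<le> S \<and> fth \<le> 1 \<and>
        4 * real n * fth \<le> M * S\<^sup>2 \<and> 0 \<le> S \<and> 2 * S \<le> R \<and> 6 * real n * \<rho> * S \<le> M \<and>
        8 * S < (1 + sqrt \<epsilon> / M) ^ n * w \<and> 0 \<le> w \<and> real d * real N * w \<le> r \<and> 0 < N \<and>
        0 < c \<and> c \<le> \<epsilon>\<^sup>2 / (2 * M) \<and> c * (1 + real n) \<le> fth \<and> f0 / c + 1 + real n < real T \<and>
        real T * (3 / real N) \<le> \<delta> \<and>
        real T \<le> C * max 1 (1 / \<epsilon>\<^sup>2 * ln (real d / (\<epsilon> * \<delta>)) ^ 4)"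
    by (rule pgd_parameters[OF f0 M(1) \<rho>(1) RM M_le]) blast
  \<comment> \<open>The second entry covers the large-tolerance regime, where the maximum in the
    bound is used only through its value \<open>1\<close>.\<close>
  define C' where "C' = max C (2 * f0 + 4)"
  have C': "0 < C'" "C \<le> C'" "2 * f0 + 4 \<le> C'" using C(1) by (auto simp: C'_def)
  show ?thesis
  proof (rule exI[of _ C'], intro conjI allI impI C'(1))
    fix d :: nat and \<epsilon> \<delta> :: real
    assume "1 \<le> d \<and> 0 < \<epsilon> \<and> 0 < \<delta> \<and> \<delta> < 1"
    then have d: "1 \<le> d" and \<epsilon>: "0 < \<epsilon>" and \<delta>: "0 < \<delta>" "\<delta> < 1" by auto
    define K where "K = max 1 (1 / \<epsilon>\<^sup>2 * ln (real d / (\<epsilon> * \<delta>)) ^ 4)"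
    have K: "1 \<le> K" by (simp add: K_def)
    have "\<exists>\<eta> r gthres fthres :: real. \<exists>tthres T :: nat.
       0 < \<eta> \<and> 0 < r \<and> 0 < gthres \<and> 0 < fthres \<and> 0 < tthres \<and> real T \<le> C' * K \<and>
       (\<forall>(F :: rvec \<Rightarrow> real) w0.
          has_min_value_zero d F \<and> third_order_self_bounding d F \<rho>1 \<rho>2 \<and>
          w0 \<in> Rspace d \<and> F w0 = f0 \<longrightarrow>
          measure (pgd_noise d r)
            {\<xi> \<in> space (pgd_noise d r).
               \<exists>w. pgd_outputs_within d F \<eta> gthres fthres tthres w0 \<xi> T w \<and>
                   norm (grad d F w) \<le> \<epsilon> \<and>
                   psd d (\<lambda>v. hess d F w v + sqrt \<epsilon> *\<^sub>R v)} \<ge> 1 - \<delta>)"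
    proof (cases "sqrt \<epsilon> < M")
      case True
      from C(2)[OF d \<epsilon> True \<delta>, folded K_def]
      obtain r fth S w c :: real and n T N :: nat where params:
        "0 < r" "0 < fth" "0 < n" "\<epsilon> * r + M / 2 * r\<^sup>2 \<le> fth" "r \<le> S" "fth \<le> 1"
        "4 * real n * fth \<le> M * S\<^sup>2" "0 \<le> S" "2 * S \<le> R" "6 * real n * \<rho> * S \<le> M"
        "8 * S < (1 + sqrt \<epsilon> / M) ^ n * w" "0 \<le> w" "real d * real N * w \<le> r" "0 < N"
        "0 < c" "c \<le> \<epsilon>\<^sup>2 / (2 * M)" "c * (1 + real n) \<le> fth" "f0 / c + 1 + real n < real T"
        "real T * (3 / real N) \<le> \<delta>" "real T \<le> C * K"
        by (elim exE conjE)
      have "C * K \<le> C' * K" using C' K by (intro mult_right_mono) auto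
      then have T: "real T \<le> C' * K" using params(20) by linarith
      have "measure (pgd_noise d r) {\<xi> \<in> space (pgd_noise d r).
          \<exists>w. pgd_outputs_within d F (1 / M) \<epsilon> fth n w0 \<xi> T w \<and> norm (grad d F w) \<le> \<epsilon> \<and>
            psd d (\<lambda>v. hess d F w v + sqrt \<epsilon> *\<^sub>R v)} \<ge> 1 - \<delta>"
        if H: "has_min_value_zero d F" "third_order_self_bounding d F \<rho>1 \<rho>2" "w0 \<in> Rspace d" "F w0 = f0"
        for F w0
      proof (rule pgd_finds_second_order_point[OF H(2) land[OF H(1,2)] H(3) _ params(1) \<epsilon>
            params(15-18) _ params(19)])
        fix u assume u: "u \<in> Rspace d" "F u \<le> f0" "norm (grad d F u) \<le> \<epsilon>"
          "\<not> psd d (\<lambda>v. hess d F u v + sqrt \<epsilon> *\<^sub>R v)"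
        show "measure (uniform_ball d r)
            {z \<in> Rspace d. - fth < F ((gd_step d F (1 / M) ^^ n) (u + z)) - F u} \<le> 3 / real N"
          by (rule escape_probability[OF land[OF H(1,2)] pgd_process_of_regular[OF H(2) params(1)]
                d \<epsilon> u params(4-14)])
      qed (use H in auto)
      with params(1-3) T M \<epsilon> show ?thesis
        by (intro exI[of _ "1 / M"] exI[of _ r] exI[of _ \<epsilon>] exI[of _ fth] exI[of _ n] exI[of _ T]) auto
    next
      case False
      then have "M \<le> sqrt \<epsilon>" by simp
      obtain T :: nat where T: "real T \<le> 2 * f0 + 4" and
        success: "\<And>d F w0 R \<rho> \<rho>1 \<rho>2. third_order_self_bounding d F \<rho>1 \<rho>2 \<Longrightarrow>
          lipschitz_landscape (Rspace d) F (grad d F) (hess d F) f0 M R \<rho> \<Longrightarrow> w0 \<in> Rspace d \<Longrightarrow> F w0 \<le> f0 \<Longrightarrow>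
          measure (pgd_noise d 1) {\<xi> \<in> space (pgd_noise d 1).
            \<exists>v. pgd_outputs_within d F (1 / M) \<epsilon> (\<epsilon>\<^sup>2 / M) 1 w0 \<xi> T v \<and> norm (grad d F v) \<le> \<epsilon> \<and>
              psd d (\<lambda>h. hess d F v h + sqrt \<epsilon> *\<^sub>R h)} \<ge> 1 - \<delta>"
        by (rule pgd_large_tolerance[OF M(1) \<epsilon> \<open>M \<le> sqrt \<epsilon>\<close> \<delta>(1) f0]) blast
      have "C' * 1 \<le> C' * K" using C' K by (intro mult_left_mono) auto
      then have TK: "real T \<le> C' * K" using T C' by linarith
      have ev: "measure (pgd_noise d 1) {\<xi> \<in> space (pgd_noise d 1).
          \<exists>w. pgd_outputs_within d F (1 / M) \<epsilon> (\<epsilon>\<^sup>2 / M) 1 w0 \<xi> T w \<and> norm (grad d F w) \<le> \<epsilon> \<and>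
            psd d (\<lambda>v. hess d F w v + sqrt \<epsilon> *\<^sub>R v)} \<ge> 1 - \<delta>"
        if H: "has_min_value_zero d F" "third_order_self_bounding d F \<rho>1 \<rho>2" "w0 \<in> Rspace d" "F w0 = f0"
        for F w0
        by (rule success[OF H(2) land[OF H(1,2)] H(3) eq_refl[OF H(4)]])
      have pos: "0 < 1 / M" "0 < \<epsilon>\<^sup>2 / M" using M \<epsilon> by auto
      show ?thesis
        by (intro exI[of _ "1 / M"] exI[of _ 1] exI[of _ \<epsilon>] exI[of _ "\<epsilon>\<^sup>2 / M"] exI[of _ "1::nat"] exI[of _ T])
           (use pos TK ev \<epsilon> in auto)
    qed
    then show "\<exists>\<eta> r gthres fthres :: real. \<exists>tthres T :: nat.
       0 < \<eta> \<and> 0 < r \<and> 0 < gthres \<and> 0 < fthres \<and> 0 < tthres \<and>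
       real T \<le> C' * max 1 (1 / \<epsilon>\<^sup>2 * ln (real d / (\<epsilon> * \<delta>)) ^ 4) \<and>
       (\<forall>(F :: rvec \<Rightarrow> real) w0.
          has_min_value_zero d F \<and> third_order_self_bounding d F \<rho>1 \<rho>2 \<and>
          w0 \<in> Rspace d \<and> F w0 = f0 \<longrightarrow>
          measure (pgd_noise d r)
            {\<xi> \<in> space (pgd_noise d r).
               \<exists>w. pgd_outputs_within d F \<eta> gthres fthres tthres w0 \<xi> T w \<and>
                   norm (grad d F w) \<le> \<epsilon> \<and>
                   psd d (\<lambda>v. hess d F w v + sqrt \<epsilon> *\<^sub>R v)} \<ge> 1 - \<delta>)"
      unfolding K_def .
  qed
qed

end
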